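(* Let $d\ge 1$ be a fixed integer. There is an algorithm that, given $n\ge 1$ and $n+1$ full-dimensional polytopes $\mathcal{P}_i=\{x\in\mathbb{R}^d : A^ix\le b^i\}$, $i\in\{0,1,\ldots,n\}$, specified by these inequality descriptions, computes a facet-describing inequality system for $$\mathcal{D}:=\operatorname{conv}\left(\bigcup_{i=0}^n\left\{\begin{pmatrix}x\\ \mathbf{e}_i\end{pmatrix} : x\in\mathcal{P}_i\right\}\right)\subset\mathbb{R}^{d+n}$$ in time polynomial in the input size (with $d$ considered to be a constant).
   Context: $\mathbf{e}_i$ denotes the $i$-th standard unit vector of $\mathbb{R}^n$ for $i\in\{1,\ldots,n\}$, and $\mathbf{e}_0$ denotes the zero vector of $\mathbb{R}^n$. The input data $A^i,b^i$ are rational, each $A^i$ has $d$ columns, and no inequality in any system $A^ix\le b^i$ is redundant; the input size is the total encoding length of $n$ and of all $A^i,b^i$. A facet-describing inequality system for $\mathcal{D}$ is a finite system of linear inequalities in $\mathbb{R}^{d+n}$ whose solution set is $\mathcal{D}$, each inequality of which describes a facet of $\mathcal{D}$ (i.e., it is valid for $\mathcal{D}$ and the set of points of $\mathcal{D}$ satisfying it with equality is a face of dimension $\dim\mathcal{D}-1$), with every facet of $\mathcal{D}$ described. *)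

theory Defs
  imports
    "HOL-Analysis.Analysis"
    "HOL-Analysis.Finite_Function_Topology"
    "HOL-Library.Log_Nat"
    "HOL-Computational_Algebra.Polynomial"
begin

section \<open>Polyhedral geometry in real coordinate space of variable dimension\<close>

text \<open>
  The dimension \<open>d + n\<close> depends on the input of the algorithm and hence cannot be a type.
  The space \<open>\<real>\<^sup>m\<close> is therefore the subspace \<open>Rn m\<close> of the real vector space of finitely
  supported sequences, with coordinates numbered from \<open>0\<close> to \<open>m - 1\<close>.
\<close>

type_synonym point = "nat \<Rightarrow>\<^sub>0 real"

definition Rn :: "nat \<Rightarrow> point set"
  where "Rn m = {x. \<forall>j\<ge>m. Poly_Mapping.lookup x j = 0}"

text \<open>
  The library restricts \<^const>\<open>aff_dim\<close> and \<^const>\<open>facet_of\<close> to Euclidean spaces; the following are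
  the same definitions over an arbitrary real vector space.  They are only used for sets
  of finite affine dimension (\<^const>\<open>card\<close> is \<open>0\<close> on infinite sets).
\<close>

definition affdim :: "'a::real_vector set \<Rightarrow> int"
  where "affdim V =
    (SOME d. \<exists>B. affine hull B = affine hull V \<and> \<not> affine_dependent B \<and> of_nat (card B) = d + 1)"

definition facet :: "'a::real_vector set \<Rightarrow> 'a set \<Rightarrow> bool"
  where "facet F S \<longleftrightarrow> F face_of S \<and> F \<noteq> {} \<and> affdim F = affdim S - 1"

lemma affdim_eq_aff_dim: "affdim V = aff_dim (V :: 'a::euclidean_space set)"
  by (simp add: affdim_def aff_dim_def)

lemma facet_iff_facet_of: "facet F S \<longleftrightarrow> F facet_of (S :: 'a::euclidean_space set)"
  by (simp add: facet_def facet_of_def affdim_eq_aff_dim)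

subsection \<open>Rational inequality systems\<close>

text \<open>The pair \<open>(a, b)\<close> stands for the inequality \<open>a \<bullet> x \<le> b\<close>.\<close>

type_synonym ineq = "rat list \<times> rat"

definition lin :: "rat list \<Rightarrow> point \<Rightarrow> real"
  where "lin a x = (\<Sum>j<length a. of_rat (a ! j) * Poly_Mapping.lookup x j)"

definition has_columns :: "nat \<Rightarrow> ineq list \<Rightarrow> bool"
  where "has_columns m S \<longleftrightarrow> (\<forall>(a, b) \<in> set S. length a = m)"

definition solutions :: "nat \<Rightarrow> ineq list \<Rightarrow> point set"
  where "solutions m S = {x \<in> Rn m. \<forall>(a, b) \<in> set S. lin a x \<le> of_rat b}"

text \<open>Redundancy refers to positions, so an irredundant system has no repeated inequality.\<close>

definition irredundant :: "nat \<Rightarrow> ineq list \<Rightarrow> bool"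
  where "irredundant m S \<longleftrightarrow>
    (\<forall>k<length S. solutions m (take k S @ drop (Suc k) S) \<noteq> solutions m S)"

definition describes_facet :: "ineq \<Rightarrow> point set \<Rightarrow> point set \<Rightarrow> bool"
  where "describes_facet c F D \<longleftrightarrow>
    (\<forall>x\<in>D. lin (fst c) x \<le> of_rat (snd c)) \<and>
    F = {x \<in> D. lin (fst c) x = of_rat (snd c)} \<and> facet F D"

definition facet_describing :: "nat \<Rightarrow> ineq list \<Rightarrow> point set \<Rightarrow> bool"
  where "facet_describing m S D \<longleftrightarrow>
    has_columns m S \<and> solutions m S = D \<and>
    (\<forall>c \<in> set S. \<exists>F. describes_facet c F D) \<and>
    (\<forall>F. facet F D \<longrightarrow> (\<exists>c \<in> set S. describes_facet c F D))"

subsection \<open>The polytope \<open>\<D>\<close>\<close>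

text \<open>
  \<open>lift d x i\<close> is the point of \<open>\<real>\<^bsup>d + n\<^esup>\<close> composed of \<open>x \<in> \<real>\<^sup>d\<close> and the unit vector \<open>e\<^sub>i \<in> \<real>\<^sup>n\<close>,
  where \<open>e\<^sub>0 = 0\<close>.  The \<open>n\<close> last coordinates have the positions \<open>d, \<dots>, d + n - 1\<close>,
  so the entry \<open>1\<close> of \<open>e\<^sub>i\<close> is at position \<open>d + i - 1\<close>.
\<close>

definition lift :: "nat \<Rightarrow> point \<Rightarrow> nat \<Rightarrow> point"
  where "lift d x i = x + (if i = 0 then 0 else Poly_Mapping.single (d + i - 1) 1)"

definition cayley :: "nat \<Rightarrow> nat \<Rightarrow> (nat \<Rightarrow> point set) \<Rightarrow> point set"
  where "cayley d n P = convex hull (\<Union>i\<in>{0..n}. {lift d x i |x. x \<in> P i})"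


section \<open>Polynomial time\<close>

text \<open>
  The model of computation is a first-order functional language with general recursion over
  S-expressions with integer atoms.  Costs are logarithmic: every operation is charged
  according to the binary length of the data it handles, multiplication according to
  the schoolbook method.  As all data that are ever created are paid for in this way, a computation
  of cost \<open>t\<close> can be simulated by a Turing machine in time polynomial in \<open>t\<close>; conversely
  the language simulates Turing machines with polynomial overhead.  Polynomial time thus has its
  usual meaning.
\<close>

datatype data = Atom int | Node data data

primrec dsize :: "data \<Rightarrow> nat" where
  "dsize (Atom k) = 1 + floorlog 2 (nat \<bar>k\<bar>)"
| "dsize (Node u v) = 1 + dsize u + dsize v"

datatype binop = MkNode | Plus | Minus | Times | Leq

datatype unop = Fst | Snd | IsNode

text \<open>Variables are de Bruijn indices; \<open>Call f\<close> refers to the \<open>f\<close>-th function of the program.\<close>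

datatype expr =
    Var nat
  | Lit int
  | Op1 unop expr
  | Op2 binop expr expr
  | Cond expr expr expr
  | LetIn expr expr
  | Call nat expr

text \<open>Operations applied to arguments of the wrong shape return the atom \<open>0\<close>.\<close>

fun val1 :: "unop \<Rightarrow> data \<Rightarrow> data" where
  "val1 Fst (Node u v) = u"
| "val1 Snd (Node u v) = v"
| "val1 IsNode (Node u v) = Atom 1"
| "val1 _ (Atom k) = Atom 0"

fun val2 :: "binop \<Rightarrow> data \<Rightarrow> data \<Rightarrow> data" where
  "val2 MkNode u v = Node u v"
| "val2 Plus (Atom k) (Atom l) = Atom (k + l)"
| "val2 Minus (Atom k) (Atom l) = Atom (k - l)"
| "val2 Times (Atom k) (Atom l) = Atom (k * l)"
| "val2 Leq (Atom k) (Atom l) = Atom (if k \<le> l then 1 else 0)"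
| "val2 _ _ _ = Atom 0"

definition cost2 :: "binop \<Rightarrow> data \<Rightarrow> data \<Rightarrow> nat"
  where "cost2 f u v = (if f = Times then dsize u * dsize v else dsize u + dsize v)"

text \<open>
  \<open>eval fs env e v t\<close>: in the program \<open>fs\<close>, the expression \<open>e\<close> evaluates to \<open>v\<close> with cost \<open>t\<close>.
  The body of a function sees its only argument as variable \<open>0\<close>.  The atom \<open>0\<close>, which also
  serves as the empty list, counts as false, all other data as true.
\<close>

inductive eval :: "expr list \<Rightarrow> data list \<Rightarrow> expr \<Rightarrow> data \<Rightarrow> nat \<Rightarrow> bool"
  for fs :: "expr list"
where
  Var: "i < length env \<Longrightarrow> eval fs env (Var i) (env ! i) (dsize (env ! i))"
| Lit: "eval fs env (Lit k) (Atom k) (dsize (Atom k))"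
| Op1: "eval fs env e u t \<Longrightarrow> eval fs env (Op1 f e) (val1 f u) (t + dsize u)"
| Op2: "eval fs env e1 u t1 \<Longrightarrow> eval fs env e2 v t2 \<Longrightarrow>
    eval fs env (Op2 f e1 e2) (val2 f u v) (t1 + t2 + cost2 f u v)"
| Cond_True: "eval fs env e c t \<Longrightarrow> c \<noteq> Atom 0 \<Longrightarrow> eval fs env e1 v t' \<Longrightarrow>
    eval fs env (Cond e e1 e2) v (t + t' + 1)"
| Cond_False: "eval fs env e (Atom 0) t \<Longrightarrow> eval fs env e2 v t' \<Longrightarrow>
    eval fs env (Cond e e1 e2) v (t + t' + 1)"
| LetIn: "eval fs env e1 u t1 \<Longrightarrow> eval fs (u # env) e2 v t2 \<Longrightarrow>
    eval fs env (LetIn e1 e2) v (t1 + t2 + 1)"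
| Call: "f < length fs \<Longrightarrow> eval fs env e u t1 \<Longrightarrow> eval fs [u] (fs ! f) v t2 \<Longrightarrow>
    eval fs env (Call f e) v (t1 + t2 + 1)"

inductive_cases eval_elims:
  "eval fs env (Var i) v t"
  "eval fs env (Lit k) v t"
  "eval fs env (Op1 f e) v t"
  "eval fs env (Op2 f e1 e2) v t"
  "eval fs env (Cond e e1 e2) v t"
  "eval fs env (LetIn e1 e2) v t"
  "eval fs env (Call f e) v t"

lemma eval_deterministic:
  assumes "eval fs env e v t" and "eval fs env e v' t'"
  shows "v' = v \<and> t' = t"
  using assms
proof (induction arbitrary: v' t' rule: eval.induct)
  case Var
  then show ?case by (blast elim: eval_elims)
next
  case Lit
  then show ?case by (auto elim: eval_elims)
next
  case Op1
  from Op1.prems show ?case by (elim eval_elims) (auto dest: Op1.IH)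
next
  case Op2
  from Op2.prems show ?case by (elim eval_elims) (auto dest: Op2.IH)
next
  case Cond_True
  from Cond_True.prems show ?case
    by (elim eval_elims) (use Cond_True.hyps in \<open>auto dest: Cond_True.IH\<close>)
next
  case Cond_False
  from Cond_False.prems show ?case
    by (elim eval_elims) (auto dest: Cond_False.IH)
next
  case LetIn
  from LetIn.prems show ?case by (elim eval_elims) (auto dest!: LetIn.IH)
next
  case Call
  from Call.prems show ?case by (elim eval_elims) (auto dest!: Call.IH)
qed

text \<open>Function \<open>0\<close> is the main function.\<close>

definition computes :: "expr list \<Rightarrow> data \<Rightarrow> data \<Rightarrow> nat \<Rightarrow> bool"
  where "computes fs u v t \<longleftrightarrow> eval fs [u] (Call 0 (Var 0)) v t"

text \<open>
  \<open>poly_time_solvable enc_in enc_out valid sol\<close>: there is an algorithm that maps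
  every instance \<open>x\<close> with \<open>valid x\<close> to some \<open>y\<close> with \<open>sol x y\<close> in time polynomial in the size
  of the encoding of \<open>x\<close>.
\<close>

definition poly_time_solvable ::
    "('a \<Rightarrow> data) \<Rightarrow> ('b \<Rightarrow> data) \<Rightarrow> ('a \<Rightarrow> bool) \<Rightarrow> ('a \<Rightarrow> 'b \<Rightarrow> bool) \<Rightarrow> bool"
  where "poly_time_solvable enc_in enc_out valid sol \<longleftrightarrow>
    (\<exists>fs. \<exists>p :: nat poly. \<forall>x. valid x \<longrightarrow>
      (\<exists>y t. computes fs (enc_in x) (enc_out y) t \<and> t \<le> poly p (dsize (enc_in x)) \<and> sol x y))"

subsection \<open>Encodings\<close>

definition enc_list :: "('a \<Rightarrow> data) \<Rightarrow> 'a list \<Rightarrow> data"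
  where "enc_list enc xs = foldr (\<lambda>x u. Node (enc x) u) xs (Atom 0)"

definition enc_rat :: "rat \<Rightarrow> data"
  where "enc_rat r = (let (p, q) = quotient_of r in Node (Atom p) (Atom q))"

definition enc_ineq :: "ineq \<Rightarrow> data"
  where "enc_ineq c = Node (enc_list enc_rat (fst c)) (enc_rat (snd c))"

definition enc_system :: "ineq list \<Rightarrow> data"
  where "enc_system = enc_list enc_ineq"

text \<open>An instance consists of \<open>n\<close> and the list of the \<open>n + 1\<close> systems \<open>A\<^sup>i x \<le> b\<^sup>i\<close>.\<close>

definition enc_instance :: "nat \<times> ineq list list \<Rightarrow> data"
  where "enc_instance x = Node (Atom (int (fst x))) (enc_list enc_system (snd x))"

definition valid_instance :: "nat \<Rightarrow> nat \<times> ineq list list \<Rightarrow> bool"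
  where "valid_instance d = (\<lambda>(n, Ss). n \<ge> 1 \<and> length Ss = n + 1 \<and>
    (\<forall>i\<in>{0..n}. has_columns d (Ss ! i) \<and> irredundant d (Ss ! i) \<and>
      polytope (solutions d (Ss ! i)) \<and> affdim (solutions d (Ss ! i)) = int d))"

end

theory Submission
  imports Defs
begin

text \<open>
  Write \<open>\<lambda>\<^sub>0 = 1 - \<lambda>\<^sub>1 - \<dots> - \<lambda>\<^sub>n\<close> for the remaining barycentric coordinate of the simplex spanned
  by \<open>e\<^sub>0, \<dots>, e\<^sub>n\<close>. Every affine inequality on \<open>\<real>\<^bsup>d + n\<^esup>\<close> then has the form \<open>a \<bullet> x \<le> \<Sum>\<^sub>i h\<^sub>i \<lambda>\<^sub>i\<close>,
  and it is valid for \<open>\<D>\<close> iff \<open>a \<bullet> x \<le> h\<^sub>i\<close> is valid for every \<open>\<P>\<^sub>i\<close>. If it describes a facet,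
  there are two cases. For \<open>a = 0\<close> it is a positive multiple of some \<open>0 \<le> \<lambda>\<^sub>k\<close>. For \<open>a \<noteq> 0\<close> no
  \<open>h\<^sub>i\<close> can be lowered, so \<open>h\<^sub>i\<close> is the maximum of \<open>a\<close> over \<open>\<P>\<^sub>i\<close>; and the differences of vertices
  of the faces where these maxima are attained, each difference being taken within a single \<open>\<P>\<^sub>i\<close>,
  span the hyperplane orthogonal to \<open>a\<close>. Hence \<open>a\<close> is determined up to a scalar by some \<open>d - 1\<close>
  such differences.

  This gives the algorithm. The vertices of \<open>\<P>\<^sub>i\<close> are found by solving every choice of \<open>d\<close>
  inequalities as equations; the candidates for \<open>a\<close> are the vectors orthogonal to \<open>d - 1\<close>
  differences of vertices; a candidate survives if each chosen difference lies in a face on which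
  the candidate is maximal; and \<open>h\<^sub>i\<close> is found by comparing all vertices of \<open>\<P>\<^sub>i\<close>. As \<open>d\<close> is a
  constant there are only polynomially many choices, and every loop that depends on \<open>d\<close> can be
  unrolled into the program. The machine has no division, so vertices are kept in integer
  homogeneous coordinates, orthogonal complements are computed by fraction-free elimination
  (\<open>int_basis_orth_step\<close>), and the coefficients that are output are integers.

  For the running time, \<open>ptime\<close> is shown to be closed under composition and under recursion along
  a list with results of polynomial size (\<open>ptime_lrec\<close>), from which the usual list operations
  follow.

  For correctness, a facet of \<open>conv W\<close> is characterised without mentioning dimensions: a valid
  inequality, strict somewhere, describes a facet iff every affine functional that vanishes on the
  tight points of \<open>W\<close> is a multiple of it (\<open>facet_functional\<close>). Three facts about this notion hold
  for every finite full-dimensional \<open>W\<close> in a nonzero space: such functionals define facets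
  (\<open>facet_functional_facet\<close>), every facet arises in this way (\<open>facet_has_functional\<close>), and
  together they cut out \<open>conv W\<close> (\<open>facet_functionals_describe_hull\<close>). It then remains to compare
  them with the output: each output inequality is a facet functional (\<open>listed_facet_functional\<close>),
  and each facet functional is a positive multiple of an output inequality
  (\<open>facet_functional_listed\<close>).
\<close>

section \<open>Linking programs and bounding costs\<close>

text \<open>
  Two programs are linked by concatenating their function lists. The first keeps its calls
  unchanged; those of the second are renumbered by \<open>shift\<close> below.
\<close>

lemma eval_append: "eval fs env e v t \<Longrightarrow> eval (fs @ gs) env e v t"
proof (induction rule: eval.induct)
  case (Call f env e u t1 v t2)
  then show ?case using eval.Call[of f "fs @ gs" env e u t1 v t2] by (simp add: nth_append)
qed (blast intro: eval.intros)+

lemma eval_weaken: "eval fs env e v t \<Longrightarrow> eval fs (env @ env') e v t"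
proof (induction rule: eval.induct)
  case (Var i env)
  then show ?case using eval.Var[of i "env @ env'" fs] by (simp add: nth_append)
qed (simp_all only: append_Cons, (blast intro: eval.intros)+)

primrec shift :: "nat \<Rightarrow> expr \<Rightarrow> expr" where
  "shift k (Var i) = Var i"
| "shift k (Lit c) = Lit c"
| "shift k (Op1 f e) = Op1 f (shift k e)"
| "shift k (Op2 f e1 e2) = Op2 f (shift k e1) (shift k e2)"
| "shift k (Cond e e1 e2) = Cond (shift k e) (shift k e1) (shift k e2)"
| "shift k (LetIn e1 e2) = LetIn (shift k e1) (shift k e2)"
| "shift k (Call f e) = Call (k + f) (shift k e)"

lemma eval_shift:
  "eval fs env e v t \<Longrightarrow>
    eval (gs @ map (shift (length gs)) fs) env (shift (length gs) e) v t"
proof (induction rule: eval.induct)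
  case (Call f env e u t1 v t2)
  then show ?case
    using eval.Call[of "length gs + f" "gs @ map (shift (length gs)) fs" env "shift (length gs) e" u t1 v t2]
    by (simp add: nth_append)
qed (simp_all only: shift.simps, (blast intro: eval.intros)+)

lemma dsize_pos: "1 \<le> dsize u"
  by (cases u) auto

lemma dsize_Atom_le: "nat \<bar>k\<bar> < 2 ^ w \<Longrightarrow> dsize (Atom k) \<le> Suc w"
  by (simp add: floorlog_leI)

lemma nat_abs_less_dsize: "nat \<bar>k\<bar> < 2 ^ (dsize (Atom k) - 1)"
  using floorlog_leD[of 2 "nat \<bar>k\<bar>" "floorlog 2 (nat \<bar>k\<bar>)"] by simp

lemma dsize_Atom_plus: "nat \<bar>m\<bar> \<le> nat \<bar>k\<bar> + nat \<bar>l\<bar> \<Longrightarrow> dsize (Atom m) \<le> dsize (Atom k) + dsize (Atom l)"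
proof -
  assume m: "nat \<bar>m\<bar> \<le> nat \<bar>k\<bar> + nat \<bar>l\<bar>"
  define a b where "a = dsize (Atom k) - 1" and "b = dsize (Atom l) - 1"
  have "nat \<bar>k\<bar> < 2 ^ a" "nat \<bar>l\<bar> < 2 ^ b"
    unfolding a_def b_def by (rule nat_abs_less_dsize)+
  moreover have "(2::nat) ^ a \<le> 2 ^ (a + b)" "(2::nat) ^ b \<le> 2 ^ (a + b)"
    by (auto intro: power_increasing)
  ultimately have "nat \<bar>m\<bar> < 2 ^ (a + b) + 2 ^ (a + b)" using m by linarith
  then have "nat \<bar>m\<bar> < 2 ^ (a + b + 1)" by (simp only: power_add power_one_right mult_2_right)
  from dsize_Atom_le[OF this] show ?thesis unfolding a_def b_def
    using dsize_pos[of "Atom k"] dsize_pos[of "Atom l"] by linarith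
qed

lemma dsize_Atom_times: "dsize (Atom (k * l)) + 1 \<le> dsize (Atom k) + dsize (Atom l)"
proof -
  define a b where "a = dsize (Atom k) - 1" and "b = dsize (Atom l) - 1"
  have "nat \<bar>k\<bar> < 2 ^ a" "nat \<bar>l\<bar> < 2 ^ b"
    unfolding a_def b_def by (rule nat_abs_less_dsize)+
  then have "nat \<bar>k * l\<bar> < 2 ^ (a + b)"
    unfolding abs_mult nat_mult_distrib[OF abs_ge_zero] power_add
    by (intro mult_strict_mono) auto
  from dsize_Atom_le[OF this] show ?thesis unfolding a_def b_def
    using dsize_pos[of "Atom k"] dsize_pos[of "Atom l"] by linarith
qed

lemma dsize_val1: "dsize (val1 f u) \<le> dsize u + 1"
  by (cases f; cases u) (auto simp: floorlog_def)

lemma dsize_val2: "dsize (val2 f u v) \<le> dsize u + dsize v + cost2 f u v"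
proof (cases "\<exists>k l. u = Atom k \<and> v = Atom l")
  case True
  then obtain k l where uv: "u = Atom k" "v = Atom l" by blast
  have "f = Plus \<or> f = Minus \<Longrightarrow> dsize (val2 f u v) \<le> dsize u + dsize v"
    unfolding uv by (auto simp del: dsize.simps intro!: dsize_Atom_plus)
  moreover have "f = Times \<Longrightarrow> dsize (val2 f u v) \<le> dsize u + dsize v"
    unfolding uv using dsize_Atom_times[of k l] by (simp del: dsize.simps)
  moreover have "f = MkNode \<or> f = Leq \<Longrightarrow> dsize (val2 f u v) \<le> dsize u + dsize v + cost2 f u v"
    unfolding uv by (auto simp: cost2_def floorlog_def)
  ultimately show ?thesis by (cases f) auto
next
  case False
  then show ?thesis using dsize_pos[of u] dsize_pos[of v]
    by (cases f; cases u; cases v) (auto simp: cost2_def floorlog_def)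
qed

text \<open>
  Every datum is paid for when it is created, so a bound on the cost of a computation is also a
  bound on the size of its result. Closure of polynomial time under composition rests on this.
\<close>

lemma eval_size: "eval fs env e v t \<Longrightarrow> dsize v \<le> t"
proof (induction rule: eval.induct)
  case (Op1 env e u t f)
  then show ?case using dsize_val1[of f u] dsize_pos[of u] by linarith
next
  case (Op2 env e1 u t1 e2 v t2 f)
  then show ?case using dsize_val2[of f u v] by linarith
qed auto

text \<open>
  Exact costs are replaced by upper bounds, which can be weakened to a uniform shape.
\<close>

definition evals :: "expr list \<Rightarrow> data list \<Rightarrow> expr \<Rightarrow> data \<Rightarrow> nat \<Rightarrow> bool"
  where "evals fs env e v T \<longleftrightarrow> (\<exists>t\<le>T. eval fs env e v t)"

lemma evals_mono: "evals fs env e v T \<Longrightarrow> T \<le> T' \<Longrightarrow> evals fs env e v T'"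
  unfolding evals_def by (meson le_trans)

lemma evals_size: "evals fs env e v T \<Longrightarrow> dsize v \<le> T"
  unfolding evals_def using eval_size le_trans by blast

lemma evals_Var: "i < length env \<Longrightarrow> evals fs env (Var i) (env ! i) (dsize (env ! i))"
  unfolding evals_def by (meson eval.Var order_refl)

lemma evals_Lit: "evals fs env (Lit k) (Atom k) (dsize (Atom k))"
  unfolding evals_def by (meson eval.Lit order_refl)

lemma evals_Op1: "evals fs env e u T \<Longrightarrow> evals fs env (Op1 f e) (val1 f u) (T + dsize u)"
  unfolding evals_def by (meson eval.Op1 add_right_mono)

lemma evals_Op2: "evals fs env e1 u T1 \<Longrightarrow> evals fs env e2 v T2 \<Longrightarrow>
    evals fs env (Op2 f e1 e2) (val2 f u v) (T1 + T2 + cost2 f u v)"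
  unfolding evals_def by (meson eval.Op2 add_mono order_refl)

lemma evals_Cond:
  assumes "evals fs env c u T" "u \<noteq> Atom 0 \<Longrightarrow> evals fs env e1 v T'" "u = Atom 0 \<Longrightarrow> evals fs env e2 v T'"
  shows "evals fs env (Cond c e1 e2) v (T + T' + 1)"
proof -
  from assms(1) obtain t where t: "t \<le> T" "eval fs env c u t" unfolding evals_def by blast
  show ?thesis
  proof (cases "u = Atom 0")
    case True
    then obtain t' where "t' \<le> T'" "eval fs env e2 v t'" using assms(3) unfolding evals_def by blast
    then show ?thesis using t True unfolding evals_def
      using eval.Cond_False[of fs env c t e2 v t' e1] by (intro exI[of _ "t + t' + 1"]) auto
  next
    case False
    then obtain t' where "t' \<le> T'" "eval fs env e1 v t'" using assms(2) unfolding evals_def by blast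
    then show ?thesis using t False unfolding evals_def
      using eval.Cond_True[of fs env c u t e1 v t' e2] by (intro exI[of _ "t + t' + 1"]) auto
  qed
qed

lemma evals_LetIn: "evals fs env e1 u T1 \<Longrightarrow> evals fs (u # env) e2 v T2 \<Longrightarrow>
    evals fs env (LetIn e1 e2) v (T1 + T2 + 1)"
  unfolding evals_def by (meson eval.LetIn add_mono order_refl)

lemma evals_Call: "f < length fs \<Longrightarrow> evals fs env e u T1 \<Longrightarrow> evals fs [u] (fs ! f) v T2 \<Longrightarrow>
    evals fs env (Call f e) v (T1 + T2 + 1)"
  unfolding evals_def by (meson eval.Call add_mono order_refl)

lemma evals_append: "evals fs env e v T \<Longrightarrow> evals (fs @ gs) env e v T"
  unfolding evals_def using eval_append by blast

lemma evals_weaken: "evals fs env e v T \<Longrightarrow> evals fs (env @ env') e v T"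
  unfolding evals_def using eval_weaken by blast

lemma evals_weaken1: "evals fs [u] e v T \<Longrightarrow> evals fs (u # env') e v T"
  using evals_weaken[of fs "[u]"] by simp

lemma evals_shift: "evals fs env e v T \<Longrightarrow>
    evals (gs @ map (shift (length gs)) fs) env (shift (length gs) e) v T"
  unfolding evals_def using eval_shift by blast

section \<open>Functions computable in polynomial time\<close>

text \<open>
  The computation is an expression with the encoded argument as its only variable, rather than
  function \<open>0\<close> of a program. Expressions compose by \<open>LetIn\<close> and linked programs need no entry
  point; \<open>ptime_solvable\<close> adds the entry point in the end.
\<close>

definition ptime :: "('a \<Rightarrow> data) \<Rightarrow> ('b \<Rightarrow> data) \<Rightarrow> ('a \<Rightarrow> 'b) \<Rightarrow> bool"
  where "ptime ea eb f \<longleftrightarrow>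
    (\<exists>fs e p. \<forall>x. evals fs [ea x] e (eb (f x)) (poly p (dsize (ea x))))"

lemma poly_nat_mono: "x \<le> y \<Longrightarrow> poly p x \<le> poly p (y::nat)"
  by (induction p) (auto intro!: add_mono mult_mono)

lemma ptimeI:
  assumes "\<And>x. evals fs [ea x] e (eb (f x)) (T x)" "\<And>x. T x \<le> poly p (dsize (ea x))"
  shows "ptime ea eb f"
  unfolding ptime_def using assms evals_mono by blast

lemma ptime_link:
  assumes "ptime ea eb f" "ptime ec ed g"
  obtains fs e p e' p' where
    "\<And>x. evals fs [ea x] e (eb (f x)) (poly p (dsize (ea x)))"
    "\<And>x. evals fs [ec x] e' (ed (g x)) (poly p' (dsize (ec x)))"
proof -
  obtain fs e p where 1: "\<And>x. evals fs [ea x] e (eb (f x)) (poly p (dsize (ea x)))"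
    using assms(1) unfolding ptime_def by blast
  obtain gs e' p' where 2: "\<And>x. evals gs [ec x] e' (ed (g x)) (poly p' (dsize (ec x)))"
    using assms(2) unfolding ptime_def by blast
  show thesis
    by (rule that[of "fs @ map (shift (length fs)) gs" e p "shift (length fs) e'" p'])
       (use 1 2 evals_append evals_shift in blast)+
qed

lemma ptime_solvable:
  assumes "ptime ea eb f" "\<And>x. valid x \<Longrightarrow> sol x (f x)"
  shows "poly_time_solvable ea eb valid sol"
proof -
  obtain fs e p where 1: "\<And>x. evals fs [ea x] e (eb (f x)) (poly p (dsize (ea x)))"
    using assms(1) unfolding ptime_def by blast
  define F where "F = shift 1 e # map (shift 1) fs"
  define q where "q = [:0,1:] + p + [:1:]"
  have "\<exists>t. computes F (ea x) (eb (f x)) t \<and> t \<le> poly q (dsize (ea x))" for x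
  proof -
    have "evals F [ea x] (shift 1 e) (eb (f x)) (poly p (dsize (ea x)))"
      using evals_shift[OF 1, of "[shift 1 e]"] unfolding F_def by simp
    then have "evals F [ea x] (Call 0 (Var 0)) (eb (f x)) (dsize (ea x) + poly p (dsize (ea x)) + 1)"
      using evals_Call[of 0 F "[ea x]" "Var 0" "ea x" "dsize (ea x)"] evals_Var[of 0 "[ea x]" F]
      by (simp add: F_def)
    then show ?thesis unfolding evals_def computes_def q_def by auto
  qed
  then show ?thesis unfolding poly_time_solvable_def using assms(2) by blast
qed

lemma ptime_id: "ptime ea ea (\<lambda>x. x)"
  by (rule ptimeI[of "[]" _ "Var 0" _ _ "\<lambda>x. dsize (ea x)" "[:0,1:]"])
     (use evals_Var[of 0 "[ea x]" "[]" for x] in auto)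

lemma ptime_comp:
  assumes "ptime eb ec g" "ptime ea eb f"
  shows "ptime ea ec (\<lambda>x. g (f x))"
proof -
  obtain fs e p e' p' where
    1: "\<And>x. evals fs [ea x] e (eb (f x)) (poly p (dsize (ea x)))" and
    2: "\<And>x. evals fs [eb x] e' (ec (g x)) (poly p' (dsize (eb x)))"
    using ptime_link[OF assms(2,1)] by blast
  show ?thesis
  proof (rule ptimeI)
    fix x
    show "evals fs [ea x] (LetIn e e') (ec (g (f x)))
        (poly p (dsize (ea x)) + poly p' (dsize (eb (f x))) + 1)"
      by (rule evals_LetIn[OF 1 evals_weaken1[OF 2]])
    show "poly p (dsize (ea x)) + poly p' (dsize (eb (f x))) + 1
        \<le> poly (p + pcompose p' p + [:1:]) (dsize (ea x))"
      using poly_nat_mono[OF evals_size[OF 1[of x]], of p'] by (simp add: poly_pcompose)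
  qed
qed

text \<open>
  Constants of every type are allowed because each datum is the value of a closed expression. In
  particular, data that depend only on the dimension may be written into the program.
\<close>

lemma ptime_const: "ptime ea eb (\<lambda>x. c)"
proof -
  have "\<exists>e T. \<forall>env. evals [] env e u T" for u
  proof (induction u)
    case (Atom k)
    then show ?case using evals_Lit by blast
  next
    case (Node u v)
    then obtain e1 T1 e2 T2 where "\<forall>env. evals [] env e1 u T1" "\<forall>env. evals [] env e2 v T2" by blast
    then have "\<forall>env. evals [] env (Op2 MkNode e1 e2) (val2 MkNode u v) (T1 + T2 + cost2 MkNode u v)"
      using evals_Op2 by blast
    then show ?case by (simp only: val2.simps) blast
  qed
  then obtain e T where "\<forall>env. evals [] env e (eb c) T" by blast
  then show ?thesis by (intro ptimeI[where T = "\<lambda>x. T" and p = "[:T:]"]) auto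
qed

lemma ptime_op1:
  assumes "ptime ea eb f" "\<And>x. val1 uop (eb (f x)) = ec (g x)"
  shows "ptime ea ec g"
proof -
  obtain fs e p where 1: "\<And>x. evals fs [ea x] e (eb (f x)) (poly p (dsize (ea x)))"
    using assms(1) unfolding ptime_def by blast
  show ?thesis
  proof (rule ptimeI)
    fix x
    show "evals fs [ea x] (Op1 uop e) (ec (g x)) (poly p (dsize (ea x)) + dsize (eb (f x)))"
      using evals_Op1[OF 1, of x uop] assms(2) by simp
    show "poly p (dsize (ea x)) + dsize (eb (f x)) \<le> poly (p + p) (dsize (ea x))"
      using evals_size[OF 1[of x]] by simp
  qed
qed

lemma ptime_op2:
  assumes "ptime ea eb f" "ptime ea ec g" "\<And>x. val2 bop (eb (f x)) (ec (g x)) = ed (h x)"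
  shows "ptime ea ed h"
proof -
  obtain fs e p e' p' where
    1: "\<And>x. evals fs [ea x] e (eb (f x)) (poly p (dsize (ea x)))" and
    2: "\<And>x. evals fs [ea x] e' (ec (g x)) (poly p' (dsize (ea x)))"
    using ptime_link[OF assms(1,2)] by blast
  show ?thesis
  proof (rule ptimeI)
    fix x
    let ?S = "dsize (ea x)"
    show "evals fs [ea x] (Op2 bop e e') (ed (h x))
        (poly p ?S + poly p' ?S + cost2 bop (eb (f x)) (ec (g x)))"
      using evals_Op2[OF 1[of x] 2[of x], of bop] assms(3) by simp
    have "dsize (eb (f x)) \<le> poly p ?S" "dsize (ec (g x)) \<le> poly p' ?S"
      using evals_size 1 2 by blast+
    then have "cost2 bop (eb (f x)) (ec (g x)) \<le> poly p ?S + poly p' ?S + poly p ?S * poly p' ?S"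
      unfolding cost2_def by (auto intro: mult_le_mono add_mono trans_le_add2 trans_le_add1)
    then show "poly p ?S + poly p' ?S + cost2 bop (eb (f x)) (ec (g x))
        \<le> poly (p + p' + p + p' + p * p') ?S"
      by simp
  qed
qed

definition enc_pair :: "('a \<Rightarrow> data) \<Rightarrow> ('b \<Rightarrow> data) \<Rightarrow> 'a \<times> 'b \<Rightarrow> data"
  where "enc_pair ea eb p = Node (ea (fst p)) (eb (snd p))"

definition enc_bool :: "bool \<Rightarrow> data"
  where "enc_bool b = Atom (if b then 1 else 0)"

lemma enc_list_simps [simp]:
  "enc_list ea [] = Atom 0" "enc_list ea (x # xs) = Node (ea x) (enc_list ea xs)"
  by (simp_all add: enc_list_def)

lemma ptime_if:
  assumes "ptime ea enc_bool b" "ptime ea eb f" "ptime ea eb g"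
  shows "ptime ea eb (\<lambda>x. if b x then f x else g x)"
proof -
  obtain fs1 e p where
    1: "\<And>x. evals fs1 [ea x] e (enc_bool (b x)) (poly p (dsize (ea x)))"
    using assms(1) unfolding ptime_def by blast
  obtain fs2 e1 e2 q r where
    2: "\<And>x. evals fs2 [ea x] e1 (eb (f x)) (poly q (dsize (ea x)))" and
    3: "\<And>x. evals fs2 [ea x] e2 (eb (g x)) (poly r (dsize (ea x)))"
    using ptime_link[OF assms(2,3)] by blast
  define fs where "fs = fs1 @ map (shift (length fs1)) fs2"
  let ?s = "shift (length fs1)"
  show ?thesis
  proof (rule ptimeI)
    fix x
    let ?S = "dsize (ea x)"
    have b2: "evals fs [ea x] (?s e1) (eb (f x)) (poly q ?S + poly r ?S)"
      unfolding fs_def by (rule evals_mono[OF evals_shift[OF 2]]) simp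
    have b3: "evals fs [ea x] (?s e2) (eb (g x)) (poly q ?S + poly r ?S)"
      unfolding fs_def by (rule evals_mono[OF evals_shift[OF 3]]) simp
    have b1: "evals fs [ea x] e (enc_bool (b x)) (poly p ?S)"
      unfolding fs_def by (rule evals_append[OF 1])
    show "evals fs [ea x] (Cond e (?s e1) (?s e2)) (eb (if b x then f x else g x))
        (poly p ?S + (poly q ?S + poly r ?S) + 1)"
      by (rule evals_Cond[OF b1]) (use b2 b3 in \<open>auto simp: enc_bool_def\<close>)
    show "poly p ?S + (poly q ?S + poly r ?S) + 1 \<le> poly (p + (q + r) + [:1:]) ?S" by simp
  qed
qed

lemma ptime_pair: "ptime ea eb f \<Longrightarrow> ptime ea ec g \<Longrightarrow> ptime ea (enc_pair eb ec) (\<lambda>x. (f x, g x))"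
  by (erule (1) ptime_op2[where bop = MkNode]) (auto simp: enc_pair_def)

lemma ptime_fst: "ptime ea (enc_pair eb ec) f \<Longrightarrow> ptime ea eb (\<lambda>x. fst (f x))"
  by (erule ptime_op1[where uop = Fst]) (auto simp: enc_pair_def)

lemma ptime_snd: "ptime ea (enc_pair eb ec) f \<Longrightarrow> ptime ea ec (\<lambda>x. snd (f x))"
  by (erule ptime_op1[where uop = Snd]) (auto simp: enc_pair_def)

lemma ptime_add: "ptime ea Atom f \<Longrightarrow> ptime ea Atom g \<Longrightarrow> ptime ea Atom (\<lambda>x. f x + g x)"
  by (erule (1) ptime_op2[where bop = Plus]) auto

lemma ptime_diff: "ptime ea Atom f \<Longrightarrow> ptime ea Atom g \<Longrightarrow> ptime ea Atom (\<lambda>x. f x - g x)"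
  by (erule (1) ptime_op2[where bop = Minus]) auto

lemma ptime_mult: "ptime ea Atom f \<Longrightarrow> ptime ea Atom g \<Longrightarrow> ptime ea Atom (\<lambda>x. f x * g x)"
  by (erule (1) ptime_op2[where bop = Times]) auto

lemma ptime_uminus: "ptime ea Atom f \<Longrightarrow> ptime ea Atom (\<lambda>x. - f x)"
  using ptime_diff[OF ptime_const[of ea Atom 0], of f] by simp

lemma ptime_le: "ptime ea Atom f \<Longrightarrow> ptime ea Atom g \<Longrightarrow> ptime ea enc_bool (\<lambda>x. f x \<le> g x)"
  by (erule (1) ptime_op2[where bop = Leq]) (auto simp: enc_bool_def)

lemma ptime_conj:
  assumes "ptime ea enc_bool f" "ptime ea enc_bool g"
  shows "ptime ea enc_bool (\<lambda>x. f x \<and> g x)"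
proof -
  have "(\<lambda>x. if f x then g x else False) = (\<lambda>x. f x \<and> g x)" by auto
  then show ?thesis using ptime_if[OF assms ptime_const[of ea enc_bool False]] by simp
qed

lemma ptime_not:
  assumes "ptime ea enc_bool f"
  shows "ptime ea enc_bool (\<lambda>x. \<not> f x)"
proof -
  have "(\<lambda>x. if f x then False else True) = (\<lambda>x. \<not> f x)" by auto
  then show ?thesis
    using ptime_if[OF assms ptime_const[of ea enc_bool False] ptime_const[of ea enc_bool True]] by simp
qed

lemma ptime_eq: "ptime ea Atom f \<Longrightarrow> ptime ea Atom g \<Longrightarrow> ptime ea enc_bool (\<lambda>x. f x = g x)"
  using ptime_conj[OF ptime_le ptime_le, of ea f g g f] by (simp add: order_eq_iff[symmetric])

lemma ptime_less: "ptime ea Atom f \<Longrightarrow> ptime ea Atom g \<Longrightarrow> ptime ea enc_bool (\<lambda>x. f x < g x)"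
  using ptime_not[OF ptime_le, of ea g f] by (simp add: not_le)

lemma ptime_Cons: "ptime ea eb f \<Longrightarrow> ptime ea (enc_list eb) g \<Longrightarrow> ptime ea (enc_list eb) (\<lambda>x. f x # g x)"
  by (erule (1) ptime_op2[where bop = MkNode]) auto

lemma ptime_tl: "ptime ea (enc_list eb) f \<Longrightarrow> ptime ea (enc_list eb) (\<lambda>x. tl (f x))"
proof (erule ptime_op1[where uop = Snd])
  show "val1 Snd (enc_list eb (f x)) = enc_list eb (tl (f x))" for x by (cases "f x") auto
qed

lemma ptime_nonempty: "ptime ea (enc_list eb) f \<Longrightarrow> ptime ea enc_bool (\<lambda>x. f x \<noteq> [])"
proof (erule ptime_op1[where uop = IsNode])
  show "val1 IsNode (enc_list eb (f x)) = enc_bool (f x \<noteq> [])" for x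
    by (cases "f x") (auto simp: enc_bool_def)
qed

lemma ptime_empty: "ptime ea (enc_list eb) f \<Longrightarrow> ptime ea enc_bool (\<lambda>x. f x = [])"
  using ptime_not[OF ptime_nonempty, of ea eb f] by simp

text \<open>
  A head with an explicit default, since \<open>hd []\<close> is an unspecified value that no program could be
  shown to return.
\<close>

definition head :: "'a \<Rightarrow> 'a list \<Rightarrow> 'a"
  where "head c xs = (case xs of [] \<Rightarrow> c | x # _ \<Rightarrow> x)"

lemma head_simps [simp]: "head c [] = c" "head c (x # xs) = x"
  by (simp_all add: head_def)

text \<open>
  On encodings, the default must be chosen by a test of the shape of the list. The element
  encoding may be arbitrary, so the function is first computed on raw data.
\<close>

lemma ptime_head:
  assumes "ptime ea (enc_list eb) f"
  shows "ptime ea eb (\<lambda>x. head c (f x))"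
proof -
  define h where "h u = (case u of Node a b \<Rightarrow> a | Atom k \<Rightarrow> eb c)" for u
  have h: "ptime id id h"
  proof -
    have "ptime id id (val1 Fst)" by (rule ptime_op1[OF ptime_id, where uop = Fst]) simp
    moreover have "ptime id enc_bool (\<lambda>u. case u of Node a b \<Rightarrow> True | Atom k \<Rightarrow> False)"
      by (rule ptime_op1[OF ptime_id, where uop = IsNode]) (auto simp: enc_bool_def split: data.split)
    ultimately have "ptime id id (\<lambda>u. if (case u of Node a b \<Rightarrow> True | Atom k \<Rightarrow> False) then val1 Fst u else eb
      c)"
      by (intro ptime_if ptime_const)
    moreover have "(\<lambda>u. if (case u of Node a b \<Rightarrow> True | Atom k \<Rightarrow> False) then val1 Fst u else eb c) = h"
      by (auto simp: h_def split: data.split)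
    ultimately show ?thesis by simp
  qed
  have "ptime ea id (\<lambda>x. enc_list eb (f x))"
    using assms unfolding ptime_def by simp
  from ptime_comp[OF h this] have "ptime ea id (\<lambda>x. h (enc_list eb (f x)))" .
  moreover have "h (enc_list eb (f x)) = eb (head c (f x))" for x
    by (cases "f x") (auto simp: h_def)
  ultimately show ?thesis unfolding ptime_def by simp
qed

primrec lrec :: "('e \<Rightarrow> 'b) \<Rightarrow> ('e \<Rightarrow> 'a \<Rightarrow> 'a list \<Rightarrow> 'b \<Rightarrow> 'b) \<Rightarrow> 'e \<Rightarrow> 'a list \<Rightarrow> 'b" where
  "lrec z g e [] = z e"
| "lrec z g e (x # xs) = g e x xs (lrec z g e xs)"

lemma length_le_dsize: "length xs < dsize (enc_list ea xs)"
  by (induction xs) (auto simp: floorlog_def)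

text \<open>
  Primitive recursion over a list is one recursive function of the machine. Without the size bound
  on the results, iterated squaring would be a counterexample; with it, all calls have arguments
  of polynomial size and hence a common polynomial bound \<open>K\<close> on the cost of one level.
\<close>

lemma ptime_lrec:
  assumes z: "ptime ee eb z"
    and g: "ptime (enc_pair ee (enc_pair ea (enc_pair (enc_list ea) eb))) eb
        (\<lambda>p. g (fst p) (fst (snd p)) (fst (snd (snd p))) (snd (snd (snd p))))"
    and q: "\<And>e xs. dsize (eb (lrec z g e xs)) \<le> poly q (dsize (enc_pair ee (enc_list ea) (e, xs)))"
  shows "ptime (enc_pair ee (enc_list ea)) eb (\<lambda>p. lrec z g (fst p) (snd p))"
proof -
  obtain fs0 Z0 pz G0 pg where
    Z0: "\<And>x. evals fs0 [ee x] Z0 (eb (z x)) (poly pz (dsize (ee x)))" and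
    G0: "\<And>x. evals fs0 [enc_pair ee (enc_pair ea (enc_pair (enc_list ea) eb)) x] G0
      (eb (g (fst x) (fst (snd x)) (fst (snd (snd x))) (snd (snd (snd x)))))
      (poly pg (dsize (enc_pair ee (enc_pair ea (enc_pair (enc_list ea) eb)) x)))"
    using ptime_link[OF z g] by blast
  define Z where "Z = shift 1 Z0"
  define G where "G = shift 1 G0"
  define arg where "arg = Op2 MkNode (Op1 Fst (Var 0)) (Op1 Snd (Op1 Snd (Var 0)))"
  define tup where "tup = Op2 MkNode (Op1 Fst (Var 1)) (Op2 MkNode (Op1 Fst (Op1 Snd (Var 1)))
     (Op2 MkNode (Op1 Snd (Op1 Snd (Var 1))) (Var 0)))"
  define R where "R = Cond (Op1 IsNode (Op1 Snd (Var 0)))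
     (LetIn (Call 0 arg) (LetIn tup G)) (LetIn (Op1 Fst (Var 0)) Z)"
  define fs where "fs = R # map (shift 1) fs0"
  have fs0: "fs ! 0 = R" "0 < length fs" by (simp_all add: fs_def)
  have Z: "evals fs [ee x] Z (eb (z x)) (poly pz (dsize (ee x)))" for x
    using evals_shift[OF Z0, of "[R]"] by (simp add: fs_def Z_def)
  have G: "evals fs [Node (ee e) (Node (ea x) (Node (enc_list ea xs) (eb a)))] G
      (eb (g e x xs a)) (poly pg (dsize (Node (ee e) (Node (ea x) (Node (enc_list ea xs) (eb a))))))"
        for e x xs a
    using evals_shift[OF G0, of "[R]" "(e, x, xs, a)"] by (simp add: fs_def G_def enc_pair_def)
  \<comment> \<open>one level of the recursion, with generous constants: \<open>S\<close> bounds the argument,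
    \<open>poly q S\<close> the recursive result\<close>
  define K where "K S = 40 * S + 10 * poly q S + 40 + poly pg (10 * S + 10 + poly q S) + poly pz S" for S
  have main: "evals fs [Node (ee e) (enc_list ea xs)] R (eb (lrec z g e xs)) (K S * Suc (length xs))"
    if "dsize (Node (ee e) (enc_list ea xs)) \<le> S" for e xs S
    using that
  proof (induction xs)
    case Nil
    let ?u = "Node (ee e) (enc_list ea [])"
    have u: "evals fs [?u] (Var 0) ?u (dsize ?u)" using evals_Var[of 0 "[?u]" fs] by simp
    have c: "evals fs [?u] (Op1 IsNode (Op1 Snd (Var 0))) (Atom 0) (dsize ?u + dsize ?u + 1)"
      using evals_Op1[OF evals_Op1[OF u, of Snd], of IsNode] by (simp add: floorlog_def)
    have f: "evals fs [?u] (Op1 Fst (Var 0)) (ee e) (dsize ?u + dsize ?u)"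
      using evals_Op1[OF u, of Fst] by simp
    have "evals fs [?u] R (eb (z e)) (dsize ?u + dsize ?u + 1 +
        (dsize ?u + dsize ?u + poly pz (dsize (ee e)) + 1) + 1)"
      unfolding R_def by (rule evals_Cond[OF c]) (use evals_LetIn[OF f evals_weaken1[OF Z]] in auto)
    moreover have "poly pz (dsize (ee e)) \<le> poly pz S"
      using Nil by (intro poly_nat_mono) simp
    ultimately show ?case using Nil by (auto elim!: evals_mono simp: K_def)
  next
    case (Cons x xs)
    let ?u = "Node (ee e) (enc_list ea (x # xs))"
    let ?a = "eb (lrec z g e xs)"
    have S: "dsize ?u \<le> S" by fact
    have S': "dsize (Node (ee e) (enc_list ea xs)) \<le> S" using S by simp
    have IH: "evals fs [Node (ee e) (enc_list ea xs)] R ?a (K S * Suc (length xs))"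
      by (rule Cons.IH[OF S'])
    have a: "dsize ?a \<le> poly q S"
      using q[of e xs] poly_nat_mono[OF S', of q] by (simp add: enc_pair_def)
    have u: "evals fs [?u] (Var 0) ?u S"
      using evals_mono[OF evals_Var[of 0 "[?u]" fs], of S] S by simp
    have c: "evals fs [?u] (Op1 IsNode (Op1 Snd (Var 0))) (Atom 1) (3 * S)"
      using evals_mono[OF evals_Op1[OF evals_Op1[OF u, of Snd], of IsNode], of "3 * S"] S by simp
    have arg: "evals fs [?u] arg (Node (ee e) (enc_list ea xs)) (8 * S)"
      unfolding arg_def
      using evals_mono[OF evals_Op2[OF evals_Op1[OF u, of Fst] evals_Op1[OF evals_Op1[OF u, of Snd], of Snd],
        of MkNode],
          of "8 * S"] S by (simp add: cost2_def)
    have call: "evals fs [?u] (Call 0 arg) ?a (8 * S + K S * Suc (length xs) + 1)"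
      by (rule evals_Call[OF fs0(2) arg]) (use IH fs0 in simp)
    have v0: "evals fs [?a, ?u] (Var 0) ?a (poly q S)"
      using evals_mono[OF evals_Var[of 0 "[?a,?u]" fs], of "poly q S"] a by simp
    have v1: "evals fs [?a, ?u] (Var 1) ?u S"
      using evals_mono[OF evals_Var[of 1 "[?a,?u]" fs], of S] S by simp
    let ?t = "Node (ee e) (Node (ea x) (Node (enc_list ea xs) ?a))"
    have t: "evals fs [?a, ?u] tup ?t (20 * S + 10 * poly q S + 20)"
      unfolding tup_def
      using evals_mono[OF evals_Op2[OF evals_Op1[OF v1, of Fst] evals_Op2[OF evals_Op1[OF evals_Op1[OF v1,
        of Snd], of Fst]
         evals_Op2[OF evals_Op1[OF evals_Op1[OF v1, of Snd], of Snd] v0, of MkNode], of MkNode], of MkNode],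
         of "20 * S + 10 * poly q S + 20"] S a by (simp add: cost2_def)
    have ts: "dsize ?t \<le> 10 * S + 10 + poly q S" using S a by simp
    have G': "evals fs [?t] G (eb (lrec z g e (x # xs))) (poly pg (10 * S + 10 + poly q S))"
      by (rule evals_mono[OF _ poly_nat_mono[OF ts]]) (simp only: lrec.simps G)
    have "evals fs [?u] (LetIn (Call 0 arg) (LetIn tup G)) (eb (lrec z g e (x # xs)))
      ((8 * S + K S * Suc (length xs) + 1) + ((20 * S + 10 * poly q S + 20) + poly pg (10 * S + 10 + poly q S) +
        1) + 1)"
      by (rule evals_LetIn[OF call evals_LetIn[OF t evals_weaken1[OF G']]])
    then have "evals fs [?u] R (eb (lrec z g e (x # xs))) (3 * S +
      ((8 * S + K S * Suc (length xs) + 1) + ((20 * S + 10 * poly q S + 20) + poly pg (10 * S + 10 + poly q S) +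
        1) + 1) + 1)"
      unfolding R_def by (intro evals_Cond[OF c]) auto
    then show ?case
      by (rule evals_mono) (simp add: K_def algebra_simps)
  qed
  show ?thesis
  proof (rule ptimeI)
    fix x :: "'a \<times> 'c list"
    let ?S = "dsize (enc_pair ee (enc_list ea) x)"
    have v: "evals fs [enc_pair ee (enc_list ea) x] (Var 0) (enc_pair ee (enc_list ea) x) ?S"
      using evals_Var[of 0 "[enc_pair ee (enc_list ea) x]"] by simp
    show "evals fs [enc_pair ee (enc_list ea) x] R (eb (lrec z g (fst x) (snd x)))
       (K ?S * Suc (length (snd x)))"
      using main[of "fst x" "snd x" ?S] by (simp add: enc_pair_def)
    have "K ?S * Suc (length (snd x)) \<le> K ?S * ?S"
      using length_le_dsize[of "snd x" ea] by (intro mult_le_mono2) (simp add: enc_pair_def)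
    also have "\<dots> = poly (([:0,40:] + smult 10 q + [:40:] + pcompose pg ([:10,10:] + q) + pz) * [:0,1:]) ?S"
      by (simp add: K_def poly_pcompose algebra_simps)
    finally show "K ?S * Suc (length (snd x)) \<le>
       poly (([:0,40:] + smult 10 q + [:40:] + pcompose pg ([:10,10:] + q) + pz) * [:0,1:]) ?S" .
  qed
qed

section \<open>Lists in polynomial time\<close>

lemma ptime_comp2:
  assumes "ptime (enc_pair e1 e2) e (\<lambda>p. h (fst p) (snd p))" "ptime A e1 f" "ptime A e2 g"
  shows "ptime A e (\<lambda>x. h (f x) (g x))"
  using ptime_comp[OF assms(1) ptime_pair[OF assms(2,3)]] by simp

lemma ptime_comp3:
  assumes "ptime (enc_pair e1 (enc_pair e2 e3)) e (\<lambda>p. h (fst p) (fst (snd p)) (snd (snd p)))"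
    "ptime A e1 f" "ptime A e2 g" "ptime A e3 k"
  shows "ptime A e (\<lambda>x. h (f x) (g x) (k x))"
  using ptime_comp[OF assms(1) ptime_pair[OF assms(2) ptime_pair[OF assms(3,4)]]] by simp

text \<open>
  The usable form of recursion: the whole input \<open>x\<close> serves as the parameter of the recursion, so
  the step may refer to everything that is in scope.
\<close>

lemma ptime_lrec_ctx:
  assumes "ptime A (enc_list ea) l" "ptime A eb z"
    "ptime (enc_pair A (enc_pair ea (enc_pair (enc_list ea) eb))) eb
        (\<lambda>p. g (fst p) (fst (snd p)) (fst (snd (snd p))) (snd (snd (snd p))))"
    "\<And>x xs. dsize (eb (lrec z g x xs)) \<le> poly q (dsize (A x) + dsize (enc_list ea xs))"
  shows "ptime A eb (\<lambda>x. lrec z g x (l x))"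
proof -
  have "ptime (enc_pair A (enc_list ea)) eb (\<lambda>p. lrec z g (fst p) (snd p))"
  proof (rule ptime_lrec[OF assms(2,3), where q = q])
    fix x xs
    have "poly q (dsize (A x) + dsize (enc_list ea xs)) \<le> poly q (dsize (enc_pair A (enc_list ea) (x, xs)))"
      by (rule poly_nat_mono) (simp add: enc_pair_def)
    with assms(4)[of x xs] show "dsize (eb (lrec z g x xs)) \<le> poly q (dsize (enc_pair A (enc_list ea) (x, xs)))"
      by linarith
  qed
  from ptime_comp2[OF this ptime_id assms(1)] show ?thesis .
qed

text \<open>
  A map whose function also sees the rest of the list. No bound on the size of the result has to
  be supplied: each entry is polynomially bounded because it is computed in polynomial time.
\<close>

lemma ptime_tails:
  assumes "ptime A (enc_list ea) l"
    and g: "ptime (enc_pair A (enc_pair ea (enc_list ea))) eb (\<lambda>p. g (fst p) (fst (snd p)) (snd (snd p)))"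
  shows "ptime A (enc_list eb) (\<lambda>x. lrec (\<lambda>_. []) (\<lambda>x y ys acc. g x y ys # acc) x (l x))"
proof -
  obtain fs e p where
    G: "\<And>x. evals fs [enc_pair A (enc_pair ea (enc_list ea)) x] e (eb (g (fst x) (fst (snd x)) (snd (snd x))))
      (poly p (dsize (enc_pair A (enc_pair ea (enc_list ea)) x)))"
    using g unfolding ptime_def by blast
  have G': "dsize (eb (g x y ys)) \<le> poly p (dsize (A x) + dsize (enc_list ea (y # ys)) + 2)" for x y ys
    proof -
    have "poly p (dsize (enc_pair A (enc_pair ea (enc_list ea)) (x, y, ys)))
        \<le> poly p (dsize (A x) + dsize (enc_list ea (y # ys)) + 2)"
      by (rule poly_nat_mono) (simp add: enc_pair_def)
    with evals_size[OF G[of "(x, y, ys)"]] show ?thesis by simp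
  qed
  have len: "dsize (enc_list eb (lrec (\<lambda>_. []) (\<lambda>x y ys acc. g x y ys # acc) x ys))
      \<le> Suc (length ys) * (poly p (dsize (A x) + dsize (enc_list ea ys) + 2) + 2)" for x ys
  proof (induction ys)
    case Nil
    then show ?case by (simp add: floorlog_def)
  next
    case (Cons y ys)
    let ?P = "\<lambda>ys. poly p (dsize (A x) + dsize (enc_list ea ys) + 2)"
    have "?P ys \<le> ?P (y # ys)" by (rule poly_nat_mono) simp
    then have "Suc (length ys) * (?P ys + 2) \<le> Suc (length ys) * (?P (y # ys) + 2)"
      by (intro mult_le_mono2) simp
    with Cons G'[of x y ys] show ?case by simp
  qed
  show ?thesis
  proof (rule ptime_lrec_ctx[OF assms(1), where q = "[:0,1:] * (pcompose p [:2,1:] + [:2:])"])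
    show "ptime A (enc_list eb) (\<lambda>x. [])" by (rule ptime_const)
    show "ptime (enc_pair A (enc_pair ea (enc_pair (enc_list ea) (enc_list eb)))) (enc_list eb)
        (\<lambda>p. g (fst p) (fst (snd p)) (fst (snd (snd p))) # snd (snd (snd p)))"
      by (rule ptime_Cons ptime_comp3[OF g] ptime_id ptime_fst ptime_snd)+
    fix x xs
    let ?S = "dsize (A x) + dsize (enc_list ea xs)"
    have "Suc (length xs) \<le> ?S" using length_le_dsize[of xs ea] by simp
    then have "Suc (length xs) * (poly p (?S + 2) + 2) \<le> ?S * (poly p (?S + 2) + 2)"
      by (rule mult_le_mono1)
    with len[of x xs] show "dsize (enc_list eb (lrec (\<lambda>_. []) (\<lambda>x y ys acc. g x y ys # acc) x xs))
        \<le> poly ([:0, 1:] * (pcompose p [:2, 1:] + [:2:])) ?S"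
      by (simp add: poly_pcompose add.commute add.left_commute)
  qed
qed

lemma ptime_map:
  assumes "ptime A (enc_list ea) l" "ptime (enc_pair A ea) eb (\<lambda>p. h (fst p) (snd p))"
  shows "ptime A (enc_list eb) (\<lambda>x. map (h x) (l x))"
proof -
  have "map (h x) ys = lrec (\<lambda>_. []) (\<lambda>x y ys acc. h x y # acc) x ys" for x ys
    by (induction ys) auto
  then show ?thesis
    by (simp only:) (rule ptime_tails assms ptime_comp2[OF assms(2)] ptime_id ptime_fst ptime_snd)+
qed

lemma dsize_append: "dsize (enc_list ea (xs @ ys)) \<le> dsize (enc_list ea xs) + dsize (enc_list ea ys)"
  by (induction xs) auto

lemma ptime_append:
  assumes "ptime A (enc_list ea) l" "ptime A (enc_list ea) m"
  shows "ptime A (enc_list ea) (\<lambda>x. l x @ m x)"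
proof -
  have eq: "ys @ m x = lrec m (\<lambda>x y ys acc. y # acc) x ys" for x ys
    by (induction ys) auto
  obtain fs e p where m: "\<And>x. evals fs [A x] e (enc_list ea (m x)) (poly p (dsize (A x)))"
    using assms(2) unfolding ptime_def by blast
  have "ptime A (enc_list ea) (\<lambda>x. lrec m (\<lambda>x y ys acc. y # acc) x (l x))"
  proof (rule ptime_lrec_ctx[OF assms, where q = "[:0,1:] + p"])
    show "ptime (enc_pair A (enc_pair ea (enc_pair (enc_list ea) (enc_list ea)))) (enc_list ea)
      (\<lambda>p. fst (snd p) # snd (snd (snd p)))"
      by (rule ptime_Cons ptime_id ptime_fst ptime_snd)+
    fix x xs
    have "dsize (enc_list ea (m x)) \<le> poly p (dsize (A x) + dsize (enc_list ea xs))"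
      using evals_size[OF m[of x]] by (rule order_trans) (auto intro: poly_nat_mono)
    then show "dsize (enc_list ea (lrec m (\<lambda>x y ys acc. y # acc) x xs))
        \<le> poly ([:0, 1:] + p) (dsize (A x) + dsize (enc_list ea xs))"
      using dsize_append[of ea xs "m x"] by (simp flip: eq)
  qed
  then show ?thesis by (simp flip: eq)
qed

lemma ptime_concat:
  fixes l :: "'a \<Rightarrow> 'b list list"
  assumes "ptime A (enc_list (enc_list ea)) l"
  shows "ptime A (enc_list ea) (\<lambda>x. concat (l x))"
proof -
  have eq: "concat ys = lrec (\<lambda>_. []) (\<lambda>x y ys acc. y @ acc) x ys" for x :: 'a and ys :: "'b list list"
    by (induction ys) auto
  have "ptime A (enc_list ea) (\<lambda>x. lrec (\<lambda>_. []) (\<lambda>x y ys acc. y @ acc) x (l x))"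
  proof (rule ptime_lrec_ctx[OF assms, where q = "[:0,1:]"])
    show "ptime (enc_pair A (enc_pair (enc_list ea) (enc_pair (enc_list (enc_list ea)) (enc_list ea))))
      (enc_list ea)
      (\<lambda>p. fst (snd p) @ snd (snd (snd p)))"
      by (rule ptime_append ptime_id ptime_fst ptime_snd)+
    fix x xs
    have "dsize (enc_list ea (concat xs)) \<le> dsize (enc_list (enc_list ea) xs)"
    proof (induction xs)
      case (Cons y ys)
      then show ?case using dsize_append[of ea y "concat ys"] by simp
    qed simp
    then show "dsize (enc_list ea (lrec (\<lambda>_. []) (\<lambda>x y ys acc. y @ acc) x xs))
        \<le> poly [:0, 1:] (dsize (A x) + dsize (enc_list (enc_list ea) xs))"
      by (simp flip: eq)
  qed (rule ptime_const)
  then show ?thesis by (simp flip: eq)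
qed

lemma ptime_filter:
  assumes "ptime A (enc_list ea) l" "ptime (enc_pair A ea) enc_bool (\<lambda>p. h (fst p) (snd p))"
  shows "ptime A (enc_list ea) (\<lambda>x. filter (h x) (l x))"
proof -
  have eq: "filter (h x) ys = concat (map (\<lambda>y. if h x y then [y] else []) ys)" for x ys
    by (induction ys) auto
  show ?thesis unfolding eq
    by (rule ptime_concat ptime_map[OF assms(1)] ptime_if[OF assms(2)] ptime_Cons ptime_snd ptime_id
      ptime_const)+
qed

lemma ptime_Ball:
  assumes "ptime A (enc_list ea) l" "ptime (enc_pair A ea) enc_bool (\<lambda>p. h (fst p) (snd p))"
  shows "ptime A enc_bool (\<lambda>x. \<forall>y\<in>set (l x). h x y)"
proof -
  have eq: "(\<forall>y\<in>set ys. h x y) = lrec (\<lambda>_. True) (\<lambda>x y ys acc. h x y \<and> acc) x ys" for x ys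
    by (induction ys) auto
  show ?thesis unfolding eq
  proof (rule ptime_lrec_ctx[OF assms(1), where q = "[:2:]"])
    show "ptime (enc_pair A (enc_pair ea (enc_pair (enc_list ea) enc_bool))) enc_bool
      (\<lambda>p. h (fst p) (fst (snd p)) \<and> snd (snd (snd p)))"
      by (rule ptime_conj ptime_comp2[OF assms(2)] ptime_id ptime_fst ptime_snd)+
    have "dsize (enc_bool b) \<le> 2" for b
      by (simp add: enc_bool_def floorlog_def)
    then show "dsize (enc_bool (lrec (\<lambda>_. True) (\<lambda>x y ys acc. h x y \<and> acc) x xs))
        \<le> poly [:2:] (dsize (A x) + dsize (enc_list ea xs))" for x xs by simp
  qed (rule ptime_const)
qed

lemma ptime_prod_list:
  assumes "ptime A (enc_list Atom) l"
  shows "ptime A Atom (\<lambda>x. prod_list (l x))"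
proof -
  have eq: "prod_list ys = lrec (\<lambda>_. 1) (\<lambda>x y ys acc. y * acc) x ys" for x :: 'a and ys :: "int list"
    by (induction ys) auto
  have "ptime A Atom (\<lambda>x. lrec (\<lambda>_. 1) (\<lambda>x y ys acc. y * acc) x (l x))"
  proof (rule ptime_lrec_ctx[OF assms, where q = "[:1,1:]"])
    show "ptime (enc_pair A (enc_pair Atom (enc_pair (enc_list Atom) Atom))) Atom
      (\<lambda>p. fst (snd p) * snd (snd (snd p)))"
      by (rule ptime_mult ptime_id ptime_fst ptime_snd)+
    fix x xs
    have "dsize (Atom (prod_list xs)) \<le> dsize (enc_list Atom xs) + 1"
    proof (induction xs)
      case Nil
      then show ?case by (simp add: floorlog_def)
    next
      case (Cons y ys)
      then show ?case using dsize_Atom_times[of y "prod_list ys"] by (simp del: dsize.simps(1))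
    qed
    then show "dsize (Atom (lrec (\<lambda>_. 1) (\<lambda>x y ys acc. y * acc) x xs))
        \<le> poly [:1, 1:] (dsize (A x) + dsize (enc_list Atom xs))"
      by (simp flip: eq del: dsize.simps)
  qed (rule ptime_const)
  then show ?thesis by (simp flip: eq)
qed

lemma ptime_length:
  fixes l :: "'a \<Rightarrow> 'b list"
  assumes "ptime A (enc_list ea) l"
  shows "ptime A Atom (\<lambda>x. int (length (l x)))"
proof -
  have eq: "int (length ys) = lrec (\<lambda>_. 0) (\<lambda>x y ys acc. acc + 1) x ys" for x :: 'a and ys :: "'b list"
    by (induction ys) auto
  have "ptime A Atom (\<lambda>x. lrec (\<lambda>_. 0) (\<lambda>x y ys acc. acc + 1) x (l x))"
  proof (rule ptime_lrec_ctx[OF assms, where q = "[:1,1:]"])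
    show "ptime (enc_pair A (enc_pair ea (enc_pair (enc_list ea) Atom))) Atom
      (\<lambda>p. snd (snd (snd p)) + 1)"
      by (rule ptime_add ptime_snd ptime_id ptime_const)+
    fix x :: 'a and xs :: "'b list"
    have "dsize (Atom (int (length xs))) \<le> Suc (length xs)"
      by (rule dsize_Atom_le) (simp add: less_exp)
    then show "dsize (Atom (lrec (\<lambda>_. 0) (\<lambda>x y ys acc. acc + 1) x xs))
        \<le> poly [:1, 1:] (dsize (A x) + dsize (enc_list ea xs))"
      using length_le_dsize[of xs ea] by (simp flip: eq del: dsize.simps)
  qed (rule ptime_const)
  then show ?thesis by (simp flip: eq)
qed

text \<open>
  Numbering in descending order makes the number of an entry a function of the tail that starts
  there.
\<close>

primrec number :: "'a list \<Rightarrow> (int \<times> 'a) list" where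
  "number [] = []"
| "number (x # xs) = (int (length xs), x) # number xs"

lemma ptime_number:
  fixes l :: "'a \<Rightarrow> 'b list"
  assumes "ptime A (enc_list ea) l"
  shows "ptime A (enc_list (enc_pair Atom ea)) (\<lambda>x. number (l x))"
proof -
  have eq: "number ys = lrec (\<lambda>_. []) (\<lambda>x y ys acc. (int (length ys), y) # acc) x ys" for x :: 'a
    and ys :: "'b list"
    by (induction ys) auto
  have "ptime A (enc_list (enc_pair Atom ea)) (\<lambda>x. lrec (\<lambda>_. []) (\<lambda>x y ys acc. (int (length ys),
    y) # acc) x (l x))"
    by (rule ptime_tails[OF assms] ptime_pair ptime_length ptime_id ptime_fst ptime_snd)+
  then show ?thesis by (simp flip: eq)
qed

text \<open>
  The encoding of a rational is that of its reduced fraction, so numerator and denominator are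
  available for free, and an integer is encoded with denominator \<open>1\<close>.
\<close>

lemma enc_rat_eq: "enc_rat r = enc_pair Atom Atom (quotient_of r)"
  by (simp add: enc_rat_def enc_pair_def split_beta)

lemma ptime_quotient_of: "ptime A enc_rat f \<Longrightarrow> ptime A (enc_pair Atom Atom) (\<lambda>x. quotient_of (f x))"
  unfolding ptime_def by (simp add: enc_rat_eq)

lemma ptime_rat_of_int:
  assumes "ptime A Atom f"
  shows "ptime A enc_rat (\<lambda>x. of_int (f x))"
  using ptime_pair[OF assms ptime_const[of A Atom 1]] unfolding ptime_def
  by (simp add: enc_rat_eq)

lemmas ptime_intros = ptime_id ptime_const ptime_fst ptime_snd ptime_pair ptime_if ptime_add ptime_diff
  ptime_mult ptime_uminus ptime_le ptime_less ptime_eq ptime_conj ptime_not ptime_Cons ptime_tl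
  ptime_head ptime_nonempty ptime_empty ptime_map ptime_append ptime_concat ptime_filter ptime_Ball
  ptime_prod_list ptime_number ptime_quotient_of ptime_rat_of_int

section \<open>The algorithm\<close>

text \<open>
  Vectors are lists of integers. Operations on them recurse on the dimension, which is a constant
  of the program, and not on the vectors.
\<close>

primrec dot :: "nat \<Rightarrow> int list \<Rightarrow> int list \<Rightarrow> int" where
  "dot 0 u v = 0"
| "dot (Suc k) u v = head 0 u * head 0 v + dot k (tl u) (tl v)"

primrec lincomb :: "nat \<Rightarrow> int \<Rightarrow> int list \<Rightarrow> int \<Rightarrow> int list \<Rightarrow> int list" where
  "lincomb 0 c u c' v = []"
| "lincomb (Suc k) c u c' v = (c * head 0 u + c' * head 0 v) # lincomb k c (tl u) c' (tl v)"

definition units :: "nat \<Rightarrow> int list list"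
  where "units k = map (\<lambda>i. map (\<lambda>j. if i = j then 1 else 0) [0..<k]) [0..<k]"

text \<open>
  One step of fraction-free elimination: \<open>B\<close> is a basis of a space, and the result is a basis of
  its subspace orthogonal to \<open>u\<close>. A basis vector \<open>p\<close> that is not orthogonal to \<open>u\<close> is removed, and
  each other \<open>w\<close> is replaced by \<open>(u \<bullet> p) w - (u \<bullet> w) p\<close>.
\<close>

definition orth_step :: "nat \<Rightarrow> int list \<Rightarrow> int list list \<Rightarrow> int list list" where
  "orth_step k u B =
    (let P = filter (\<lambda>w. dot k u w \<noteq> 0) B; p = head [] P
     in if P = [] then B
        else map (\<lambda>w. lincomb k (dot k u p) w (- dot k u w) p) (filter (\<lambda>w. dot k u w = 0) B @ tl P))"

primrec orth_basis :: "nat \<Rightarrow> nat \<Rightarrow> int list list \<Rightarrow> int list list" where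
  "orth_basis k 0 U = units k"
| "orth_basis k (Suc j) U = orth_step k (head [] U) (orth_basis k j (tl U))"

primrec tuples :: "nat \<Rightarrow> 'a list \<Rightarrow> 'a list list" where
  "tuples 0 xs = [[]]"
| "tuples (Suc k) xs = concat (map (\<lambda>x. map (\<lambda>t. x # t) (tuples k xs)) xs)"

definition plus_minus :: "int list list \<Rightarrow> int list list"
  where "plus_minus B = B @ map (map uminus) B"

text \<open>
  The integers obtained from the fractions \<open>p\<^sub>i / q\<^sub>i\<close> by multiplication with all denominators. As
  the machine cannot divide, the product of the other denominators is formed directly for each
  entry; numbers attached to the entries tell which factor to leave out.
\<close>

definition cleared :: "(int \<times> int) list \<Rightarrow> int list" where
  "cleared L = map (\<lambda>p. fst (snd p) *
     prod_list (map (\<lambda>r. if fst r = fst p then 1 else snd (snd r)) (number L))) (number L)"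

text \<open>
  The inequality \<open>a \<bullet> x \<le> b\<close> as an integer vector \<open>r\<close> with \<open>r \<bullet> (1, x) \<le> 0\<close>.
\<close>

definition hrow :: "ineq \<Rightarrow> int list" where
  "hrow c = (let r = cleared (map quotient_of (snd c # fst c)) in - head 0 r # tl r)"

text \<open>
  Vertices as integer vectors \<open>(y\<^sub>0, y)\<close> with \<open>y\<^sub>0 > 0\<close> that stand for the points \<open>y / y\<^sub>0\<close>. The
  rows chosen in \<open>t\<close> may be linearly dependent, in which case feasible points that are not
  vertices may be listed as well; they lie in the polytope and so do no harm to the convex hull.
\<close>

definition vertices :: "nat \<Rightarrow> ineq list \<Rightarrow> int list list" where
  "vertices d S = filter (\<lambda>y. 0 < head 0 y \<and> (\<forall>r\<in>set (map hrow S). dot (Suc d) r y \<le> 0))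
     (concat (map (\<lambda>t. plus_minus (orth_basis (Suc d) d t)) (tuples d (map hrow S))))"

text \<open>
  Comparison of \<open>(a \<bullet> v) / v\<^sub>0\<close> with \<open>(a \<bullet> y) / y\<^sub>0\<close>, cross-multiplied.
\<close>

definition maximal :: "nat \<Rightarrow> int list \<Rightarrow> int list list \<Rightarrow> int list \<Rightarrow> bool" where
  "maximal d a V y \<longleftrightarrow> (\<forall>v\<in>set V. dot d a (tl v) * head 0 y \<le> dot d a (tl y) * head 0 v)"

text \<open>
  Each difference carries one of its end points and the list it comes from, against which the
  maximality of a candidate normal is tested later.
\<close>

definition differences :: "nat \<Rightarrow> int list list \<Rightarrow> (int list \<times> int list \<times> int list list) list" where
  "differences d V = concat (map (\<lambda>y. map (\<lambda>y'.
     (lincomb d (head 0 y) (tl y') (- head 0 y') (tl y), y, V)) V) V)"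

text \<open>
  The complement of \<open>d - 1\<close> vectors in dimension \<open>d\<close> has a basis of length \<open>1\<close> exactly if they are
  linearly independent. A normal is orthogonal to the difference, so testing one end point tests
  both.
\<close>

definition normals :: "nat \<Rightarrow> int list list list \<Rightarrow> int list list" where
  "normals d VV = concat (map (\<lambda>t. let B = orth_basis d (d - 1) (map fst t) in
     if tl B = [] then filter (\<lambda>a. \<forall>e\<in>set t. maximal d a (snd (snd e)) (fst (snd e))) (plus_minus B)
     else []) (tuples (d - 1) (concat (map (differences d) VV))))"

definition height :: "nat \<Rightarrow> int list \<Rightarrow> int list list \<Rightarrow> int \<times> int" where
  "height d a V = (let y = head [] (filter (maximal d a V) V) in (dot d a (tl y), head 0 y))"

text \<open>
  The inequality \<open>a \<bullet> x \<le> \<Sum>\<^sub>i h\<^sub>i \<lambda>\<^sub>i\<close> after elimination of \<open>\<lambda>\<^sub>0\<close>.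
\<close>

definition cayley_ineq :: "int list \<Rightarrow> int list \<Rightarrow> ineq" where
  "cayley_ineq a hs = (map of_int (a @ map (\<lambda>h. head 0 hs - h) (tl hs)), of_int (head 0 hs))"

definition normal_ineq :: "nat \<Rightarrow> int list list list \<Rightarrow> int list \<Rightarrow> ineq" where
  "normal_ineq d VV a = (let L = map (height d a) VV in
     cayley_ineq (map (\<lambda>x. prod_list (map snd L) * x) a) (cleared L))"

text \<open>
  The inequality \<open>0 \<le> \<lambda>\<^sub>k\<close>, with \<open>a = 0\<close> and \<open>h\<close> a unit vector, for each \<open>k\<close>.
\<close>

definition simplex_ineqs :: "nat \<Rightarrow> 'a list \<Rightarrow> ineq list" where
  "simplex_ineqs d xs = map (\<lambda>p. cayley_ineq (replicate d 0)
     (map (\<lambda>r. if fst r = fst p then 1 else 0) (number xs))) (number xs)"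

definition cayley_facets :: "nat \<Rightarrow> int list list list \<Rightarrow> ineq list" where
  "cayley_facets d VV = simplex_ineqs d VV @ map (normal_ineq d VV) (normals d VV)"

section \<open>Running time of the algorithm\<close>

lemma ptime_dot:
  "ptime A (enc_list Atom) f \<Longrightarrow> ptime A (enc_list Atom) g \<Longrightarrow> ptime A Atom (\<lambda>x. dot k (f x) (g x))"
proof (induction k arbitrary: f g)
  case (Suc k)
  then show ?case by (auto intro!: ptime_intros)
qed (auto intro: ptime_const)

lemma ptime_comb:
  "ptime A Atom c \<Longrightarrow> ptime A (enc_list Atom) f \<Longrightarrow> ptime A Atom c' \<Longrightarrow> ptime A (enc_list Atom) g \<Longrightarrow>
    ptime A (enc_list Atom) (\<lambda>x. lincomb k (c x) (f x) (c' x) (g x))"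
proof (induction k arbitrary: f g)
  case (Suc k)
  then show ?case by (auto intro!: ptime_intros)
qed (auto intro: ptime_const)

lemma ptime_orth_step:
  assumes "ptime A (enc_list Atom) f" "ptime A (enc_list (enc_list Atom)) g"
  shows "ptime A (enc_list (enc_list Atom)) (\<lambda>x. orth_step k (f x) (g x))"
  by (rule ptime_comp2[OF _ assms]) (unfold orth_step_def Let_def, (rule ptime_intros ptime_dot ptime_comb)+)

lemma ptime_orth:
  "ptime A (enc_list (enc_list Atom)) f \<Longrightarrow> ptime A (enc_list (enc_list Atom)) (\<lambda>x. orth_basis k j (f x))"
proof (induction j arbitrary: f)
  case (Suc j)
  then show ?case by (auto intro!: ptime_intros ptime_orth_step)
qed (auto intro: ptime_const)

lemma ptime_tuples:
  assumes "ptime A (enc_list ea) f"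
  shows "ptime A (enc_list (enc_list ea)) (\<lambda>x. tuples k (f x))"
proof -
  have "ptime (enc_list ea) (enc_list (enc_list ea)) (tuples k)"
  proof (induction k)
    case (Suc k)
    show ?case
      by (simp only: tuples.simps[abs_def]) (rule ptime_intros ptime_comp[OF Suc])+
  qed (simp add: ptime_const)
  from ptime_comp[OF this assms] show ?thesis .
qed

lemma ptime_plus_minus:
  assumes "ptime A (enc_list (enc_list Atom)) f"
  shows "ptime A (enc_list (enc_list Atom)) (\<lambda>x. plus_minus (f x))"
  by (rule ptime_comp[OF _ assms]) (unfold plus_minus_def, (rule ptime_intros)+)

lemma ptime_clear:
  assumes "ptime A (enc_list (enc_pair Atom Atom)) f"
  shows "ptime A (enc_list Atom) (\<lambda>x. cleared (f x))"
  by (rule ptime_comp[OF _ assms]) (unfold cleared_def, (rule ptime_intros)+)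

lemma ptime_row:
  assumes "ptime A (enc_pair (enc_list enc_rat) enc_rat) f"
  shows "ptime A (enc_list Atom) (\<lambda>x. hrow (f x))"
  by (rule ptime_comp[OF _ assms]) (unfold hrow_def Let_def, (rule ptime_intros ptime_clear)+)

lemma ptime_vertices:
  assumes "ptime A (enc_list (enc_pair (enc_list enc_rat) enc_rat)) f"
  shows "ptime A (enc_list (enc_list Atom)) (\<lambda>x. vertices d (f x))"
  by (rule ptime_comp[OF _ assms])
    (unfold vertices_def, (rule ptime_intros ptime_row ptime_dot ptime_plus_minus ptime_orth ptime_tuples)+)

lemma ptime_maximal:
  assumes "ptime A (enc_list Atom) f" "ptime A (enc_list (enc_list Atom)) g" "ptime A (enc_list Atom) h"
  shows "ptime A enc_bool (\<lambda>x. maximal d (f x) (g x) (h x))"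
  by (rule ptime_comp3[OF _ assms]) (unfold maximal_def, (rule ptime_intros ptime_dot)+)

lemma ptime_differences:
  assumes "ptime A (enc_list (enc_list Atom)) f"
  shows "ptime A (enc_list (enc_pair (enc_list Atom) (enc_pair (enc_list Atom) (enc_list (enc_list Atom)))))
    (\<lambda>x. differences d (f x))"
  by (rule ptime_comp[OF _ assms]) (unfold differences_def, (rule ptime_intros ptime_comb)+)

lemma ptime_normals:
  assumes "ptime A (enc_list (enc_list (enc_list Atom))) f"
  shows "ptime A (enc_list (enc_list Atom)) (\<lambda>x. normals d (f x))"
  by (rule ptime_comp[OF _ assms])
    (unfold normals_def Let_def, (rule ptime_intros ptime_differences ptime_tuples ptime_orth ptime_plus_minus
      ptime_maximal)+)

lemma ptime_height:
  assumes "ptime A (enc_list Atom) f" "ptime A (enc_list (enc_list Atom)) g"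
  shows "ptime A (enc_pair Atom Atom) (\<lambda>x. height d (f x) (g x))"
  by (rule ptime_comp2[OF _ assms])
    (unfold height_def Let_def, (rule ptime_intros ptime_dot ptime_maximal)+)

lemma ptime_cayley_ineq:
  assumes "ptime A (enc_list Atom) f" "ptime A (enc_list Atom) g"
  shows "ptime A (enc_pair (enc_list enc_rat) enc_rat) (\<lambda>x. cayley_ineq (f x) (g x))"
  by (rule ptime_comp2[OF _ assms]) (unfold cayley_ineq_def, (rule ptime_intros)+)

lemma ptime_normal_ineq:
  assumes "ptime A (enc_list (enc_list (enc_list Atom))) f" "ptime A (enc_list Atom) g"
  shows "ptime A (enc_pair (enc_list enc_rat) enc_rat) (\<lambda>x. normal_ineq d (f x) (g x))"
  by (rule ptime_comp2[OF _ assms])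
    (unfold normal_ineq_def Let_def, (rule ptime_intros ptime_cayley_ineq ptime_height ptime_clear)+)

lemma ptime_simplex_ineqs:
  assumes "ptime A (enc_list ea) f"
  shows "ptime A (enc_list (enc_pair (enc_list enc_rat) enc_rat)) (\<lambda>x. simplex_ineqs d (f x))"
  by (rule ptime_comp[OF _ assms])
    (unfold simplex_ineqs_def, (rule ptime_intros ptime_cayley_ineq)+)

lemma ptime_cayley_facets:
  assumes "ptime A (enc_list (enc_list (enc_list Atom))) f"
  shows "ptime A (enc_list (enc_pair (enc_list enc_rat) enc_rat)) (\<lambda>x. cayley_facets d (f x))"
  by (rule ptime_comp[OF _ assms])
    (unfold cayley_facets_def, (rule ptime_intros ptime_simplex_ineqs ptime_normals ptime_normal_ineq)+)

lemma ptime_algorithm: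
  "ptime enc_instance enc_system (\<lambda>x. cayley_facets d (map (vertices d) (snd x)))"
proof -
  have "enc_ineq = enc_pair (enc_list enc_rat) enc_rat"
    by (simp add: fun_eq_iff enc_ineq_def enc_pair_def)
  then have s: "enc_system = enc_list (enc_pair (enc_list enc_rat) enc_rat)"
    by (simp add: enc_system_def)
  have i: "enc_instance = enc_pair (\<lambda>n. Atom (int n)) (enc_list enc_system)"
    by (simp add: fun_eq_iff enc_instance_def enc_pair_def)
  show ?thesis unfolding i s
    by (rule ptime_cayley_facets ptime_map ptime_vertices ptime_snd ptime_id)+
qed

section \<open>Separation by linear functionals\<close>

lemma linear_functional_exists:
  fixes a :: "'a::real_vector"
  assumes "a \<notin> span S"
  shows "\<exists>f::'a \<Rightarrow> real. linear f \<and> (\<forall>x\<in>span S. f x = 0) \<and> f a = 1"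
proof -
  obtain B where B: "B \<subseteq> S" "independent B" "S \<subseteq> span B"
    using maximal_independent_subset by blast
  have sp: "span B = span S" using B by (metis span_mono span_span subset_antisym span_minimal subspace_span)
  then have a: "a \<notin> span B" using assms by simp
  then have "a \<notin> B" using span_base by blast
  obtain f :: "'a \<Rightarrow> real" where f: "linear f" "\<forall>x\<in>insert a B. f x = (if x = a then 1 else 0)"
    using linear_independent_extend[OF independent_insertI[OF a B(2)], of "\<lambda>x. if x = a then 1 else 0"] by blast
  then have "\<forall>x\<in>B. f x = 0" using \<open>a \<notin> B\<close> by auto
  then have "f x = 0" if "x \<in> span B" for x
    using linear_eq_0_on_span[OF f(1)] that by blast
  then show ?thesis using f sp by auto
qed

text \<open>
  Induction on the number of generators. If a functional separates \<open>b\<close> from the first generators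
  but is positive on the new one \<open>v j\<close>, everything is projected along \<open>v j\<close> to the kernel of that
  functional. A separating functional for the projections can be pulled back; a nonnegative
  combination of the projections lifts, the coefficient of \<open>v j\<close> being nonnegative because of the
  signs of the first functional.
\<close>

lemma farkas:
  fixes v :: "'i \<Rightarrow> 'a::real_vector"
  assumes "finite I"
  shows "(\<exists>c. (\<forall>i\<in>I. 0 \<le> c i) \<and> b = (\<Sum>i\<in>I. c i *\<^sub>R v i)) \<or>
    (\<exists>f::'a \<Rightarrow> real. linear f \<and> (\<forall>i\<in>I. f (v i) \<le> 0) \<and> 0 < f b)"
  using assms
proof (induction I arbitrary: v b rule: finite_induct)
  case empty
  show ?case
  proof (cases "b = 0")
    case False
    then have "b \<notin> span {}" by simp
    from linear_functional_exists[OF this] show ?thesis by force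
  qed simp
next
  case (insert j I)
  show ?case
  proof (cases "\<exists>c. (\<forall>i\<in>I. 0 \<le> c i) \<and> b = (\<Sum>i\<in>I. c i *\<^sub>R v i)")
    case True
    then obtain c where c: "\<forall>i\<in>I. 0 \<le> c i" "b = (\<Sum>i\<in>I. c i *\<^sub>R v i)" by blast
    have "(\<Sum>i\<in>I. (c(j := 0)) i *\<^sub>R v i) = (\<Sum>i\<in>I. c i *\<^sub>R v i)"
      using insert.hyps by (intro sum.cong) auto
    then have "(\<forall>i\<in>insert j I. 0 \<le> (c(j := 0)) i) \<and> b = (\<Sum>i\<in>insert j I. (c(j := 0)) i *\<^sub>R v i)"
      using c insert.hyps by simp
    then show ?thesis by blast
  next
    case False
    then obtain f :: "'a \<Rightarrow> real" where f: "linear f" "\<forall>i\<in>I. f (v i) \<le> 0" "0 < f b"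
      using insert.IH by blast
    show ?thesis
    proof (cases "f (v j) \<le> 0")
      case True
      then show ?thesis using f by auto
    next
      case fj: False
      define P where "P x = x - (f x / f (v j)) *\<^sub>R v j" for x
      have P: "linear P" unfolding P_def
        by (rule linearI) (simp_all add: linear_add[OF f(1)] linear_scale[OF f(1)] add_divide_distrib
          scaleR_add_left scaleR_diff_right)
      have Pj: "P (v j) = 0" using fj by (simp add: P_def)
      from insert.IH[of "P b" "\<lambda>i. P (v i)"] show ?thesis
      proof
        assume "\<exists>c. (\<forall>i\<in>I. 0 \<le> c i) \<and> P b = (\<Sum>i\<in>I. c i *\<^sub>R P (v i))"
        then obtain c where c: "\<forall>i\<in>I. 0 \<le> c i" "P b = (\<Sum>i\<in>I. c i *\<^sub>R P (v i))" by blast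
        define s where "s = (\<Sum>i\<in>I. c i *\<^sub>R v i)"
        \<comment> \<open>\<open>b\<close> and \<open>s\<close> have the same projection, so they differ by this multiple of \<open>v j\<close>\<close>
        define k where "k = (f b - f s) / f (v j)"
        have "P b = P s" unfolding s_def c(2) by (simp add: linear_sum[OF P] linear_scale[OF P])
        then have bs: "b = k *\<^sub>R v j + s" unfolding P_def k_def
          by (simp add: diff_divide_distrib scaleR_diff_left algebra_simps)
        have "f s \<le> 0" unfolding s_def
          by (simp add: linear_sum[OF f(1)] linear_scale[OF f(1)]) (use c f in \<open>auto intro!: sum_nonpos
            mult_nonneg_nonpos\<close>)
        then have "0 \<le> k" using fj f(3) by (simp add: k_def)
        moreover have "(\<Sum>i\<in>I. (c(j := k)) i *\<^sub>R v i) = s"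
          unfolding s_def using insert.hyps by (intro sum.cong) auto
        ultimately have "(\<forall>i\<in>insert j I. 0 \<le> (c(j := k)) i) \<and> b = (\<Sum>i\<in>insert j I. (c(j := k)) i *\<^sub>R v i)"
          using c(1) insert.hyps bs by simp
        then show ?thesis by blast
      next
        assume "\<exists>g::'a \<Rightarrow> real. linear g \<and> (\<forall>i\<in>I. g (P (v i)) \<le> 0) \<and> 0 < g (P b)"
        then obtain g :: "'a \<Rightarrow> real" where g: "linear g" "\<forall>i\<in>I. g (P (v i)) \<le> 0" "0 < g (P b)" by blast
        have "linear (\<lambda>x. g (P x))" using linear_compose[OF P g(1)] by (simp add: o_def)
        moreover have "g (P (v j)) = 0" using Pj linear_0[OF g(1)] by simp
        ultimately show ?thesis using g by (intro disjI2 exI[of _ "\<lambda>x. g (P x)"]) auto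
      qed
    qed
  qed
qed

text \<open>
  Farkas' lemma is applied to the points \<open>(w, 1)\<close>, where the additional coordinate forces the
  coefficients to sum to \<open>1\<close>.
\<close>

lemma separate_finite_hull:
  fixes W :: "'a::real_vector set"
  assumes "finite W" "x \<notin> convex hull W"
  shows "\<exists>(f::'a \<Rightarrow> real) b. linear f \<and> (\<forall>w\<in>W. f w \<le> b) \<and> b < f x"
proof -
  have "\<nexists>c. (\<forall>i\<in>W. 0 \<le> c i) \<and> (x, 1::real) = (\<Sum>i\<in>W. c i *\<^sub>R (i, 1))"
  proof
    assume "\<exists>c. (\<forall>i\<in>W. 0 \<le> c i) \<and> (x, 1::real) = (\<Sum>i\<in>W. c i *\<^sub>R (i, 1))"
    then obtain c where c: "\<forall>i\<in>W. 0 \<le> c i" "(x, 1::real) = (\<Sum>i\<in>W. c i *\<^sub>R (i, 1))" by blast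
    then have "x = (\<Sum>i\<in>W. c i *\<^sub>R i)" "(\<Sum>i\<in>W. c i) = 1"
      by (simp_all add: prod_eq_iff fst_sum snd_sum)
    then show False using assms c(1) by (auto simp: convex_hull_finite)
  qed
  then obtain G :: "'a \<times> real \<Rightarrow> real" where G: "linear G" "\<forall>i\<in>W. G (i, 1) \<le> 0" "0 < G (x, 1)"
    using farkas[OF assms(1), of "(x, 1::real)" "\<lambda>i. (i, 1)"] by blast
  have lin: "linear (\<lambda>y. G (y, 0))"
  proof (rule linearI)
    show "G (y + z, 0) = G (y, 0) + G (z, 0)" for y z
      using linear_add[OF G(1), of "(y, 0)" "(z, 0)"] by simp
    show "G (r *\<^sub>R y, 0) = r *\<^sub>R G (y, 0)" for r y
      using linear_scale[OF G(1), of r "(y, 0)"] by simp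
  qed
  have "G (y, 1) = G (y, 0) + G (0, 1)" for y
    using linear_add[OF G(1), of "(y, 0)" "(0, 1)"] by simp
  then have split: "G (y, 1) = G (y, 0) + G (0, 1)" for y .
  have "G (w, 0) \<le> - G (0, 1)" if "w \<in> W" for w
    using bspec[OF G(2) that] split[of w] by linarith
  moreover have "- G (0, 1) < G (x, 0)" using G(3) split[of x] by linarith
  ultimately show ?thesis using lin by blast
qed

lemma linear_const_affine_hull:
  fixes f :: "'a::real_vector \<Rightarrow> real"
  assumes "linear f" "\<And>w. w \<in> W \<Longrightarrow> f w = c" "x \<in> affine hull W"
  shows "f x = c"
proof -
  have "affine hull W \<subseteq> {x. f x = c}"
  proof (rule hull_minimal)
    show "affine {x. f x = c}"
      unfolding affine_def
      by (auto simp: linear_add[OF assms(1)] linear_scale[OF assms(1)] simp flip: distrib_right)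
  qed (use assms in auto)
  then show ?thesis using assms by blast
qed

lemma linear_le_convex_hull:
  fixes f :: "'a::real_vector \<Rightarrow> real"
  assumes "linear f" "\<And>w. w \<in> W \<Longrightarrow> f w \<le> c" "x \<in> convex hull W"
  shows "f x \<le> c"
proof -
  have "convex hull W \<subseteq> {x. f x \<le> c}"
  proof (rule hull_minimal)
    show "convex {x. f x \<le> c}"
      unfolding convex_def
      by (auto simp: linear_add[OF assms(1)] linear_scale[OF assms(1)] intro!: convex_bound_le)
  qed (use assms in auto)
  then show ?thesis using assms by blast
qed

section \<open>Facets of finite convex hulls\<close>

text \<open>
  For a linear space \<open>X \<noteq> {0}\<close> the last condition says that the tight points of \<open>W\<close> span the
  hyperplane \<open>f = b\<close> of \<open>X\<close> affinely. Phrased through functionals it avoids dimensions, and it can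
  be read off coordinates.
\<close>

definition facet_functional :: "'a::real_vector set \<Rightarrow> 'a set \<Rightarrow> ('a \<Rightarrow> real) \<Rightarrow> real \<Rightarrow> bool" where
  "facet_functional X W f b \<longleftrightarrow> linear f \<and> (\<forall>w\<in>W. f w \<le> b) \<and> (\<exists>w\<in>W. f w < b) \<and>
    (\<forall>g c. linear g \<longrightarrow> (\<forall>w\<in>W. f w = b \<longrightarrow> g w = c) \<longrightarrow> (\<exists>k. \<forall>x\<in>X. g x - c = k * (f x - b)))"

lemma linear_combo:
  fixes f g :: "'a::real_vector \<Rightarrow> real"
  assumes "linear f" "linear g"
  shows "linear (\<lambda>x. f x + t * g x)"
  by (rule linearI) (simp_all add: linear_add[OF assms(1)] linear_add[OF assms(2)]
    linear_scale[OF assms(1)] linear_scale[OF assms(2)] algebra_simps)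

text \<open>
  If \<open>x\<close> is outside the hull, choose a separating inequality with as many tight points as
  possible. It is a facet functional: otherwise a functional that vanishes on the tight points, is
  not a multiple of it, and vanishes at \<open>x\<close> as well would allow it to be tilted until a further
  point becomes tight, without changing its value at \<open>x\<close>.
\<close>

lemma facet_functionals_describe_hull:
  fixes W :: "'a::real_vector set"
  assumes W: "finite W" and X: "affine hull W = X" and x: "x \<in> X"
    and sat: "\<And>f b. facet_functional X W f b \<Longrightarrow> f x \<le> b"
  shows "x \<in> convex hull W"
proof (rule ccontr)
  assume "x \<notin> convex hull W"
  define sep where "sep = (\<lambda>(f::'a \<Rightarrow> real, b). linear f \<and> (\<forall>w\<in>W. f w \<le> b) \<and> b < f x)"
  define tight where "tight = (\<lambda>(f::'a \<Rightarrow> real, b). {w\<in>W. f w = b})"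
  have tW: "tight p \<subseteq> W" for p by (cases p) (auto simp: tight_def)
  then have fin: "finite (tight p)" for p using W finite_subset by blast
  have cW: "card (tight p) < Suc (card W)" for p using card_mono[OF W tW[of p]] by simp
  obtain f0 b0 where fb0: "sep (f0, b0)"
    using separate_finite_hull[OF W \<open>x \<notin> convex hull W\<close>] unfolding sep_def by blast
  have "\<exists>p. sep p \<and> (\<forall>q. sep q \<longrightarrow> card (tight q) \<le> card (tight p))"
    by (rule ex_has_greatest_nat[where b = "Suc (card W)", of sep, OF fb0]) (simp add: cW)
  then obtain p where p: "sep p" "\<And>q. sep q \<Longrightarrow> card (tight q) \<le> card (tight p)" by metis
  obtain f b where fb: "p = (f, b)" by (cases p)
  have f: "linear f" "\<And>w. w \<in> W \<Longrightarrow> f w \<le> b" "b < f x" using p(1) by (auto simp: sep_def fb)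
  have strict: "\<exists>w\<in>W. f w < b"
  proof (rule ccontr)
    assume "\<not> (\<exists>w\<in>W. f w < b)"
    then have "f x = b" using linear_const_affine_hull[OF f(1), of W b x] f(2) X x by (force simp: not_less)
    then show False using f by simp
  qed
  have unique: "\<exists>k. \<forall>y\<in>X. g y - c = k * (f y - b)"
    if g: "linear g" and gc: "\<forall>w\<in>W. f w = b \<longrightarrow> g w = c" for g c
  proof (rule ccontr)
    assume no: "\<not> (\<exists>k. \<forall>y\<in>X. g y - c = k * (f y - b))"
    \<comment> \<open>the multiple of \<open>f - b\<close> to be subtracted from \<open>g - c\<close> so that the difference vanishes at \<open>x\<close>\<close>
    define k where "k = (g x - c) / (f x - b)"
    have "\<exists>w\<in>W. g w - c \<noteq> k * (f w - b)"
    proof (rule ccontr)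
      assume "\<not> ?thesis"
      then have "g w + (- k) * f w = c - k * b" if "w \<in> W" for w
        using that by (force simp: algebra_simps)
      then have "g y + (- k) * f y = c - k * b" if "y \<in> X" for y
        using linear_const_affine_hull[OF linear_combo[OF g f(1), of "- k"]] that X by blast
      then have "\<forall>y\<in>X. g y - c = k * (f y - b)" by (force simp: algebra_simps)
      then show False using no by blast
    qed
    then obtain w0 where w0: "w0 \<in> W" "g w0 - c \<noteq> k * (f w0 - b)" by blast
    \<comment> \<open>\<open>h\<close> vanishes on the tight points and at \<open>x\<close>, so tilting \<open>f\<close> along \<open>h\<close> keeps both.\<close>
    define s :: real where "s = sgn ((g w0 - c) - k * (f w0 - b))"
    define h where "h y = s * ((g y - c) - k * (f y - b))" for y
    have h0: "h w0 > 0" using w0 by (auto simp: h_def s_def sgn_if)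
    have hx: "h x = 0" using f(3) by (simp add: h_def k_def)
    have ht: "h w = 0" if "w \<in> W" "f w = b" for w using that gc by (simp add: h_def)
    define Q where "Q = {w\<in>W. h w > 0}"
    have Q: "finite Q" "Q \<noteq> {}" using W h0 w0 by (auto simp: Q_def)
    define t where "t = Min ((\<lambda>w. (b - f w) / h w) ` Q)"
    have "t \<in> (\<lambda>w. (b - f w) / h w) ` Q" unfolding t_def using Q by (intro Min_in) auto
    then obtain w1 where w1: "w1 \<in> Q" "t = (b - f w1) / h w1" by blast
    have tle: "t \<le> (b - f w) / h w" if "w \<in> Q" for w unfolding t_def using Q that by (intro Min_le) auto
    have "f w1 < b" using w1 f(2)[of w1] ht[of w1] by (force simp: Q_def)
    then have tpos: "0 < t" using w1 by (simp add: Q_def)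
    define f' where "f' y = f y + (t * s) * (g y + (- k) * f y)" for y
    define b' where "b' = b + (t * s) * (c - k * b)"
    have f'h: "f' y - b' = (f y - b) + t * h y" for y
      unfolding f'_def b'_def h_def by (simp add: algebra_simps)
    have lf': "linear f'" unfolding f'_def by (intro linear_combo f g)
    have "f' w \<le> b'" if "w \<in> W" for w
    proof (cases "h w > 0")
      case True
      then have "t * h w \<le> b - f w" using tle[of w] that by (simp add: Q_def field_simps)
      then show ?thesis using f'h[of w] by simp
    next
      case False
      then have "t * h w \<le> 0" using tpos by (simp add: mult_le_0_iff)
      then show ?thesis using f'h[of w] f(2)[OF that] by linarith
    qed
    moreover have "b' < f' x" using f'h[of x] hx f(3) by simp
    ultimately have "sep (f', b')" using lf' by (simp add: sep_def)
    then have "card (tight (f', b')) \<le> card (tight p)" using p(2) by blast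
    moreover have "tight p \<subset> tight (f', b')"
    proof -
      have "w \<in> tight (f', b')" if "w \<in> tight p" for w
        using that ht[of w] f'h[of w] by (simp add: tight_def fb)
      moreover have "f' w1 = b'" using f'h[of w1] w1 by (simp add: Q_def)
      then have "w1 \<in> tight (f', b')" using w1 by (simp add: tight_def Q_def)
      moreover have "w1 \<notin> tight p" using \<open>f w1 < b\<close> by (simp add: tight_def fb)
      ultimately show ?thesis by blast
    qed
    ultimately show False using psubset_card_mono[OF fin] by (metis not_less)
  qed
  have "facet_functional X W f b"
    unfolding facet_functional_def
  proof (intro conjI allI impI)
    show "\<forall>w\<in>W. f w \<le> b" by (rule ballI) (rule f(2))
    show "\<exists>k. \<forall>x\<in>X. g x - c = k * (f x - b)"
      if "linear g" "\<forall>w\<in>W. f w = b \<longrightarrow> g w = c" for g c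
      by (rule unique[OF that])
  qed (rule f(1) strict)+
  then have "f x \<le> b" by (rule sat)
  then show False using f(3) by linarith
qed

text \<open>
  Affine dimension is well defined in every real vector space, for sets with a finite affine
  basis: with a base point chosen, two affine bases become two bases of the same linear space.
\<close>

lemma affine_basis_card_unique:
  fixes B B' :: "'a::real_vector set"
  assumes "finite B" "\<not> affine_dependent B" "\<not> affine_dependent B'" "affine hull B' = affine hull B"
  shows "card B' = card B"
proof (cases "B = {}")
  case True
  then have "B' = {}" using assms(4) by (metis affine_hull_eq_empty)
  then show ?thesis using True by simp
next
  case False
  then have "B' \<noteq> {}" using assms(4) by (metis affine_hull_eq_empty)
  then obtain b b' where b: "b \<in> B" "b' \<in> B'" using False by blast
  define C where "C = (\<lambda>x. - b + x) ` (B - {b})"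
  define C' where "C' = (\<lambda>x. - b' + x) ` (B' - {b'})"
  have C: "independent C" "independent C'" unfolding C_def C'_def
    using assms(2,3) affine_dependent_iff_dependent2 b by blast+
  have H: "affine hull B = (\<lambda>x. b + x) ` span C" "affine hull B = (\<lambda>x. b' + x) ` span C'"
    using affine_hull_span2[OF b(1)] affine_hull_span2[OF b(2)] assms(4) unfolding C_def C'_def by auto
  have "b' \<in> affine hull B" using b assms(4) hull_inc[of b' B'] by auto
  then have d: "b' - b \<in> span C" unfolding H(1) by auto
  have "x \<in> span C \<longleftrightarrow> x \<in> span C'" for x
  proof -
    have "x \<in> span C' \<longleftrightarrow> b' + x \<in> affine hull B" unfolding H(2) by auto
    also have "\<dots> \<longleftrightarrow> (b' - b) + x \<in> span C"
      unfolding H(1) image_iff by (metis (no_types,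
        opaque_lifting) add.commute add_diff_cancel_left' diff_add_eq)
    also have "\<dots> \<longleftrightarrow> x \<in> span C" using d span_add_eq by blast
    finally show ?thesis by simp
  qed
  then have sp: "span C = span C'" by blast
  have fC: "finite C" using assms(1) by (simp add: C_def)
  have 1: "finite C' \<and> card C' \<le> card C"
    by (rule independent_span_bound[OF fC C(2)]) (use sp span_superset in auto)
  then have 2: "card C \<le> card C'"
    using independent_span_bound[OF _ C(1), of C'] sp span_superset by auto
  have "card C = card (B - {b})" "card C' = card (B' - {b'})"
    unfolding C_def C'_def by (auto intro!: card_image)
  moreover have "finite B'"
  proof -
    have "finite (B' - {b'})" using 1 unfolding C'_def by (subst (asm) finite_image_iff) auto
    then show ?thesis by simp
  qed
  ultimately show ?thesis using 1 2 b assms(1) by (metis card.remove le_antisym)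
qed

lemma affdim_eq:
  assumes "finite B" "\<not> affine_dependent B" "affine hull B = affine hull V"
  shows "affdim V = int (card B) - 1"
  unfolding affdim_def
proof (rule some_equality)
  show "\<exists>B'. affine hull B' = affine hull V \<and> \<not> affine_dependent B' \<and> int (card B') = int (card B) - 1 + 1"
    using assms by (intro exI[of _ B]) auto
  fix d assume "\<exists>B'. affine hull B' = affine hull V \<and> \<not> affine_dependent B' \<and> int (card B') = d + 1"
  then obtain B' where "affine hull B' = affine hull V" "\<not> affine_dependent B'" "int (card B') = d + 1" by blast
  then show "d = int (card B) - 1" using affine_basis_card_unique[OF assms(1,2), of B'] assms(3) by simp
qed

lemma affdim_translated_span:
  assumes "finite C" "independent C" "affine hull V = (\<lambda>x. a + x) ` span C"
  shows "affdim V = int (card C)"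
proof -
  define B where "B = insert a ((\<lambda>x. a + x) ` C)"
  have "0 \<notin> C" using assms(2) dependent_zero by blast
  then have aC: "a \<notin> (\<lambda>x. a + x) ` C" by auto
  then have eq: "(\<lambda>x. - a + x) ` (B - {a}) = C" unfolding B_def by (auto simp: image_image)
  have "a \<in> B" by (simp add: B_def)
  then have "\<not> affine_dependent B" "affine hull B = affine hull V"
    using affine_dependent_iff_dependent2[of a B] affine_hull_span2[of a B] assms(2,3) unfolding eq by auto
  then have "affdim V = int (card B) - 1" using assms(1) by (intro affdim_eq) (auto simp: B_def)
  moreover have "card B = Suc (card C)" unfolding B_def using aC assms(1) by (simp add: card_image)
  ultimately show ?thesis by simp
qed

lemma affine_basis_of_finite_dim:
  fixes V :: "'a::real_vector set"
  assumes "finite S" "V \<subseteq> span S" "V \<noteq> {}"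
  obtains a B C where "a \<in> V" "B \<subseteq> V" "finite B" "B \<noteq> {}" "affine hull B = affine hull V"
    "finite C" "independent C" "affine hull V = (\<lambda>x. a + x) ` span C" "affdim V = int (card C)" "C \<subseteq> span S"
proof -
  obtain B where B: "B \<subseteq> V" "\<not> affine_dependent B" "affine hull V = affine hull B"
    using affine_basis_exists by blast
  have "B \<noteq> {}" using B assms(3) by (metis affine_hull_eq_empty)
  then obtain a where a: "a \<in> B" by blast
  define C where "C = (\<lambda>x. - a + x) ` (B - {a})"
  have C: "independent C" unfolding C_def using affine_dependent_iff_dependent2 B a by blast
  have sub: "C \<subseteq> span S" unfolding C_def using B a assms(2) by (auto intro!: span_diff)
  have fC: "finite C" using independent_span_bound[OF assms(1) C sub] by blast
  then have "finite (B - {a})" unfolding C_def by (subst (asm) finite_image_iff) auto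
  then have fB: "finite B" by simp
  have H: "affine hull V = (\<lambda>x. a + x) ` span C" using affine_hull_span2[OF a] B(3) unfolding C_def by simp
  show thesis
    using that[of a B C] a B fB \<open>B \<noteq> {}\<close> fC C H sub affdim_translated_span[OF fC C H] by blast
qed

lemma independent_card_spans:
  assumes "finite S" "independent D" "D \<subseteq> span S" "card S \<le> card D"
  shows "span D = span S"
proof
  show "span D \<subseteq> span S" using assms(3) span_minimal subspace_span by blast
  have "y \<in> span D" if "y \<in> span S" for y
  proof (rule ccontr)
    assume y: "y \<notin> span D"
    have fD: "finite D" using independent_span_bound[OF assms(1-3)] by blast
    have "card (insert y D) \<le> card S"
      using independent_span_bound[OF assms(1) independent_insertI[OF y assms(2)]] that assms(3) by blast
    moreover have "y \<notin> D" using y span_base by blast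
    ultimately show False using assms(4) fD by simp
  qed
  then show "span S \<subseteq> span D" by blast
qed

lemma tight_face_of:
  fixes f :: "'a::real_vector \<Rightarrow> real"
  assumes f: "linear f" and "\<And>x. x \<in> S \<Longrightarrow> f x \<le> b" and "convex S"
  shows "{x\<in>S. f x = b} face_of S"
  unfolding face_of_def
proof (intro conjI ballI impI)
  have "convex {x. f x = b}" unfolding convex_def
    by (auto simp: linear_add[OF f] linear_scale[OF f] simp flip: distrib_right)
  from convex_Int[OF assms(3) this] show "convex {x\<in>S. f x = b}" by (simp add: Int_def)
  fix y z x assume yz: "y \<in> S" "z \<in> S" and x: "x \<in> {x\<in>S. f x = b}" "x \<in> open_segment y z"
  then obtain u where u: "0 < u" "u < 1" "x = (1 - u) *\<^sub>R y + u *\<^sub>R z" by (auto simp: in_segment)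
  have "b = f x" using x(1) by simp
  also have "f x = (1 - u) * f y + u * f z"
    unfolding u(3) by (simp only: linear_add[OF f] linear_scale[OF f] real_scaleR_def)
  finally have "(1 - u) * (b - f y) + u * (b - f z) = 0" by (simp add: algebra_simps)
  moreover have "0 \<le> (1 - u) * (b - f y)" "0 \<le> u * (b - f z)" using assms(2) yz u by auto
  ultimately have "(1 - u) * (b - f y) = 0" "u * (b - f z) = 0" by linarith+
  then show "y \<in> {x\<in>S. f x = b}" "z \<in> {x\<in>S. f x = b}" using u yz by auto
qed auto

lemma tight_hull:
  fixes f :: "'a::real_vector \<Rightarrow> real"
  assumes W: "finite W" and f: "linear f" and le: "\<And>w. w \<in> W \<Longrightarrow> f w \<le> b"
    and x: "x \<in> convex hull W" "f x = b"
  shows "x \<in> convex hull {w\<in>W. f w = b}"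
proof -
  obtain u where u: "\<forall>w\<in>W. 0 \<le> u w" "sum u W = 1" "(\<Sum>w\<in>W. u w *\<^sub>R w) = x"
    using x(1) by (auto simp: convex_hull_finite[OF W])
  have "(\<Sum>w\<in>W. u w * (b - f w)) = b * sum u W - f x"
    unfolding u(3)[symmetric] by (simp add: linear_sum[OF f] linear_scale[OF f] right_diff_distrib
      sum_subtractf sum_distrib_left mult.commute)
  then have "(\<Sum>w\<in>W. u w * (b - f w)) = 0" using u x by simp
  then have z: "u w * (b - f w) = 0" if "w \<in> W" for w
    using sum_nonneg_eq_0_iff[OF W, of "\<lambda>w. u w * (b - f w)"] u le that by auto
  let ?T = "{w\<in>W. f w = b}"
  have "u w = 0" if "w \<in> W - ?T" for w using z[of w] that by auto
  then have "sum u ?T = 1" "(\<Sum>w\<in>?T. u w *\<^sub>R w) = x"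
    using u W by (auto simp: sum.mono_neutral_left[of W ?T])
  moreover have "finite ?T" "\<forall>w\<in>?T. 0 \<le> u w" using W u by auto
  ultimately show ?thesis unfolding convex_hull_finite[OF \<open>finite ?T\<close>]
    by (intro CollectI exI[of _ u] conjI)
qed

text \<open>
  The affine hull of the tight points is the whole hyperplane \<open>f = b\<close>: for a point of the
  hyperplane outside of it, some affine functional would vanish on the tight points but not at
  that point, and so would not be a multiple of \<open>f - b\<close>. The hyperplane has one dimension less
  than \<open>X\<close>.
\<close>

theorem facet_functional_facet:
  fixes W :: "'a::real_vector set"
  assumes ff: "facet_functional X W f b"
    and S: "finite S" "independent S" "X = span S" and W: "affine hull W = X" and X: "X \<noteq> {0}"
  shows "facet {x \<in> convex hull W. f x = b} (convex hull W)"
proof -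
  let ?F = "{x \<in> convex hull W. f x = b}"
  have f: "linear f" and le: "\<And>w. w \<in> W \<Longrightarrow> f w \<le> b"
    and unique: "\<And>g c. linear g \<Longrightarrow> (\<And>w. w \<in> W \<Longrightarrow> f w = b \<Longrightarrow> g w = c) \<Longrightarrow> \<exists>k. \<forall>x\<in>X. g x - c = k * (f x - b)"
    using ff unfolding facet_functional_def by blast+
  have "\<exists>w\<in>W. f w < b" using ff unfolding facet_functional_def by (elim conjE)
  then obtain w0 where w0: "w0 \<in> W" "f w0 < b" by blast
  have WX: "W \<subseteq> X" using hull_subset[of W affine] W by simp
  define T where "T = {w\<in>W. f w = b}"
  have sX: "subspace X" using S by simp
  have "T \<noteq> {}"
  proof
    assume "T = {}"
    then have empty: "\<not> (w \<in> W \<and> f w = b)" for w by (auto simp: T_def)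
    obtain y where y: "y \<in> X" "y \<noteq> 0" using X sX subspace_0 by fastforce
    then have "y \<notin> span {}" by simp
    then obtain g :: "'a \<Rightarrow> real" where g: "linear g" "g y = 1" using linear_functional_exists by blast
    obtain k where k: "\<forall>x\<in>X. 0 - 1 = k * (f x - b)"
      using unique[of "\<lambda>_. 0" 1] empty linear_zero by blast
    obtain k' where k': "\<forall>x\<in>X. g x - 0 = k' * (f x - b)" using unique[of g 0] g empty by blast
    have X0: "0 \<in> X" using sX subspace_0 by blast
    have "b \<noteq> 0" using k X0 linear_0[OF f] by force
    then have "k' = 0" using k' X0 linear_0[OF f] linear_0[OF g(1)] by fastforce
    then show False using k' y g by force
  qed
  then obtain t where t: "t \<in> W" "f t = b" by (auto simp: T_def)
  define H where "H = {x\<in>X. f x = b}"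
  have affH: "affine H"
    using subspace_imp_affine[OF sX] unfolding H_def affine_def
    by (auto simp: linear_add[OF f] linear_scale[OF f] simp flip: distrib_right)
  have TH: "affine hull T = H"
  proof
    show "affine hull T \<subseteq> H" by (rule hull_minimal) (use affH WX in \<open>auto simp: T_def H_def\<close>)
    show "H \<subseteq> affine hull T"
    proof
      fix x assume x: "x \<in> H"
      show "x \<in> affine hull T"
      proof (rule ccontr)
        assume nx: "x \<notin> affine hull T"
        have tT: "t \<in> T" using t by (simp add: T_def)
        have "x - t \<notin> span ((\<lambda>x. - t + x) ` (T - {t}))"
        proof
          assume "x - t \<in> span ((\<lambda>x. - t + x) ` (T - {t}))"
          then have "t + (x - t) \<in> affine hull T" unfolding affine_hull_span2[OF tT] by blast
          then show False using nx by simp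
        qed
        then obtain g :: "'a \<Rightarrow> real" where g: "linear g"
          "\<forall>y\<in>span ((\<lambda>x. - t + x) ` (T - {t})). g y = 0" "g (x - t) = 1"
          using linear_functional_exists by blast
        have "g w = g t" if "w \<in> W" "f w = b" for w
        proof (cases "w = t")
          case False
          then have "- t + w \<in> span ((\<lambda>x. - t + x) ` (T - {t}))"
            using that by (intro span_base) (auto simp: T_def)
          then have "g (w - t) = 0" using g(2) by simp
          then show ?thesis by (simp add: linear_diff[OF g(1)])
        qed simp
        then obtain k where "\<forall>y\<in>X. g y - g t = k * (f y - b)" using unique[OF g(1)] by blast
        then have "g x - g t = 0" using x by (auto simp: H_def)
        then show False using g(3) by (simp add: linear_diff[OF g(1)])
      qed
    qed
  qed
  have FH: "affine hull ?F = H"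
  proof
    have "convex hull W \<subseteq> X" using WX sX by (simp add: hull_minimal subspace_imp_convex)
    then show "affine hull ?F \<subseteq> H" by (intro hull_minimal) (use affH in \<open>auto simp: H_def\<close>)
    have "T \<subseteq> ?F" by (auto simp: T_def hull_inc)
    then show "H \<subseteq> affine hull ?F" unfolding TH[symmetric] by (rule hull_mono)
  qed
  define K where "K = {x\<in>X. f x = 0}"
  have sK: "subspace K" using sX unfolding K_def subspace_def
    by (auto simp: linear_add[OF f] linear_scale[OF f] linear_0[OF f])
  obtain C where C: "C \<subseteq> K" "independent C" "K \<subseteq> span C" using maximal_independent_subset by blast
  have spK: "span C = K" using C sK span_minimal by (metis subset_antisym)
  have CX: "C \<subseteq> span S" using C(1) S by (auto simp: K_def)
  have fC: "finite C" using independent_span_bound[OF S(1) C(2) CX] by blast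
  have "H = (\<lambda>x. t + x) ` span C"
  proof -
    have tX: "t \<in> X" using t WX by blast
    have "x \<in> H \<longleftrightarrow> x - t \<in> K" for x
      unfolding H_def K_def using t tX sX subspace_diff[of X x t] subspace_add[of X "x - t" t]
      by (auto simp: linear_diff[OF f])
    then have HK: "\<And>x. x \<in> H \<longleftrightarrow> x - t \<in> K" by blast
    show ?thesis unfolding spK
    proof (intro set_eqI iffI)
      show "x \<in> (\<lambda>x. t + x) ` K" if "x \<in> H" for x
        by (rule image_eqI[of x "\<lambda>x. t + x" "x - t" K]) (use HK[of x] that in simp_all)
      show "x \<in> H" if "x \<in> (\<lambda>x. t + x) ` K" for x
        using that by (rule imageE) (simp add: HK)
    qed
  qed
  then have dF: "affdim ?F = int (card C)" using FH fC C(2) affdim_translated_span by metis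
  have "affdim (convex hull W) = int (card S)"
    by (rule affdim_translated_span[where a = 0]) (use S W in \<open>auto simp: image_iff\<close>)
  moreover have "card S = Suc (card C)"
  proof -
    define x0 where "x0 = w0 - t"
    have x0: "x0 \<in> X" "f x0 \<noteq> 0" unfolding x0_def
      using w0 t WX subspace_diff[OF sX] by (auto simp: linear_diff[OF f])
    have nx0: "x0 \<notin> span C" using x0 spK by (simp add: K_def)
    have "x \<in> span (insert x0 C)" if "x \<in> X" for x
    proof -
      have "x - (f x / f x0) *\<^sub>R x0 \<in> K"
        unfolding K_def using that x0 sX
          by (auto simp: linear_diff[OF f] linear_scale[OF f] subspace_diff subspace_scale)
      then show ?thesis unfolding span_insert spK by blast
    qed
    then have sub: "S \<subseteq> span (insert x0 C)" using S(3) span_superset[of S] by blast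
    have "card S \<le> card (insert x0 C)"
      using independent_span_bound[OF _ S(2) sub] fC by simp
    moreover have "card (insert x0 C) \<le> card S"
      using independent_span_bound[OF S(1) independent_insertI[OF nx0 C(2)]] x0 CX S(3) by auto
    moreover have "x0 \<notin> C" using nx0 span_base by blast
    ultimately show ?thesis using fC by simp
  qed
  moreover have "?F face_of convex hull W"
    by (rule tight_face_of[OF f]) (use linear_le_convex_hull[OF f le] in auto)
  moreover have "?F \<noteq> {}" using t by (auto intro!: exI[of _ t] simp: hull_inc)
  ultimately show ?thesis using dF unfolding facet_def by simp
qed

text \<open>
  A facet spans a hyperplane \<open>f = b\<close>. Points of the polytope on this hyperplane belong to the
  facet because a relatively interior point of the facet lies between such a point and another
  point of the facet. Therefore the polytope cannot have points strictly on both sides, as the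
  segment between them would meet the facet.
\<close>

theorem facet_has_functional:
  fixes W :: "'a::real_vector set"
  assumes F: "facet F (convex hull W)" and W: "finite W" "affine hull W = X"
    and S: "finite S" "independent S" "X = span S"
  shows "\<exists>f b. facet_functional X W f b \<and> F = {x \<in> convex hull W. f x = b}"
proof -
  let ?D = "convex hull W"
  have sX: "subspace X" using S by simp
  have DX: "?D \<subseteq> X" using W S hull_subset[of W affine] by (simp add: hull_minimal subspace_imp_convex)
  have face: "F face_of ?D" "F \<noteq> {}" and dF: "affdim F = affdim ?D - 1" using F by (auto simp: facet_def)
  have FD: "F \<subseteq> ?D" using face by (simp add: face_of_imp_subset)
  have "affdim ?D = int (card S)"
    by (rule affdim_translated_span[where a = 0]) (use S W in \<open>auto simp: image_iff\<close>)
  then have dF: "affdim F = int (card S) - 1" using dF by simp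
  have "F \<subseteq> span S" using FD DX S by blast
  then obtain a B C where B: "a \<in> F" "B \<subseteq> F" "finite B" "B \<noteq> {}" "affine hull B = affine hull F"
    and C: "finite C" "independent C" "affine hull F = (\<lambda>x. a + x) ` span C" "affdim F = int (card C)"
      "C \<subseteq> span S"
    using affine_basis_of_finite_dim[OF S(1) _ face(2)] by metis
  have cS: "card S = Suc (card C)" using dF C(4) by simp
  have "\<not> S \<subseteq> span C"
    using independent_span_bound[OF C(1) S(2)] cS by auto
  then obtain x0 where x0: "x0 \<in> S" "x0 \<notin> span C" by blast
  have "x0 \<notin> C" using x0 span_base by blast
  then have "span (insert x0 C) = span S"
    using x0 C cS span_base by (intro independent_card_spans S independent_insertI) auto
  obtain f :: "'a \<Rightarrow> real" where f: "linear f" "\<forall>x\<in>span C. f x = 0" "f x0 = 1"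
    using linear_functional_exists[OF x0(2)] by blast
  define b where "b = f a"
  have aX: "a \<in> X" using B FD DX by blast
  have ker: "x \<in> span C" if "x \<in> X" "f x = 0" for x
  proof -
    have "x \<in> span (insert x0 C)" using that S \<open>span (insert x0 C) = span S\<close> by simp
    then obtain k where k: "x - k *\<^sub>R x0 \<in> span C" unfolding span_insert by blast
    then have "f (x - k *\<^sub>R x0) = 0" using f(2) by blast
    then have "k = 0" using that f by (simp add: linear_diff[OF f(1)] linear_scale[OF f(1)])
    then show ?thesis using k by simp
  qed
  have H: "x \<in> affine hull F \<longleftrightarrow> x \<in> X \<and> f x = b" for x
  proof
    assume "x \<in> affine hull F"
    then obtain y where y: "y \<in> span C" "x = a + y" using C(3) by auto
    have "y \<in> span S" using y C(5) span_minimal[of C "span S"] by auto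
    then show "x \<in> X \<and> f x = b" using y f aX sX S
      by (auto simp: b_def linear_add[OF f(1)] subspace_add)
  next
    assume x: "x \<in> X \<and> f x = b"
    then have "x - a \<in> span C" using aX sX by (intro ker) (auto simp: subspace_diff linear_diff[OF f(1)] b_def)
    then have "a + (x - a) \<in> affine hull F" unfolding C(3) by blast
    then show "x \<in> affine hull F" by simp
  qed
  \<comment> \<open>The barycentre of \<open>B\<close> is relatively interior to \<open>F\<close>, so it lies between \<open>p\<close> and a point of \<open>F\<close>.\<close>
  have inF: "p \<in> F" if p: "p \<in> ?D" "f p = b" for p
  proof -
    have "p \<in> affine hull B" using H p DX B(5) by blast
    then obtain c where c: "sum c B = 1" "(\<Sum>v\<in>B. c v *\<^sub>R v) = p"
      by (auto simp: affine_hull_finite[OF B(3)])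
    define m where "m = real (card B)"
    have m: "m > 0" using B by (simp add: m_def card_gt_0_iff)
    \<comment> \<open>small enough for all coefficients \<open>u v\<close> of \<open>q' = q + e (q - p)\<close> to be nonnegative\<close>
    define e where "e = 1 / (m * (1 + (\<Sum>v\<in>B. \<bar>c v\<bar>)))"
    have s0: "0 \<le> (\<Sum>v\<in>B. \<bar>c v\<bar>)" by (intro sum_nonneg) auto
    then have s1: "0 < 1 + (\<Sum>v\<in>B. \<bar>c v\<bar>)" by linarith
    then have e: "e > 0" unfolding e_def using m by (intro divide_pos_pos mult_pos_pos) auto
    define u where "u v = ((1 + e) / m - e * c v)" for v
    have u0: "0 \<le> u v" if "v \<in> B" for v
    proof -
      have "c v \<le> (\<Sum>v\<in>B. \<bar>c v\<bar>)" using member_le_sum[OF that, of "\<lambda>v. \<bar>c v\<bar>"] B by auto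
      then have "e * c v \<le> e * (1 + (\<Sum>v\<in>B. \<bar>c v\<bar>))" using e by (intro mult_left_mono) auto
      also have "\<dots> = 1 / m" unfolding e_def using s1 m by (simp only: times_divide_eq_left mult_1)
        (simp add: divide_simps)
      also have "\<dots> \<le> (1 + e) / m" using e m by (simp add: divide_right_mono)
      finally show ?thesis by (simp add: u_def)
    qed
    have "sum u B = m * ((1 + e) / m) - e * sum c B"
      by (simp add: u_def sum_subtractf sum_distrib_left m_def)
    then have u1: "sum u B = 1" using c m by simp
    define q' where "q' = (\<Sum>v\<in>B. u v *\<^sub>R v)"
    have cF: "convex F" using face(1) face_of_imp_convex by blast
    have "q' \<in> convex hull B" unfolding q'_def using u0 u1 by (auto simp: convex_hull_finite[OF B(3)])
    then have q': "q' \<in> F" using hull_minimal[of B F convex] B(2) cF by blast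
    define q where "q = (\<Sum>v\<in>B. (1 / m) *\<^sub>R v)"
    have "sum (\<lambda>_. 1 / m) B = 1" using m by (simp add: m_def)
    then have "q \<in> convex hull B" unfolding q_def using m
      by (auto simp: convex_hull_finite[OF B(3)] intro!: exI[of _ "\<lambda>_. 1 / m"])
    then have q: "q \<in> F" using hull_minimal[of B F convex] B(2) cF by blast
    have "q' = (1 + e) *\<^sub>R q - e *\<^sub>R p"
      unfolding q'_def q_def c(2)[symmetric] u_def
      by (simp add: scaleR_diff_left sum_subtractf scaleR_sum_right)
    then have eq: "(1 + e) *\<^sub>R q = q' + e *\<^sub>R p" by simp
    have "q = (1 / (1 + e)) *\<^sub>R ((1 + e) *\<^sub>R q)" using e by simp
    also have "\<dots> = (1 - e / (1 + e)) *\<^sub>R q' + (e / (1 + e)) *\<^sub>R p"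
      unfolding eq using e by (simp add: scaleR_add_right field_simps)
    finally have q2: "q = (1 - e / (1 + e)) *\<^sub>R q' + (e / (1 + e)) *\<^sub>R p" .
    show ?thesis
    proof (cases "q' = p")
      case False
      then have "q \<in> open_segment q' p" unfolding in_segment using e q2
        by (intro conjI exI[of _ "e / (1 + e)"]) (auto simp: field_simps)
      then show ?thesis using face(1) q q' p(1) FD unfolding face_of_def by blast
    qed (use q' in simp)
  qed
  have Feq: "F = {x \<in> ?D. f x = b}"
    using inF FD H hull_inc[of _ F affine] by blast
  have sides: "\<not> (f y < b \<and> b < f z)" if yz: "y \<in> ?D" "z \<in> ?D" for y z
  proof
    assume s: "f y < b \<and> b < f z"
    define u where "u = (b - f y) / (f z - f y)"
    have u: "0 < u" "u < 1" using s by (auto simp: u_def field_simps)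
    define p where "p = (1 - u) *\<^sub>R y + u *\<^sub>R z"
    have "f p = (1 - u) * f y + u * f z"
      unfolding p_def by (simp only: linear_add[OF f(1)] linear_scale[OF f(1)] real_scaleR_def)
    also have "\<dots> = f y + u * (f z - f y)" by (simp add: algebra_simps)
    also have "\<dots> = b" using s by (simp add: u_def)
    finally have fp: "f p = b" .
    have "p \<in> ?D" unfolding p_def using yz u convex_convex_hull[of W] by (auto intro!: convexD)
    then have "p \<in> F" using inF fp by blast
    moreover have "p \<in> open_segment y z" unfolding in_segment p_def using u s by auto
    ultimately have "y \<in> F" using face(1) yz unfolding face_of_def by blast
    then show False using Feq s by auto
  qed
  have nonconst: "\<exists>w\<in>W. f w \<noteq> b"
  proof (rule ccontr)
    assume "\<not> ?thesis"
    then have const: "f x = b" if "x \<in> X"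
      for x using linear_const_affine_hull[OF f(1), of W b x] that W by blast
    have "f 0 = b" using const sX subspace_0 by blast
    moreover have "f x0 = b" using const[of x0] x0 S(3) span_base[of x0 S] by simp
    ultimately show False using f linear_0[OF f(1)] by simp
  qed
  have main: "facet_functional X W f' b'"
    if f': "linear f'" "\<And>w. w \<in> W \<Longrightarrow> f' w \<le> b'"
      and s: "s \<noteq> 0" "\<And>x. f' x - b' = s * (f x - b)" for f' b' s
  proof -
    have tight: "f' x = b' \<longleftrightarrow> f x = b" for x using s(2)[of x] s(1) by auto
    have strict: "\<exists>w\<in>W. f' w < b'" using nonconst f'(2) tight by (metis less_eq_real_def)
    have "\<exists>k. \<forall>x\<in>X. g x - c = k * (f' x - b')"
      if g: "linear g" "\<forall>w\<in>W. f' w = b' \<longrightarrow> g w = c" for g c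
    proof -
      have gF: "g x = c" if "x \<in> F" for x
      proof -
        have "x \<in> convex hull {w\<in>W. f' w = b'}"
          using tight_hull[OF W(1) f'] that Feq tight by blast
        then have "x \<in> affine hull {w\<in>W. f' w = b'}" by (rule subsetD[OF convex_hull_subset_affine_hull])
        then show ?thesis by (rule linear_const_affine_hull[OF g(1), rotated]) (use g(2) in auto)
      qed
      have gH: "g x = c" if "x \<in> X" "f x = b" for x
        by (rule linear_const_affine_hull[OF g(1) gF]) (use H[of x] that in auto)
      have gK: "g x = 0" if "x \<in> span C" for x
      proof -
        have "a + x \<in> affine hull F" using that C(3) by blast
        then have "g (a + x) = c" using H gH by blast
        moreover have "g a = c" using gF B(1) by blast
        ultimately show ?thesis by (simp add: linear_add[OF g(1)])
      qed
      have "g x - c = (g x0 / s) * (f' x - b')" if "x \<in> X" for x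
      proof -
        have "x - a - (f x - b) *\<^sub>R x0 \<in> span C"
        proof (rule ker)
          have "x0 \<in> X" using x0(1) S(3) span_base by simp
          then show "x - a - (f x - b) *\<^sub>R x0 \<in> X"
            by (intro subspace_diff[OF sX] subspace_scale[OF sX] that aX)
          show "f (x - a - (f x - b) *\<^sub>R x0) = 0"
            by (simp add: linear_diff[OF f(1)] linear_scale[OF f(1)] f(3) b_def)
        qed
        then have "g (x - a - (f x - b) *\<^sub>R x0) = 0" using gK by blast
        then have "g x - g a = (f x - b) * g x0" by (simp add: linear_diff[OF g(1)] linear_scale[OF g(1)])
        moreover have "(g x0 / s) * (f' x - b') = (f x - b) * g x0" unfolding s(2) using s(1) by simp
        ultimately show ?thesis using gF[OF B(1)] by simp
      qed
      then show ?thesis by blast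
    qed
    moreover have "\<forall>w\<in>W. f' w \<le> b'" by (rule ballI) (rule f'(2))
    ultimately show ?thesis using f'(1) strict unfolding facet_functional_def by simp
  qed
  show ?thesis
  proof (cases "\<forall>w\<in>W. f w \<le> b")
    case True
    then have "facet_functional X W f b" using main[of f b 1] f by simp
    then show ?thesis using Feq by blast
  next
    case False
    then obtain z where z: "z \<in> W" "b < f z" by force
    then have "\<forall>w\<in>W. b \<le> f w" using sides hull_inc by (metis not_le)
    then have "facet_functional X W (\<lambda>x. - f x) (- b)"
      using main[of "\<lambda>x. - f x" "- b" "-1"] f by (simp add: linear_compose_neg)
    then show ?thesis using Feq by (intro exI[of _ "\<lambda>x. - f x"] exI[of _ "- b"]) auto
  qed
qed

section \<open>Coordinates and integer vectors\<close>

abbreviation coord :: "point \<Rightarrow> nat \<Rightarrow> real"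
  where "coord \<equiv> Poly_Mapping.lookup"

lemma coord_scaleR [simp]: "coord (r *\<^sub>R x) j = r * coord x j"
proof -
  have "finite {j. r *\<^sub>R coord x j \<noteq> 0}"
    by (rule finite_subset[OF _ finite_lookup[of x]]) auto
  then show ?thesis unfolding scaleR_poly_mapping_def by simp
qed

lemma point_eqI: "(\<And>j. coord x j = coord y j) \<Longrightarrow> x = y"
  by (simp add: poly_mapping_eq_iff fun_eq_iff)

lemmas coord_simps = lookup_add lookup_minus lookup_sum lookup_single when_def

lemma subspace_Rn: "subspace (Rn m)"
  unfolding subspace_def Rn_def by (auto simp: coord_simps)

definition std_basis :: "nat \<Rightarrow> point set"
  where "std_basis m = (\<lambda>j. Poly_Mapping.single j 1) ` {..<m}"

lemma Rn_expansion:
  assumes "x \<in> Rn m"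
  shows "x = (\<Sum>j<m. coord x j *\<^sub>R Poly_Mapping.single j 1)"
proof (rule point_eqI)
  fix i
  have "(\<Sum>j<m. coord x j * (if j = i then 1 else 0)) = (if i < m then coord x i else 0)"
    by (simp add: sum.delta' if_distrib cong: if_cong)
  then show "coord x i = coord (\<Sum>j<m. coord x j *\<^sub>R Poly_Mapping.single j 1) i"
    using assms by (auto simp: coord_simps Rn_def)
qed

lemma single_inj: "Poly_Mapping.single (i::nat) (1::real) = Poly_Mapping.single j 1 \<longleftrightarrow> i = j"
proof
  assume "Poly_Mapping.single i (1::real) = Poly_Mapping.single j 1"
  then have "coord (Poly_Mapping.single i 1) i = coord (Poly_Mapping.single j 1) i" by simp
  then show "i = j" by (auto simp: coord_simps split: if_splits)
qed auto

lemma finite_std_basis: "finite (std_basis m)" and card_std_basis: "card (std_basis m) = m"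
  by (simp_all add: std_basis_def card_image inj_on_def single_inj)

lemma span_std_basis: "span (std_basis m) = Rn m"
proof
  have "std_basis m \<subseteq> Rn m" by (auto simp: std_basis_def Rn_def coord_simps)
  then show "span (std_basis m) \<subseteq> Rn m" using subspace_Rn by (rule span_minimal)
  show "Rn m \<subseteq> span (std_basis m)"
  proof
    fix x assume "x \<in> Rn m"
    then have x: "x = (\<Sum>j<m. coord x j *\<^sub>R Poly_Mapping.single j 1)" by (rule Rn_expansion)
    show "x \<in> span (std_basis m)"
      unfolding std_basis_def by (subst x) (intro span_sum span_scale span_base imageI)
  qed
qed

lemma independent_std_basis: "independent (std_basis m)"
proof (rule independent_if_scalars_zero[OF finite_std_basis])
  fix f x assume z: "(\<Sum>x\<in>std_basis m. f x *\<^sub>R x) = 0" and "x \<in> std_basis m"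
  then obtain i where i: "i < m" "x = Poly_Mapping.single i 1" by (auto simp: std_basis_def)
  have "(\<Sum>x\<in>std_basis m. f x *\<^sub>R x) = (\<Sum>j<m. f (Poly_Mapping.single j 1) *\<^sub>R Poly_Mapping.single j 1)"
    unfolding std_basis_def by (subst sum.reindex) (auto simp: inj_on_def single_inj)
  then have "(\<Sum>j<m. f (Poly_Mapping.single j 1) * coord (Poly_Mapping.single j 1) i) = 0"
    using z by (metis (no_types, lifting) coord_scaleR lookup_sum lookup_zero sum.cong)
  then show "f x = 0" using i by (simp add: coord_simps sum.delta' if_distrib cong: if_cong)
qed

definition ip :: "nat \<Rightarrow> point \<Rightarrow> point \<Rightarrow> real"
  where "ip k x y = (\<Sum>j<k. coord x j * coord y j)"

lemma linear_ip: "linear (ip k x)"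
  by (rule linearI) (simp_all add: ip_def coord_simps algebra_simps sum.distrib sum_distrib_left)

lemma ip_commute: "ip k x y = ip k y x"
  by (simp add: ip_def mult.commute)

lemmas ip_add = linear_add[OF linear_ip] and ip_diff = linear_diff[OF linear_ip]
  and ip_scale = linear_scale[OF linear_ip, unfolded real_scaleR_def] and ip_0 = linear_0[OF linear_ip]

lemma linear_ip_left: "linear (\<lambda>x. ip k x y)"
proof -
  have "(\<lambda>x. ip k x y) = ip k y" by (rule ext) (rule ip_commute)
  then show ?thesis using linear_ip[of k y] by simp
qed

lemma linear_eq_ip:
  fixes f :: "point \<Rightarrow> real"
  assumes "linear f"
  obtains z where "z \<in> Rn k" "\<And>x. x \<in> Rn k \<Longrightarrow> f x = ip k z x"
proof
  let ?z = "\<Sum>j<k. f (Poly_Mapping.single j 1) *\<^sub>R Poly_Mapping.single j 1 :: point"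
  have c: "coord ?z i = (if i < k then f (Poly_Mapping.single i 1) else 0)" for i
    by (simp add: coord_simps sum.delta' if_distrib cong: if_cong)
  show "?z \<in> Rn k" unfolding Rn_def using c by simp
  fix x assume "x \<in> Rn k"
  then have "f x = f (\<Sum>j<k. coord x j *\<^sub>R Poly_Mapping.single j 1)" using Rn_expansion by metis
  also have "\<dots> = (\<Sum>j<k. coord x j * f (Poly_Mapping.single j 1))"
    by (simp add: linear_sum[OF assms] linear_scale[OF assms])
  finally show "f x = ip k ?z x" unfolding ip_def c by (simp add: mult.commute)
qed

definition ivec :: "int list \<Rightarrow> point"
  where "ivec u = Poly_Mapping.nth (map real_of_int u)"

lemma coord_vec: "coord (ivec u) j = (if j < length u then real_of_int (u ! j) else 0)"
  by (simp add: ivec_def nth_default_def)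

lemma vec_in_Rn: "length u \<le> k \<Longrightarrow> ivec u \<in> Rn k"
  by (simp add: Rn_def coord_vec)

lemma vec_inj: "length u = length v \<Longrightarrow> ivec u = ivec v \<longleftrightarrow> u = v"
proof
  assume l: "length u = length v" and e: "ivec u = ivec v"
  show "u = v"
  proof (rule nth_equalityI[OF l])
    fix i assume "i < length u"
    moreover have "coord (ivec u) i = coord (ivec v) i" using e by simp
    ultimately show "u ! i = v ! i" using l by (simp add: coord_vec)
  qed
qed auto

lemma dot_sum: "length u = k \<Longrightarrow> length v = k \<Longrightarrow> dot k u v = (\<Sum>j<k. u ! j * v ! j)"
proof (induction k arbitrary: u v)
  case (Suc k)
  then obtain a u' b v' where "u = a # u'" "v = b # v'" by (metis length_Suc_conv)
  then show ?case using Suc by (simp add: sum.lessThan_Suc_shift del: sum.lessThan_Suc)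
qed simp

lemma dot_ip: "length u = k \<Longrightarrow> length v = k \<Longrightarrow> real_of_int (dot k u v) = ip k (ivec u) (ivec v)"
  by (simp add: dot_sum ip_def coord_vec)

lemma length_comb [simp]: "length (lincomb k c u c' v) = k"
  by (induction k arbitrary: u v) auto

lemma comb_nth: "length u = k \<Longrightarrow> length v = k \<Longrightarrow> i < k \<Longrightarrow> lincomb k c u c' v ! i = c * u ! i + c' * v ! i"
proof (induction k arbitrary: u v i)
  case (Suc k)
  then obtain a u' b v' where "u = a # u'" "v = b # v'" by (metis length_Suc_conv)
  then show ?case using Suc by (cases i) auto
qed simp

lemma vec_comb: "length u = k \<Longrightarrow> length v = k \<Longrightarrow>
    ivec (lincomb k c u c' v) = real_of_int c *\<^sub>R ivec u + real_of_int c' *\<^sub>R ivec v"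
  by (rule point_eqI) (simp add: coord_vec coord_simps comb_nth)

lemma vec_uminus: "ivec (map uminus u) = - ivec u"
  by (rule point_eqI) (simp add: coord_vec)

lemma in_tuples: "t \<in> set (tuples k xs) \<longleftrightarrow> length t = k \<and> set t \<subseteq> set xs"
proof (induction k arbitrary: t)
  case (Suc k)
  then show ?case by (cases t) auto
qed auto

section \<open>Orthogonal complements of integer vectors\<close>

definition int_basis :: "nat \<Rightarrow> int list list \<Rightarrow> point set \<Rightarrow> bool" where
  "int_basis k B C \<longleftrightarrow> (\<forall>w\<in>set B. length w = k) \<and> distinct B \<and>
     independent (ivec ` set B) \<and> span (ivec ` set B) = C"

lemma int_basis_units: "int_basis k (units k) (Rn k)"
proof -
  have v: "ivec (map (\<lambda>j. if i = j then 1 else 0) [0..<k]) = Poly_Mapping.single i 1" if "i < k" for i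
    by (rule point_eqI) (use that in \<open>auto simp: coord_vec coord_simps\<close>)
  have "ivec ` set (units k) = std_basis k"
    unfolding units_def std_basis_def using v by (force simp: image_image atLeast0LessThan)
  moreover have "distinct (units k)"
    unfolding units_def distinct_map
  proof (intro conjI inj_onI)
    fix i j assume ij: "i \<in> set [0..<k]" "j \<in> set [0..<k]"
      and e: "map (\<lambda>l. if i = l then 1 else 0::int) [0..<k] = map (\<lambda>l. if j = l then 1 else 0) [0..<k]"
    have "map (\<lambda>l. if i = l then 1 else 0::int) [0..<k] ! i = map (\<lambda>l. if j = l then 1 else 0) [0..<k] ! i"
      by (rule arg_cong[OF e])
    then show "i = j" using ij by (simp split: if_splits)
  qed simp
  ultimately show ?thesis unfolding int_basis_def
    using independent_std_basis span_std_basis by (auto simp: units_def)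
qed

text \<open>
  The replacement \<open>L z = (u \<bullet> p) z - (u \<bullet> z) p\<close> is linear, its kernel is the line through \<open>p\<close>, and
  it maps into the complement of \<open>u\<close>, on which it is a multiple of the identity. So it maps the
  span of the other basis vectors, which does not contain \<open>p\<close>, isomorphically onto that
  complement.
\<close>

lemma int_basis_orth_step:
  assumes B: "int_basis k B C" and u: "length u = k"
  shows "int_basis k (orth_step k u B) {y \<in> C. ip k (ivec u) y = 0}"
    and "length (orth_step k u B) = (if \<exists>w\<in>set B. dot k u w \<noteq> 0 then length B - 1 else length B)"
proof -
  have len: "\<And>w. w \<in> set B \<Longrightarrow> length w = k" and dist: "distinct B"
    and ind: "independent (ivec ` set B)" and sp: "span (ivec ` set B) = C"
    using B unfolding int_basis_def by auto
  define P where "P = filter (\<lambda>w. dot k u w \<noteq> 0) B"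
  have "int_basis k (orth_step k u B) {y \<in> C. ip k (ivec u) y = 0} \<and>
    length (orth_step k u B) = (if \<exists>w\<in>set B. dot k u w \<noteq> 0 then length B - 1 else length B)"
  proof (cases P)
    case Nil
    then have z: "\<And>w. w \<in> set B \<Longrightarrow> dot k u w = 0" by (auto simp: P_def filter_empty_conv)
    have "ip k (ivec u) y = 0" if "y \<in> C" for y
    proof (rule linear_eq_0_on_span[OF linear_ip])
      show "y \<in> span (ivec ` set B)" using that sp by simp
      fix x assume "x \<in> ivec ` set B"
      then show "ip k (ivec u) x = 0" using z dot_ip[OF u len] by force
    qed
    then have "{y \<in> C. ip k (ivec u) y = 0} = C" by auto
    moreover have "orth_step k u B = B" using Nil by (simp add: orth_step_def P_def)
    ultimately show ?thesis using B z by auto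
  next
    case (Cons p ps)
    define rest where "rest = filter (\<lambda>w. dot k u w = 0) B @ ps"
    have "p \<in> set P" using Cons by simp
    then have p: "p \<in> set B" "dot k u p \<noteq> 0" by (simp_all add: P_def)
    have "mset rest + {#p#} = mset (filter (\<lambda>w. dot k u w = 0) B) + mset P"
      by (simp add: rest_def Cons)
    also have "\<dots> = mset B"
      unfolding P_def using multiset_partition[of "mset B" "\<lambda>w. dot k u w = 0"] by simp
    finally have ms: "mset B = add_mset p (mset rest)" by simp
    then have "distinct (p # rest)" using dist by (metis mset.simps(2) mset_eq_imp_distinct_iff)
    moreover have "set B = insert p (set rest)" using ms by (metis mset.simps(2) set_mset_mset list.simps(15))
    moreover have "length B = Suc (length rest)" using ms by (metis mset.simps(2) size_mset length_Cons)
    ultimately have rest: "distinct rest" "p \<notin> set rest" "set B = insert p (set rest)"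
      "length B = Suc (length rest)"
      by auto
    define D where "D = real_of_int (dot k u p)"
    have D: "D \<noteq> 0" "D = ip k (ivec u) (ivec p)"
      using p(2) dot_ip[OF u len[OF p(1)]] by (simp_all only: D_def of_int_eq_0_iff not_False_eq_True)
    define L where "L z = D *\<^sub>R z - ip k (ivec u) z *\<^sub>R ivec p" for z
    have L: "linear L" unfolding L_def
      by (rule linearI) (simp_all add: ip_add ip_scale algebra_simps)
    have Lp: "L (ivec p) = 0" by (simp add: L_def D(2))
    let ?E = "\<lambda>w. lincomb k (dot k u p) w (- dot k u w) p"
    have vL: "ivec (?E w) = L (ivec w)" if "w \<in> set B" for w
      using len[OF that] len[OF p(1)] dot_ip[OF u len[OF that]] by (simp add: vec_comb L_def D_def)
    let ?R = "ivec ` set rest"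
    have np: "ivec p \<notin> ?R"
    proof
      assume "ivec p \<in> ?R"
      then obtain w where w: "w \<in> set rest" "ivec p = ivec w" by blast
      then have "p = w" using vec_inj[of p w] len rest(3) by auto
      then show False using w rest by simp
    qed
    have img: "ivec ` set B = insert (ivec p) ?R" using rest by simp
    have nsp: "ivec p \<notin> span ?R" and indR: "independent ?R"
      using ind np unfolding img independent_insert by auto
    have inj: "inj_on L (span ?R)"
      unfolding linear_inj_on_iff_eq_0[OF L subspace_span]
    proof (intro ballI impI)
      fix z assume z: "z \<in> span ?R" "L z = 0"
      then have e: "D *\<^sub>R z = ip k (ivec u) z *\<^sub>R ivec p" by (simp add: L_def)
      have "ip k (ivec u) z = 0"
      proof (rule ccontr)
        assume nz: "ip k (ivec u) z \<noteq> 0"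
        have "ivec p = (1 / ip k (ivec u) z) *\<^sub>R (ip k (ivec u) z *\<^sub>R ivec p)" using nz by simp
        also have "\<dots> = (D / ip k (ivec u) z) *\<^sub>R z" unfolding e[symmetric] by simp
        finally show False using nsp z(1) span_scale by metis
      qed
      then show "z = 0" using e D by simp
    qed
    have "orth_step k u B = map ?E rest"
      using Cons by (simp add: orth_step_def P_def[symmetric] rest_def)
    moreover have im: "ivec ` set (map ?E rest) = L ` ?R"
      using vL rest(3) by (force simp: image_image)
    moreover have "distinct (map ?E rest)"
      unfolding distinct_map
    proof (intro conjI inj_onI)
      fix w w' assume w: "w \<in> set rest" "w' \<in> set rest" and "?E w = ?E w'"
      then have "L (ivec w) = L (ivec w')" using vL[of w] vL[of w'] rest(3) by simp
      then have "ivec w = ivec w'" using inj w by (auto dest!: inj_onD intro: span_base)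
      then show "w = w'" using vec_inj[of w w'] len rest(3) w by auto
    qed (rule rest)
    moreover have "independent (L ` ?R)"
      by (rule linear_independent_injective_image[OF L indR inj])
    moreover have "span (L ` ?R) = {y \<in> C. ip k (ivec u) y = 0}"
    proof -
      have sub: "span ?R \<subseteq> C" unfolding sp[symmetric] img by (rule span_mono) auto
      have pC: "ivec p \<in> C" unfolding sp[symmetric] img by (rule span_base) simp
      have sC: "subspace C" unfolding sp[symmetric] by simp
      have "L z \<in> {y \<in> C. ip k (ivec u) y = 0}" if "z \<in> span ?R" for z
      proof -
        have "z \<in> C" using that sub by blast
        then have "L z \<in> C" unfolding L_def by (intro subspace_diff[OF sC] subspace_scale[OF sC] pC)
        moreover have "ip k (ivec u) (L z) = 0" by (simp add: L_def ip_diff ip_scale D(2))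
        ultimately show ?thesis by simp
      qed
      moreover have "y \<in> L ` span ?R" if y: "y \<in> C" "ip k (ivec u) y = 0" for y
      proof -
        have "y \<in> span (insert (ivec p) ?R)" using y(1) sp img by simp
        then obtain c where c: "y - c *\<^sub>R ivec p \<in> span ?R" unfolding span_insert by blast
        let ?z = "(1 / D) *\<^sub>R (y - c *\<^sub>R ivec p)"
        have "L (y - c *\<^sub>R ivec p) = L y" by (simp add: linear_diff[OF L] linear_scale[OF L] Lp)
        also have "\<dots> = D *\<^sub>R y" using y by (simp add: L_def)
        finally have "L ?z = y" using D by (simp add: linear_scale[OF L])
        moreover have "?z \<in> span ?R" using c by (rule span_scale)
        ultimately show ?thesis by force
      qed
      ultimately show ?thesis unfolding linear_span_image[OF L] by blast
    qed
    ultimately show ?thesis unfolding int_basis_def using p rest(4) by auto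
  qed
  then show "int_basis k (orth_step k u B) {y \<in> C. ip k (ivec u) y = 0}"
    "length (orth_step k u B) = (if \<exists>w\<in>set B. dot k u w \<noteq> 0 then length B - 1 else length B)"
    by blast+
qed

definition complement :: "nat \<Rightarrow> int list set \<Rightarrow> point set"
  where "complement k U = {y \<in> Rn k. \<forall>u\<in>U. ip k (ivec u) y = 0}"

lemma int_basis_orth:
  "length t = j \<Longrightarrow> \<forall>u\<in>set t. length u = k \<Longrightarrow> int_basis k (orth_basis k j t) (complement k (set t))"
proof (induction j arbitrary: t)
  case 0
  then show ?case using int_basis_units by (simp add: complement_def)
next
  case (Suc j)
  then obtain u s where t: "t = u # s" by (metis length_Suc_conv)
  have "int_basis k (orth_basis k j s) (complement k (set s))" using Suc t by auto
  from int_basis_orth_step(1)[OF this, of u] have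
    "int_basis k (orth_basis k (Suc j) t) {y \<in> complement k (set s). ip k (ivec u) y = 0}"
    using Suc.prems t by simp
  moreover have "{y \<in> complement k (set s). ip k (ivec u) y = 0} = complement k (set t)"
    by (auto simp: complement_def t)
  ultimately show ?case by simp
qed

text \<open>
  A greedy choice: as long as the complement of the vectors chosen so far has dimension at least
  \<open>2\<close>, some vector of \<open>U\<close> is not orthogonal to all of it, since the complement of \<open>U\<close> is a line;
  choosing that vector lowers the dimension by one.
\<close>

lemma exists_tuple_spanning_line:
  assumes k: "1 \<le> k" and U: "\<forall>u\<in>U. length u = k" and line: "complement k U = span {z}" and z: "z \<noteq> 0"
  shows "\<exists>t a c. set t \<subseteq> U \<and> length t = k - 1 \<and> orth_basis k (k - 1) t = [a] \<and> length a = k \<and> z = c *\<^sub>R ivec a"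
proof -
  have "j \<le> k - 1 \<Longrightarrow> \<exists>t. set t \<subseteq> U \<and> length t = j \<and> length (orth_basis k j t) = k - j" for j
  proof (induction j)
    case 0
    then show ?case by (intro exI[of _ "[]"]) (simp add: units_def)
  next
    case (Suc j)
    then obtain t where t: "set t \<subseteq> U" "length t = j" "length (orth_basis k j t) = k - j" by auto
    let ?B = "orth_basis k j t"
    have B: "int_basis k ?B (complement k (set t))" using int_basis_orth t U by blast
    have "\<exists>u\<in>U. \<exists>w\<in>set ?B. dot k u w \<noteq> 0"
    proof (rule ccontr)
      assume no: "\<not> ?thesis"
      have len: "\<And>w. w \<in> set ?B \<Longrightarrow> length w = k" and ind: "independent (ivec ` set ?B)" and dist: "distinct ?B"
        using B by (auto simp: int_basis_def)
      have "ivec w \<in> complement k U" if "w \<in> set ?B" for w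
        unfolding complement_def
      proof (intro CollectI conjI ballI)
        show "ivec w \<in> Rn k" using vec_in_Rn len[OF that] by simp
        show "ip k (ivec u) (ivec w) = 0" if "u \<in> U" for u
          using no \<open>u \<in> U\<close> \<open>w \<in> set ?B\<close> U len dot_ip[of u k w] by auto
      qed
      then have "ivec ` set ?B \<subseteq> span {z}" using line by blast
      then have "card (ivec ` set ?B) \<le> 1" using independent_span_bound[OF _ ind, of "{z}"] by simp
      moreover have "inj_on ivec (set ?B)" using vec_inj len by (auto intro!: inj_onI)
      ultimately have "length ?B \<le> 1" using dist by (simp add: card_image distinct_card)
      then show False using t Suc.prems by simp
    qed
    then obtain u w where u: "u \<in> U" "w \<in> set ?B" "dot k u w \<noteq> 0" by blast
    have "length (orth_step k u ?B) = length ?B - 1"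
      using int_basis_orth_step(2)[OF B, of u] U u by auto
    then have "length (orth_basis k (Suc j) (u # t)) = k - Suc j" using t by simp
    then show ?case using t u by (intro exI[of _ "u # t"]) auto
  qed
  from this[of "k - 1"] k obtain t where t: "set t \<subseteq> U" "length t = k - 1" "length (orth_basis k (k - 1) t) = 1"
    by auto
  then obtain a where a: "orth_basis k (k - 1) t = [a]" by (metis length_0_conv length_Suc_conv One_nat_def)
  have B: "int_basis k [a] (complement k (set t))" using int_basis_orth[of t "k - 1" k] t U a by auto
  have "z \<in> complement k U" using line by (simp add: span_base)
  then have "z \<in> complement k (set t)" using t by (auto simp: complement_def)
  then have "z \<in> span {ivec a}" using B by (simp add: int_basis_def)
  then obtain c where "z = c *\<^sub>R ivec a" by (auto simp: span_singleton)
  then show ?thesis using t a B by (auto simp: int_basis_def)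
qed

section \<open>Vertices of an inequality system\<close>

lemma length_number [simp]: "length (number xs) = length xs"
  by (induction xs) auto

lemma map_snd_number: "map snd (number xs) = xs"
  by (induction xs) auto

lemma snd_number_nth: "i < length xs \<Longrightarrow> snd (number xs ! i) = xs ! i"
  by (metis length_number map_snd_number nth_map)

lemma fst_number_less: "p \<in> set (number xs) \<Longrightarrow> fst p < int (length xs)"
  by (induction xs) auto

lemma distinct_number: "distinct (map fst (number xs))"
proof (induction xs)
  case (Cons x xs)
  then show ?case using fst_number_less[of _ xs] by force
qed simp

text \<open>
  Multiplying back the factor that was left out gives the full product, because the numbers single
  out one position.
\<close>

lemma prod_list_except:
  fixes g :: "'a \<Rightarrow> int"
  assumes "distinct (map fst N)" "p \<in> set N"
  shows "prod_list (map (\<lambda>r. if fst r = fst p then 1 else g (snd r)) N) * g (snd p)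
    = prod_list (map (\<lambda>r. g (snd r)) N)"
  using assms
proof (induction N)
  case (Cons n N)
  have nf: "fst r \<noteq> fst n" if "r \<in> set N" for r using Cons.prems(1) that by (simp add: image_iff) metis
  show ?case
  proof (cases "p = n")
    case True
    have "map (\<lambda>r. if fst r = fst p then 1 else g (snd r)) N = map (\<lambda>r. g (snd r)) N"
      using nf True by (intro map_cong) auto
    from arg_cong[OF this, of prod_list] show ?thesis using True by simp
  next
    case False
    then have "p \<in> set N" using Cons.prems by simp
    moreover have "fst n \<noteq> fst p" using nf[OF \<open>p \<in> set N\<close>] by simp
    ultimately show ?thesis using Cons by simp
  qed
qed simp

lemma length_clear [simp]: "length (cleared L) = length L"
  by (simp add: cleared_def)

lemma clear_nth:
  assumes "i < length L"
  shows "cleared L ! i * snd (L ! i) = prod_list (map snd L) * fst (L ! i)"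
proof -
  let ?p = "number L ! i"
  have p: "?p \<in> set (number L)" "snd ?p = L ! i" using assms snd_number_nth by auto
  have "prod_list (map (\<lambda>r. if fst r = fst ?p then 1 else snd (snd r)) (number L)) * snd (L ! i)
      = prod_list (map (\<lambda>r. snd (snd r)) (number L))"
    using prod_list_except[OF distinct_number p(1), of snd] p(2) by simp
  also have "map (\<lambda>r. snd (snd r)) (number L) = map snd L"
    by (metis (no_types, lifting) comp_apply map_eq_conv map_map map_snd_number)
  finally show ?thesis using assms p(2) by (simp add: cleared_def algebra_simps)
qed

lemma clear_nth_real:
  assumes "i < length L" "snd (L ! i) \<noteq> 0"
  shows "real_of_int (cleared L ! i)
    = real_of_int (prod_list (map snd L)) * (real_of_int (fst (L ! i)) / real_of_int (snd (L ! i)))"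
proof -
  have "real_of_int (cleared L ! i) * real_of_int (snd (L ! i))
    = real_of_int (prod_list (map snd L)) * real_of_int (fst (L ! i))"
    using clear_nth[OF assms(1)] by (metis of_int_mult)
  then show ?thesis using assms(2) by (simp add: field_simps)
qed

lemma prod_list_pos: "(\<And>x. x \<in> set xs \<Longrightarrow> 0 < (x::int)) \<Longrightarrow> 0 < prod_list xs"
  by (induction xs) auto

text \<open>
  The point \<open>(c, x)\<close>, with the homogenising coordinate in front.
\<close>

definition homog :: "real \<Rightarrow> point \<Rightarrow> point"
  where "homog c x = Abs_poly_mapping (\<lambda>j. case j of 0 \<Rightarrow> c | Suc i \<Rightarrow> coord x i)"

lemma coord_hom: "coord (homog c x) j = (case j of 0 \<Rightarrow> c | Suc i \<Rightarrow> coord x i)"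
proof -
  have "{j. (case j of 0 \<Rightarrow> c | Suc i \<Rightarrow> coord x i) \<noteq> 0} \<subseteq> insert 0 (Suc ` {i. coord x i \<noteq> 0})"
  proof
    fix j assume "j \<in> {j. (case j of 0 \<Rightarrow> c | Suc i \<Rightarrow> coord x i) \<noteq> 0}"
    then show "j \<in> insert 0 (Suc ` {i. coord x i \<noteq> 0})" by (cases j) simp_all
  qed
  then have "finite {j. (case j of 0 \<Rightarrow> c | Suc i \<Rightarrow> coord x i) \<noteq> 0}"
    by (rule finite_subset) simp
  then show ?thesis unfolding homog_def by simp
qed

lemma coord_hom_simps [simp]: "coord (homog c x) 0 = c" "coord (homog c x) (Suc i) = coord x i"
  by (simp_all add: coord_hom)

lemma point_eq_SucI: "coord x 0 = coord y 0 \<Longrightarrow> (\<And>i. coord x (Suc i) = coord y (Suc i)) \<Longrightarrow> x = y"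
  by (rule point_eqI) (metis not0_implies_Suc)

lemma hom_eq_iff: "homog c x = homog c' x' \<longleftrightarrow> c = c' \<and> x = x'"
proof
  assume e: "homog c x = homog c' x'"
  have "coord (homog c x) j = coord (homog c' x') j" for j using e by simp
  from this[of 0] this[of "Suc i" for i] show "c = c' \<and> x = x'" by (auto intro: point_eqI)
qed auto

lemma hom_diff: "homog c x - homog c' x' = homog (c - c') (x - x')"
  by (rule point_eq_SucI) (simp_all add: coord_simps)

lemma hom_scale: "r *\<^sub>R homog c x = homog (r * c) (r *\<^sub>R x)"
  by (rule point_eq_SucI) simp_all

lemma hom_0: "homog 0 0 = 0"
  by (rule point_eq_SucI) simp_all

lemma hom_in_Rn: "x \<in> Rn d \<Longrightarrow> homog c x \<in> Rn (Suc d)"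
  by (auto simp: Rn_def coord_hom split: nat.split)

lemma Rn_Suc_hom:
  assumes "z \<in> Rn (Suc d)"
  obtains x where "x \<in> Rn d" "z = homog (coord z 0) x"
proof
  let ?x = "\<Sum>j<d. coord z (Suc j) *\<^sub>R Poly_Mapping.single j 1 :: point"
  have c: "coord ?x i = (if i < d then coord z (Suc i) else 0)" for i
    by (simp add: coord_simps sum.delta' if_distrib cong: if_cong)
  show "?x \<in> Rn d" unfolding Rn_def using c by simp
  show "z = homog (coord z 0) ?x"
    using assms c by (intro point_eq_SucI) (auto simp: Rn_def)
qed

lemma ip_hom: "ip (Suc d) (homog c x) (homog c' x') = c * c' + ip d x x'"
  by (simp add: ip_def sum.lessThan_Suc_shift del: sum.lessThan_Suc)

lemma vec_Cons: "ivec (c # u) = homog (real_of_int c) (ivec u)"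
  by (rule point_eq_SucI) (simp_all add: coord_vec)

definition vertex :: "int list \<Rightarrow> point"
  where "vertex y = (1 / real_of_int (head 0 y)) *\<^sub>R ivec (tl y)"

lemma vec_vertex:
  assumes "length y = Suc d" "0 < head 0 y"
  shows "ivec y = real_of_int (head 0 y) *\<^sub>R homog 1 (vertex y)" "vertex y \<in> Rn d"
proof -
  obtain c u where y: "y = c # u" "length u = d" using assms(1) by (metis length_Suc_conv)
  then show "ivec y = real_of_int (head 0 y) *\<^sub>R homog 1 (vertex y)"
    using assms(2) by (simp add: vertex_def vec_Cons hom_scale)
  show "vertex y \<in> Rn d" unfolding vertex_def
    by (intro subspace_scale[OF subspace_Rn] vec_in_Rn) (use assms(1) in simp)
qed

lemma of_rat_quotient_of: "real_of_int (fst (quotient_of r)) / real_of_int (snd (quotient_of r)) = of_rat r"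
proof -
  obtain p q where "quotient_of r = (p, q)" by (cases "quotient_of r")
  then show ?thesis using quotient_of_div[of r p q] by (simp add: of_rat_divide)
qed

lemma quotient_of_snd_pos: "0 < snd (quotient_of r)"
  using quotient_of_denom_pos[of r] by (cases "quotient_of r") auto

lemma row_inequality:
  assumes "length (fst c) = d"
  shows "length (hrow c) = Suc d"
    and "\<exists>Q>0. \<forall>t x. ip (Suc d) (ivec (hrow c)) (homog t x) = Q * (lin (fst c) x - of_rat (snd c) * t)"
proof -
  obtain a b where c: "c = (a, b)" by (cases c)
  define L where "L = map quotient_of (b # a)"
  define Q where "Q = real_of_int (prod_list (map snd L))"
  have "0 < prod_list (map snd L)" by (rule prod_list_pos) (auto simp: L_def quotient_of_snd_pos)
  then have Q: "0 < Q" by (simp add: Q_def)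
  have len: "length (cleared L) = Suc d" using assms by (simp add: c L_def)
  then obtain r0 r where r: "cleared L = r0 # r" "length r = d" by (metis length_Suc_conv)
  have "hrow c = - head 0 (cleared L) # tl (cleared L)"
    unfolding hrow_def c L_def by (simp only: Let_def fst_conv snd_conv)
  then have hrow: "hrow c = - r0 # r" by (simp add: r)
  then show "length (hrow c) = Suc d" using r by simp
  have nth: "real_of_int (cleared L ! i) = Q * of_rat ((b # a) ! i)" if "i < Suc d" for i
  proof -
    have l: "i < length L" using that len by simp
    then have Li: "L ! i = quotient_of ((b # a) ! i)" unfolding L_def by (metis length_map nth_map)
    have "snd (L ! i) \<noteq> 0" unfolding Li using quotient_of_snd_pos by (metis less_irrefl)
    from clear_nth_real[OF l this] show ?thesis unfolding Li of_rat_quotient_of Q_def .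
  qed
  have r0: "real_of_int r0 = Q * of_rat b" using nth[of 0] r by simp
  have rj: "real_of_int (r ! j) = Q * of_rat (a ! j)" if "j < d" for j using nth[of "Suc j"] r that by simp
  have "ip (Suc d) (ivec (hrow c)) (homog t x) = Q * (lin (fst c) x - of_rat (snd c) * t)" for t x
  proof -
    have "ip d (ivec r) x = Q * lin a x"
      using assms r(2) rj by (simp add: ip_def lin_def coord_vec c sum_distrib_left mult.assoc)
    then show ?thesis unfolding hrow by (simp add: vec_Cons ip_hom r0 c algebra_simps)
  qed
  then show "\<exists>Q>0. \<forall>t x. ip (Suc d) (ivec (hrow c)) (homog t x) = Q * (lin (fst c) x - of_rat (snd c) * t)"
    using Q by blast
qed

lemma row_vertex:
  assumes "length (fst c) = d" "length y = Suc d" "0 < head 0 y"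
  shows "dot (Suc d) (hrow c) y \<le> 0 \<longleftrightarrow> lin (fst c) (vertex y) \<le> of_rat (snd c)"
proof -
  obtain Q where Q: "0 < Q" "\<And>t x. ip (Suc d) (ivec (hrow c)) (homog t x)
    = Q * (lin (fst c) x - of_rat (snd c) * t)"
    using row_inequality(2)[OF assms(1)] by blast
  have "real_of_int (dot (Suc d) (hrow c) y) = ip (Suc d) (ivec (hrow c)) (ivec y)"
    by (rule dot_ip[OF row_inequality(1)[OF assms(1)] assms(2)])
  also have "\<dots> = real_of_int (head 0 y) * (Q * (lin (fst c) (vertex y) - of_rat (snd c)))"
    unfolding vec_vertex(1)[OF assms(2,3)] ip_scale Q(2) by simp
  finally have "real_of_int (dot (Suc d) (hrow c) y) \<le> 0 \<longleftrightarrow> lin (fst c) (vertex y) - of_rat (snd c) \<le> 0"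
    using Q(1) assms(3) by (simp add: mult_le_0_iff)
  then show ?thesis by (simp only: of_int_le_0_iff diff_le_0_iff_le)
qed

lemma linear_lin: "linear (lin a)"
  by (rule linearI) (simp_all add: lin_def coord_simps algebra_simps sum.distrib sum_distrib_left)

lemma in_vertices:
  assumes S: "has_columns d S"
  shows "y \<in> set (vertices d S) \<longleftrightarrow> (\<exists>t. length t = d \<and> set t \<subseteq> hrow ` set S
    \<and> y \<in> set (plus_minus (orth_basis (Suc d) d t)))
    \<and> length y = Suc d \<and> 0 < head 0 y \<and> vertex y \<in> solutions d S"
proof -
  have l: "length (fst c) = d" if "c \<in> set S" for c using S that by (auto simp: has_columns_def)
  have len: "length y = Suc d" if t: "length t = d" "set t \<subseteq> hrow ` set S"
    "y \<in> set (plus_minus (orth_basis (Suc d) d t))" for t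
  proof -
    have "\<forall>u\<in>set t. length u = Suc d" using t row_inequality(1)[OF l] by auto
    then have "int_basis (Suc d) (orth_basis (Suc d) d t) (complement (Suc d) (set t))"
      using t(1) int_basis_orth by blast
    then show ?thesis using t(3) by (auto simp: int_basis_def plus_minus_def)
  qed
  have feas: "(\<forall>r\<in>set (map hrow S). dot (Suc d) r y \<le> 0) \<longleftrightarrow> vertex y \<in> solutions d S"
    if "length y = Suc d" "0 < head 0 y"
    using row_vertex[OF l that] vec_vertex(2)[OF that] by (force simp: solutions_def)
  show ?thesis
    unfolding vertices_def using feas len by (auto simp: in_tuples)
qed

lemma small_step:
  assumes "finite A" "\<And>c. c \<in> A \<Longrightarrow> 0 < (s c :: real)"
  shows "\<exists>e>0. \<forall>c\<in>A. e * \<bar>g c\<bar> \<le> s c"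
  using assms
proof (induction A rule: finite_induct)
  case empty
  then show ?case by (auto intro: exI[of _ 1])
next
  case (insert c A)
  then obtain e where e: "e > 0" "\<forall>c\<in>A. e * \<bar>g c\<bar> \<le> s c" by auto
  define e' where "e' = min e (s c / (\<bar>g c\<bar> + 1))"
  have sc: "0 < s c" using insert by simp
  have "e' > 0" using e sc by (simp add: e'_def)
  moreover have "e' * \<bar>g x\<bar> \<le> s x" if "x \<in> A" for x
  proof -
    have "e' * \<bar>g x\<bar> \<le> e * \<bar>g x\<bar>" by (intro mult_right_mono) (auto simp: e'_def)
    then show ?thesis using e that by force
  qed
  moreover have "e' * \<bar>g c\<bar> \<le> s c"
  proof -
    have "e' * \<bar>g c\<bar> \<le> (s c / (\<bar>g c\<bar> + 1)) * \<bar>g c\<bar>" by (intro mult_right_mono) (auto simp: e'_def)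
    also have "\<dots> \<le> s c" using sc by (simp add: field_simps)
    finally show ?thesis .
  qed
  ultimately show ?case by auto
qed

text \<open>
  At an extreme point \<open>q\<close> only the line through \<open>(1, q)\<close> is orthogonal to all tight rows: another
  such vector would give a direction in which one can move from \<open>q\<close> both ways, the other
  inequalities having slack. So the greedy choice finds \<open>d\<close> tight rows that determine \<open>q\<close>.
\<close>

lemma extreme_point_is_vertex:
  assumes S: "has_columns d S" and q: "q \<in> solutions d S"
    and ext: "\<And>u e. u \<in> Rn d \<Longrightarrow> u \<noteq> 0 \<Longrightarrow> 0 < e \<Longrightarrow> q + e *\<^sub>R u \<in> solutions d S \<Longrightarrow> q - e *\<^sub>R u \<in> solutions d S \<Longrightarrow>
      False"
  shows "\<exists>y\<in>set (vertices d S). vertex y = q"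
proof -
  have l: "length (fst c) = d" if "c \<in> set S" for c using S that by (auto simp: has_columns_def)
  have qR: "q \<in> Rn d" and qS: "\<And>c. c \<in> set S \<Longrightarrow> lin (fst c) q \<le> of_rat (snd c)"
    using q by (auto simp: solutions_def)
  define T where "T = {c \<in> set S. lin (fst c) q = of_rat (snd c)}"
  have orth0: "ip (Suc d) (ivec (hrow c)) (homog 0 u) = 0 \<longleftrightarrow> lin (fst c) u = 0"
    and orth1: "ip (Suc d) (ivec (hrow c)) (homog 1 u) = 0 \<longleftrightarrow> lin (fst c) u = of_rat (snd c)"
      if "c \<in> set S" for c u
  proof -
    note cS = that
    obtain Q where "0 < Q" "\<And>t x. ip (Suc d) (ivec (hrow c)) (homog t x)
      = Q * (lin (fst c) x - of_rat (snd c) * t)"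
      using row_inequality(2)[OF l[OF cS]] by blast
    then show "ip (Suc d) (ivec (hrow c)) (homog 0 u) = 0 \<longleftrightarrow> lin (fst c) u = 0"
      "ip (Suc d) (ivec (hrow c)) (homog 1 u) = 0 \<longleftrightarrow> lin (fst c) u = of_rat (snd c)" by auto
  qed
  let ?q = "homog 1 q"
  have qc: "?q \<in> complement (Suc d) (hrow ` T)"
    unfolding complement_def using hom_in_Rn[OF qR] orth1 by (auto simp: T_def)
  have line: "complement (Suc d) (hrow ` T) = span {?q}"
  proof
    have "subspace (complement (Suc d) (hrow ` T))"
      using subspace_Rn unfolding complement_def subspace_def by (auto simp: ip_0 ip_add ip_scale)
    then show "span {?q} \<subseteq> complement (Suc d) (hrow ` T)" using qc by (intro span_minimal) auto
    show "complement (Suc d) (hrow ` T) \<subseteq> span {?q}"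
    proof
      fix z assume z: "z \<in> complement (Suc d) (hrow ` T)"
      then obtain x where x: "x \<in> Rn d" "z = homog (coord z 0) x"
        using Rn_Suc_hom by (auto simp: complement_def)
      define u where "u = x - coord z 0 *\<^sub>R q"
      have u: "u \<in> Rn d" unfolding u_def using x qR by (intro subspace_diff subspace_scale subspace_Rn)
      have zu: "z - coord z 0 *\<^sub>R ?q = homog 0 u" by (subst (1) x(2)) (simp add: hom_scale hom_diff u_def)
      have u0: "lin (fst c) u = 0" if c: "c \<in> T" for c
      proof -
        have "ip (Suc d) (ivec (hrow c)) (homog 0 u) = 0"
          unfolding zu[symmetric] using z qc c by (simp add: complement_def ip_diff ip_scale)
        then show ?thesis using orth0 c by (simp add: T_def)
      qed
      have "u = 0"
      proof (rule ccontr)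
        assume "u \<noteq> 0"
        obtain e where e: "0 < e" "\<forall>c\<in>set S - T. e * \<bar>lin (fst c) u\<bar> \<le> of_rat (snd c) - lin (fst c) q"
          using small_step[of "set S - T" "\<lambda>c. of_rat (snd c) - lin (fst c) q" "\<lambda>c. lin (fst c) u"] qS
          by (force simp: T_def order.strict_iff_order)
        have step: "lin (fst c) q + r * lin (fst c) u \<le> of_rat (snd c)" if c: "c \<in> set S"
          and r: "r = e \<or> r = - e" for c r
        proof (cases "c \<in> T")
          case True
          then show ?thesis using u0 qS c by simp
        next
          case False
          have "r * lin (fst c) u \<le> \<bar>r * lin (fst c) u\<bar>" by simp
          also have "\<dots> = e * \<bar>lin (fst c) u\<bar>" using r e(1) by (auto simp: abs_mult)
          finally show ?thesis using e(2) False c by force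
        qed
        have "q + e *\<^sub>R u \<in> solutions d S"
          unfolding solutions_def using step[of _ e] qR u
          by (auto simp: linear_add[OF linear_lin] linear_scale[OF linear_lin] subspace_add[OF subspace_Rn]
            subspace_scale[OF subspace_Rn])
        moreover have "q - e *\<^sub>R u \<in> solutions d S"
          unfolding solutions_def using step[of _ "- e"] qR u
          by (auto simp: linear_diff[OF linear_lin] linear_scale[OF linear_lin] subspace_diff[OF subspace_Rn]
            subspace_scale[OF subspace_Rn])
        ultimately show False using ext[OF u \<open>u \<noteq> 0\<close> e(1)] by blast
      qed
      then have "z = coord z 0 *\<^sub>R ?q" using zu hom_0 by simp
      then show "z \<in> span {?q}" by (metis insertI1 span_base span_scale)
    qed
  qed
  have "\<forall>r\<in>hrow ` T. length r = Suc d" using row_inequality(1)[OF l] by (auto simp: T_def)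
  moreover have nz: "?q \<noteq> 0" using hom_eq_iff[of 1 q 0 0] hom_0 by simp
  ultimately obtain t a c where t: "set t \<subseteq> hrow ` T" "length t = d" "orth_basis (Suc d) d t = [a]"
    "length a = Suc d" "?q = c *\<^sub>R ivec a"
    using exists_tuple_spanning_line[OF _ _ line] by auto
  obtain a0 a' where a: "a = a0 # a'" using t(4) by (metis length_Suc_conv)
  have "coord ?q 0 = c * real_of_int a0" unfolding t(5) by (simp add: a vec_Cons)
  then have c1: "c * real_of_int a0 = 1" by simp
  then have "a0 \<noteq> 0" by auto
  with c1 have a0: "a0 \<noteq> 0" "c = 1 / real_of_int a0" by (simp_all add: nonzero_eq_divide_eq)
  have va: "ivec a = real_of_int a0 *\<^sub>R ?q" unfolding t(5) using a0 by simp
  define y where "y = (if 0 < a0 then a else map uminus a)"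
  have y: "length y = Suc d" "0 < head 0 y" using t(4) a0 by (auto simp: y_def a)
  have "ivec y = real_of_int (head 0 y) *\<^sub>R ?q"
    using va by (simp add: y_def a vec_uminus[of "a0 # a'", simplified])
  then have "real_of_int (head 0 y) *\<^sub>R homog 1 (vertex y) = real_of_int (head 0 y) *\<^sub>R ?q"
    using vec_vertex(1)[OF y] by simp
  then have vy: "vertex y = q" using y(2) hom_eq_iff by simp
  have "y \<in> set (plus_minus (orth_basis (Suc d) d t))" unfolding t(3) by (simp add: y_def plus_minus_def)
  moreover have "set t \<subseteq> hrow ` set S" using t(1) by (auto simp: T_def)
  ultimately have "y \<in> set (vertices d S)" unfolding in_vertices[OF S] using t(2) y vy q by blast
  then show ?thesis using vy by blast
qed

text \<open>
  An element in the hull of the others could be dropped, so a generating set of least size has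
  none.
\<close>

lemma polytope_minimal_generators:
  fixes P :: "'a::real_vector set"
  assumes "polytope P"
  obtains Q where "finite Q" "P = convex hull Q" "\<And>q. q \<in> Q \<Longrightarrow> q \<notin> convex hull (Q - {q})"
proof -
  obtain Q0 where Q0: "finite Q0 \<and> P = convex hull Q0" using assms by (auto simp: polytope_def)
  obtain Q where Q: "finite Q" "P = convex hull Q" "\<And>R. finite R \<and> P = convex hull R \<Longrightarrow> card Q \<le> card R"
    using ex_has_least_nat[of "\<lambda>Q. finite Q \<and> P = convex hull Q" Q0 card, OF Q0] by blast
  have "q \<notin> convex hull (Q - {q})" if q: "q \<in> Q" for q
  proof
    assume "q \<in> convex hull (Q - {q})"
    then have "convex hull (insert q (Q - {q})) = convex hull (Q - {q})" by (rule hull_redundant)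
    then have "P = convex hull (Q - {q})" using Q(2) q by (simp add: insert_absorb)
    then have "card Q \<le> card (Q - {q})" using Q(1,3) by simp
    then show False using Q(1) q by (metis card_Diff1_less not_less)
  qed
  then show thesis using that Q by blast
qed

theorem polytope_hull_of_vertices:
  assumes S: "has_columns d S" and P: "polytope (solutions d S)"
  shows "solutions d S = convex hull (vertex ` set (vertices d S))"
proof
  let ?P = "solutions d S"
  obtain Q where Q: "finite Q" "?P = convex hull Q" "\<And>q. q \<in> Q \<Longrightarrow> q \<notin> convex hull (Q - {q})"
    using polytope_minimal_generators[OF P] by blast
  have "\<exists>y\<in>set (vertices d S). vertex y = q" if q: "q \<in> Q" for q
  proof (rule extreme_point_is_vertex[OF S])
    show "q \<in> ?P" unfolding Q(2) using q by (rule hull_inc)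
    have "q extreme_point_of (convex hull (insert q (Q - {q})))"
      using Q q by (intro extreme_point_of_convex_hull_insert) auto
    then have ext: "q extreme_point_of ?P" using q Q(2) by (simp add: insert_absorb)
    fix u e assume u: "u \<in> Rn d" "u \<noteq> 0" "0 < (e::real)" and "q + e *\<^sub>R u \<in> ?P" "q - e *\<^sub>R u \<in> ?P"
    moreover have "q \<in> open_segment (q - e *\<^sub>R u) (q + e *\<^sub>R u)"
    proof -
      have "(1 - 1/2) *\<^sub>R (q - e *\<^sub>R u) + (1/2::real) *\<^sub>R (q + e *\<^sub>R u)
          = (1/2) *\<^sub>R ((q - e *\<^sub>R u) + (q + e *\<^sub>R u))"
        by (simp only: scaleR_add_right) simp
      also have "\<dots> = (1/2) *\<^sub>R (q + q)" by (rule arg_cong[where f = "scaleR (1/2)"]) simp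
      also have "\<dots> = q" by (rule scaleR_half_double)
      finally have "q = (1 - 1/2) *\<^sub>R (q - e *\<^sub>R u) + (1/2::real) *\<^sub>R (q + e *\<^sub>R u)" by simp
      moreover have "q - e *\<^sub>R u \<noteq> q + e *\<^sub>R u"
      proof
        assume "q - e *\<^sub>R u = q + e *\<^sub>R u"
        then have "(2 * e) *\<^sub>R u = 0" by (simp add: scaleR_2 flip: scaleR_scaleR)
        then show False using u by simp
      qed
      ultimately show ?thesis unfolding in_segment by (intro conjI exI[of _ "1/2"]) auto
    qed
    ultimately show False using ext unfolding extreme_point_of_def by blast
  qed
  then have "Q \<subseteq> vertex ` set (vertices d S)" by blast
  then show "?P \<subseteq> convex hull (vertex ` set (vertices d S))" unfolding Q(2) by (rule hull_mono)
  have "convex ?P" unfolding Q(2) by simp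
  moreover have "vertex ` set (vertices d S) \<subseteq> ?P" using in_vertices[OF S] by blast
  ultimately show "convex hull (vertex ` set (vertices d S)) \<subseteq> ?P" by (simp add: hull_minimal)
qed

lemma affine_hull_full_dim:
  assumes "V \<subseteq> Rn d" "affdim V = int d"
  shows "affine hull V = Rn d"
proof -
  have "affdim ({}::point set) = -1" using affdim_eq[of "{}" "{}::point set"] by simp
  then have "V \<noteq> {}" using assms(2) by auto
  moreover have "V \<subseteq> span (std_basis d)" using assms(1) span_std_basis by simp
  ultimately obtain a B C where a: "a \<in> V"
    and C: "finite C" "independent C" "affine hull V = (\<lambda>x. a + x) ` span C"
      "affdim V = int (card C)" "C \<subseteq> span (std_basis d)"
    using affine_basis_of_finite_dim[OF finite_std_basis] by metis
  have "span C = Rn d"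
    using independent_card_spans[OF finite_std_basis C(2,5)] C(4) assms(2) card_std_basis span_std_basis by simp
  moreover have "(\<lambda>x. a + x) ` Rn d = Rn d"
  proof (intro set_eqI iffI)
    have aR: "a \<in> Rn d" using a assms(1) by blast
    show "x \<in> Rn d" if "x \<in> (\<lambda>x. a + x) ` Rn d" for x using that aR subspace_add[OF subspace_Rn] by blast
    show "x \<in> (\<lambda>x. a + x) ` Rn d" if "x \<in> Rn d" for x
      by (rule image_eqI[of _ _ "x - a"]) (use that aR subspace_diff[OF subspace_Rn] in auto)
  qed
  ultimately show ?thesis using C(3) by simp
qed

section \<open>Facets of Cayley polytopes, block by block\<close>

lemma ip_self_eq_0: "x \<in> Rn k \<Longrightarrow> ip k x x = 0 \<Longrightarrow> x = 0"
proof (rule point_eqI)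
  fix j assume x: "x \<in> Rn k" and z: "ip k x x = 0"
  have "coord x j * coord x j = 0" if "j < k"
    using sum_nonneg_eq_0_iff[of "{..<k}" "\<lambda>j. coord x j * coord x j"] z that by (simp add: ip_def)
  then show "coord x j = coord 0 j" using x by (cases "j < k") (auto simp: Rn_def)
qed

lemma ip_eq_imp_eq:
  assumes "x \<in> Rn k" "y \<in> Rn k" "\<And>z. z \<in> Rn k \<Longrightarrow> ip k x z = ip k y z"
  shows "x = y"
proof -
  have "x - y \<in> Rn k" using assms subspace_diff[OF subspace_Rn] by blast
  moreover have "ip k (x - y) (x - y) = ip k x (x - y) - ip k y (x - y)"
    using linear_diff[OF linear_ip_left] by blast
  ultimately show ?thesis using ip_self_eq_0[of "x - y" k] assms(3)[of "x - y"] by simp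
qed

lemmas ip_scale_left = linear_scale[OF linear_ip_left, unfolded real_scaleR_def]
  and ip_0_left = linear_0[OF linear_ip_left]

lemma linear_eq_0_on_Rn_add:
  fixes h :: "point \<Rightarrow> real"
  assumes h: "linear h" "\<And>x. x \<in> Rn d \<Longrightarrow> h x = 0" "\<And>i. 1 \<le> i \<Longrightarrow> i \<le> n \<Longrightarrow> h (Poly_Mapping.single (d + i - 1) 1) = 0"
    and y: "y \<in> Rn (d + n)"
  shows "h y = 0"
proof (rule linear_eq_0_on_span[OF h(1)])
  show "y \<in> span (std_basis (d + n))" using y span_std_basis by simp
  fix b assume "b \<in> std_basis (d + n)"
  then obtain j where j: "j < d + n" "b = Poly_Mapping.single j 1" by (auto simp: std_basis_def)
  show "h b = 0"
  proof (cases "j < d")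
    case True
    then have "b \<in> Rn d" using j by (auto simp: Rn_def coord_simps)
    then show ?thesis by (rule h(2))
  next
    case False
    then show ?thesis using h(3)[of "j - d + 1"] j by simp
  qed
qed

lemma lift_add: "lift d x i = x + lift d 0 i"
  by (simp add: lift_def)

lemma lift_0 [simp]: "lift d x 0 = x"
  by (simp add: lift_def)

lemma lift_unit: "1 \<le> i \<Longrightarrow> lift d 0 i = Poly_Mapping.single (d + i - 1) 1"
  by (simp add: lift_def)

lemma lift_in_Rn: "x \<in> Rn d \<Longrightarrow> i \<le> n \<Longrightarrow> lift d x i \<in> Rn (d + n)"
  by (auto simp: Rn_def lift_def coord_simps)

text \<open>
  The lifted copies of \<open>\<real>\<^sup>d\<close> span \<open>\<real>\<^bsup>d + n\<^esup>\<close> affinely, so affine functionals may be compared on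
  them. The constants cancel because \<open>0\<close> is one of the lifted points.
\<close>

lemma proportional_on_lifts:
  fixes f g :: "point \<Rightarrow> real"
  assumes f: "linear f" and g: "linear g"
    and eq: "\<And>x i. x \<in> Rn d \<Longrightarrow> i \<le> n \<Longrightarrow> g (lift d x i) - c = k * (f (lift d x i) - b)"
    and y: "y \<in> Rn (d + n)"
  shows "g y - c = k * (f y - b)"
proof -
  define h where "h x = g x + (- k) * f x" for x
  have h: "linear h" unfolding h_def by (rule linear_combo[OF g f])
  have e: "h (lift d x i) = c - k * b" if "x \<in> Rn d" "i \<le> n" for x i
    using eq[OF that] by (simp add: h_def algebra_simps)
  have z: "0 \<in> Rn d" using subspace_0[OF subspace_Rn] .
  have e0: "c - k * b = 0" using e[OF z, of 0] linear_0[OF h] by simp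
  have "h y = 0"
  proof (rule linear_eq_0_on_Rn_add[OF h _ _ y])
    show "h x = 0" if "x \<in> Rn d" for x using e[OF that, of 0] e0 by simp
    show "h (Poly_Mapping.single (d + i - 1) 1) = 0" if "1 \<le> i" "i \<le> n" for i
      using e[OF z that(2)] e0 lift_unit[OF that(1), of d] by simp
  qed
  then show ?thesis using e0 by (simp add: h_def algebra_simps)
qed

lemma lin_single: "lin u (Poly_Mapping.single j 1) = (if j < length u then of_rat (u ! j) else 0)"
  by (simp add: lin_def coord_simps sum.delta' if_distrib cong: if_cong)

lemma lin_cayley_ineq:
  assumes "length a = d" "length hs = Suc n" "x \<in> Rn d" "i \<le> n"
  shows "lin (fst (cayley_ineq a hs)) (lift d x i) - of_rat (snd (cayley_ineq a hs))
    = ip d (ivec a) x - real_of_int (hs ! i)"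
proof -
  obtain h0 ht where hs: "hs = h0 # ht" "length ht = n" using assms(2) by (metis length_Suc_conv)
  define u where "u = fst (cayley_ineq a hs)"
  have u: "u = map of_int (a @ map (\<lambda>h. h0 - h) ht)" by (simp add: u_def cayley_ineq_def hs)
  have lu: "length u = d + n" using assms hs by (simp add: u)
  have "lin u x = (\<Sum>j<d. of_rat (u ! j) * coord x j)"
    unfolding lin_def lu using assms(3) by (intro sum.mono_neutral_right) (auto simp: Rn_def)
  also have "\<dots> = ip d (ivec a) x"
    unfolding ip_def using assms(1) by (intro sum.cong) (auto simp: u coord_vec nth_append)
  finally have x: "lin u x = ip d (ivec a) x" .
  have "lin u (lift d 0 i) = real_of_int h0 - real_of_int (hs ! i)"
  proof (cases i)
    case 0
    then show ?thesis using linear_0[OF linear_lin] hs by simp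
  next
    case (Suc j)
    then have "u ! (d + j) = of_int (h0 - ht ! j)" using assms hs by (simp add: u nth_append)
    then show ?thesis using Suc assms hs lu lift_unit[of i d] by (simp add: lin_single of_rat_diff)
  qed
  moreover have "lin u (lift d x i) = lin u x + lin u (lift d 0 i)"
    by (subst lift_add) (rule linear_add[OF linear_lin])
  moreover have "of_rat (snd (cayley_ineq a hs)) = real_of_int h0" by (simp add: cayley_ineq_def hs)
  ultimately show ?thesis using x unfolding u_def[symmetric] by simp
qed

lemma length_cayley_ineq: "length a = d \<Longrightarrow> length hs = Suc n \<Longrightarrow> length (fst (cayley_ineq a hs)) = d + n"
  by (simp add: cayley_ineq_def)

lemma finite_argmax:
  fixes f :: "'a \<Rightarrow> real"
  assumes "finite A" "A \<noteq> {}"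
  shows "\<exists>x\<in>A. \<forall>y\<in>A. f y \<le> f x"
proof -
  have "Max (f ` A) \<in> f ` A" using assms by simp
  then obtain x where "x \<in> A" "Max (f ` A) = f x" by blast
  then show ?thesis using assms by (metis Max_ge finite_imageI imageI)
qed

text \<open>
  \<open>VV\<close> holds the vertex lists of the polytopes \<open>\<P>\<^sub>0, \<dots>, \<P>\<^sub>n\<close>, in homogeneous coordinates.
\<close>

locale vertex_lists =
  fixes d n :: nat and VV :: "int list list list"
  assumes d: "1 \<le> d" and n: "1 \<le> n" and length_VV: "length VV = Suc n"
    and vertex_shape: "\<And>V y. V \<in> set VV \<Longrightarrow> y \<in> set V \<Longrightarrow> length y = Suc d \<and> 0 < head 0 y"
    and full_dim: "\<And>V. V \<in> set VV \<Longrightarrow> affine hull (vertex ` set V) = Rn d"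
begin

definition pts :: "nat \<Rightarrow> point set"
  where "pts i = vertex ` set (VV ! i)"

definition W :: "point set"
  where "W = (\<Union>i\<in>{0..n}. (\<lambda>v. lift d v i) ` pts i)"

abbreviation X :: "point set"
  where "X \<equiv> Rn (d + n)"

lemma VV_nth: "i \<le> n \<Longrightarrow> VV ! i \<in> set VV"
  using length_VV by simp

lemma VV_index: "V \<in> set VV \<Longrightarrow> \<exists>i\<le>n. V = VV ! i"
  using length_VV by (metis in_set_conv_nth less_Suc_eq_le)

lemma pts: "i \<le> n \<Longrightarrow> finite (pts i)" "i \<le> n \<Longrightarrow> affine hull pts i = Rn d" "i \<le> n \<Longrightarrow> pts i \<noteq> {}"
  "i \<le> n \<Longrightarrow> v \<in> pts i \<Longrightarrow> v \<in> Rn d"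
proof -
  assume i: "i \<le> n"
  show "finite (pts i)" by (simp add: pts_def)
  show a: "affine hull pts i = Rn d" unfolding pts_def by (rule full_dim[OF VV_nth[OF i]])
  show "pts i \<noteq> {}"
  proof
    assume "pts i = {}"
    then have "Rn d = {}" using a by simp
    then show False using subspace_0[OF subspace_Rn, of d] by simp
  qed
  show "v \<in> Rn d" if "v \<in> pts i" using hull_inc[OF that, of affine] a by simp
qed

lemma finite_W: "finite W"
  unfolding W_def by (intro finite_UN_I finite_imageI pts(1)) auto

lemma W_subset: "W \<subseteq> X"
  unfolding W_def using pts(4) lift_in_Rn by auto

lemma in_W: "w \<in> W \<longleftrightarrow> (\<exists>i v. i \<le> n \<and> v \<in> pts i \<and> w = lift d v i)"
  unfolding W_def by auto

lemma ball_W: "(\<forall>w\<in>W. Q w) \<longleftrightarrow> (\<forall>i\<le>n. \<forall>v\<in>pts i. Q (lift d v i))"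
  by (simp add: W_def atLeast0AtMost Bex_def Ball_def) blast

lemma bex_W: "(\<exists>w\<in>W. Q w) \<longleftrightarrow> (\<exists>i\<le>n. \<exists>v\<in>pts i. Q (lift d v i))"
  by (simp add: W_def atLeast0AtMost Bex_def Ball_def) blast

lemma linear_const_W:
  fixes f :: "point \<Rightarrow> real"
  assumes f: "linear f" "\<And>w. w \<in> W \<Longrightarrow> f w = c" and y: "y \<in> X"
  shows "f y = c"
proof -
  have "f (lift d x i) = c" if x: "x \<in> Rn d" and i: "i \<le> n" for x i
  proof -
    have "f x = c - f (lift d 0 i)"
    proof (rule linear_const_affine_hull[OF f(1)])
      show "x \<in> affine hull pts i" using pts(2)[OF i] x by simp
      fix v assume "v \<in> pts i"
      then have "f (lift d v i) = c" using f(2) i in_W by blast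
      then show "f v = c - f (lift d 0 i)"
        using linear_add[OF f(1), of v "lift d 0 i"] lift_add[of d v i] by simp
    qed
    then show ?thesis using linear_add[OF f(1), of x "lift d 0 i"] lift_add[of d x i] by simp
  qed
  then have "f y - c = 0 * (f y - 0)"
    by (intro proportional_on_lifts[OF f(1) f(1) _ y]) simp
  then show ?thesis by simp
qed

lemma affine_hull_W: "affine hull W = X"
proof
  show "affine hull W \<subseteq> X" by (intro hull_minimal W_subset subspace_imp_affine subspace_Rn)
  show "X \<subseteq> affine hull W"
  proof
    fix z assume z: "z \<in> X"
    obtain v where "v \<in> pts 0" using pts(3)[of 0] by auto
    then have w: "lift d v 0 \<in> W" using in_W by blast
    define w where "w = lift d v 0"
    show "z \<in> affine hull W"
    proof (rule ccontr)
      assume "z \<notin> affine hull W"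
      then have "z - w \<notin> span ((\<lambda>x. - w + x) ` (W - {w}))"
        using affine_hull_span2[of w W] w by (force simp: w_def image_iff)
      then obtain g :: "point \<Rightarrow> real" where g: "linear g" "\<forall>x\<in>span ((\<lambda>x. - w + x) ` (W - {w})). g x = 0"
        "g (z - w) = 1"
        using linear_functional_exists by blast
      have "g x = g w" if "x \<in> W" for x
      proof (cases "x = w")
        case False
        then have "- w + x \<in> span ((\<lambda>x. - w + x) ` (W - {w}))" using that by (intro span_base) auto
        then have "g (x - w) = 0" using g(2) by simp
        then show ?thesis by (simp add: linear_diff[OF g(1)])
      qed simp
      then have "g z = g w" using linear_const_W[OF g(1) _ z] by blast
      then show False using g(3) by (simp add: linear_diff[OF g(1)])
    qed
  qed
qed

text \<open>
  On the lifted copies of \<open>\<real>\<^sup>d\<close>, the affine functional \<open>f - b\<close> is given by a common normal \<open>a\<close> and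
  one height for each copy. This is the form \<open>a \<bullet> x - \<Sum>\<^sub>i h\<^sub>i \<lambda>\<^sub>i\<close>.
\<close>

definition blocks :: "(point \<Rightarrow> real) \<Rightarrow> real \<Rightarrow> point \<Rightarrow> (nat \<Rightarrow> real) \<Rightarrow> bool" where
  "blocks f b a h \<longleftrightarrow> (\<forall>x\<in>Rn d. \<forall>i\<le>n. f (lift d x i) - b = ip d a x - h i)"

lemma blocks_exist:
  fixes f :: "point \<Rightarrow> real"
  assumes "linear f"
  obtains a h where "a \<in> Rn d" "blocks f b a h"
proof -
  obtain a where a: "a \<in> Rn d" "\<And>x. x \<in> Rn d \<Longrightarrow> f x = ip d a x" using linear_eq_ip[OF assms, of d] by blast
  have "blocks f b a (\<lambda>i. b - f (lift d 0 i))"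
    unfolding blocks_def
  proof (intro ballI allI impI)
    fix x i assume "x \<in> Rn d" "i \<le> n"
    moreover have "f (lift d x i) = f x + f (lift d 0 i)" by (subst lift_add) (rule linear_add[OF assms])
    ultimately show "f (lift d x i) - b = ip d a x - (b - f (lift d 0 i))" using a(2) by simp
  qed
  then show thesis using that a(1) by blast
qed

lemma functional_with_blocks: "\<exists>f b. linear f \<and> blocks f b a h"
proof -
  define f where "f y = ip d a y + (\<Sum>i\<in>{1..n}. (h 0 - h i) * coord y (d + i - 1))" for y
  have "linear f" unfolding f_def
    by (rule linearI) (simp_all add: ip_add ip_scale coord_simps distrib_left sum.distrib sum_distrib_left
      mult.left_commute)
  moreover have "blocks f (h 0) a h"
    unfolding blocks_def
  proof (intro ballI allI impI)
    fix x i assume x: "x \<in> Rn d" and i: "i \<le> n"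
    have c: "coord (lift d x i) (d + j - 1) = (if j = i then 1 else 0)" if "j \<in> {1..n}" for j
      using x that by (auto simp: lift_def coord_simps Rn_def)
    have "ip d a (lift d x i) = ip d a x"
      unfolding ip_def by (intro sum.cong) (auto simp: lift_def coord_simps)
    moreover have "(\<Sum>j\<in>{1..n}. (h 0 - h j) * coord (lift d x i) (d + j - 1)) = h 0 - h i"
    proof -
      have "(\<Sum>j\<in>{1..n}. (h 0 - h j) * coord (lift d x i) (d + j - 1)) = (\<Sum>j\<in>{1..n}. if j
        = i then h 0 - h j else 0)"
        using c by (intro sum.cong) auto
      then show ?thesis using i by (cases "i = 0") auto
    qed
    ultimately show "f (lift d x i) - h 0 = ip d a x - h i" by (simp add: f_def)
  qed
  ultimately show ?thesis by blast
qed

text \<open>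
  The conditions of \<open>facet_functional\<close>, expressed by normals and heights.
\<close>

definition block_facet :: "point \<Rightarrow> (nat \<Rightarrow> real) \<Rightarrow> bool" where
  "block_facet a h \<longleftrightarrow> (\<forall>i\<le>n. \<forall>v\<in>pts i. ip d a v \<le> h i) \<and> (\<exists>i\<le>n. \<exists>v\<in>pts i. ip d a v < h i) \<and>
    (\<forall>z\<in>Rn d. \<forall>h'. (\<forall>i\<le>n. \<forall>v\<in>pts i. ip d a v = h i \<longrightarrow> ip d z v = h' i) \<longrightarrow>
      (\<exists>k. \<forall>x\<in>Rn d. \<forall>i\<le>n. ip d z x - h' i = k * (ip d a x - h i)))"

lemma facet_functional_iff_block_facet:
  assumes f: "linear f" and fb: "blocks f b a h"
  shows "facet_functional X W f b \<longleftrightarrow> block_facet a h"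
proof -
  have v: "f (lift d x i) - b = ip d a x - h i" if "x \<in> Rn d" "i \<le> n" for x i
    using fb that by (simp add: blocks_def)
  have le: "f (lift d x i) \<le> b \<longleftrightarrow> ip d a x \<le> h i" and less: "f (lift d x i) < b \<longleftrightarrow> ip d a x < h i"
    and eq: "f (lift d x i) = b \<longleftrightarrow> ip d a x = h i" if "x \<in> pts i" "i \<le> n" for x i
    using v[OF pts(4)[OF that(2,1)] that(2)] by auto
  have "(\<forall>w\<in>W. f w \<le> b) \<longleftrightarrow> (\<forall>i\<le>n. \<forall>v\<in>pts i. ip d a v \<le> h i)" unfolding ball_W using le by auto
  moreover have "(\<exists>w\<in>W. f w < b) \<longleftrightarrow> (\<exists>i\<le>n. \<exists>v\<in>pts i. ip d a v < h i)"
    unfolding bex_W using less by auto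
  moreover have "(\<forall>g c. linear g \<longrightarrow> (\<forall>w\<in>W. f w = b \<longrightarrow> g w = c) \<longrightarrow> (\<exists>k. \<forall>x\<in>X. g x - c = k * (f x - b))) \<longleftrightarrow>
    (\<forall>z\<in>Rn d. \<forall>h'. (\<forall>i\<le>n. \<forall>v\<in>pts i. ip d a v = h i \<longrightarrow> ip d z v = h' i) \<longrightarrow>
      (\<exists>k. \<forall>x\<in>Rn d. \<forall>i\<le>n. ip d z x - h' i = k * (ip d a x - h i)))" (is "?L \<longleftrightarrow> ?R")
  proof -
    have key: "((\<forall>w\<in>W. f w = b \<longrightarrow> g w = c) \<longleftrightarrow> (\<forall>i\<le>n. \<forall>v\<in>pts i. ip d a v = h i \<longrightarrow> ip d z v = h' i)) \<and>
       ((\<exists>k. \<forall>x\<in>X. g x - c = k * (f x - b)) \<longleftrightarrow> (\<exists>k. \<forall>x\<in>Rn d. \<forall>i\<le>n. ip d z x - h' i = k * (ip d a x - h i)))"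
      if g: "linear g" and gb: "blocks g c z h'" for g c z h'
    proof -
      have gv: "g (lift d x i) - c = ip d z x - h' i" if "x \<in> Rn d" "i \<le> n" for x i
        using gb that by (simp add: blocks_def)
      have geq: "g (lift d x i) = c \<longleftrightarrow> ip d z x = h' i" if "x \<in> pts i" "i \<le> n" for x i
        using gv[OF pts(4)[OF that(2,1)] that(2)] by auto
      have 1: "(\<forall>w\<in>W. f w = b \<longrightarrow> g w = c) \<longleftrightarrow> (\<forall>i\<le>n. \<forall>v\<in>pts i. ip d a v = h i \<longrightarrow> ip d z v = h' i)"
        unfolding ball_W using eq geq by auto
      have 2: "(\<forall>x\<in>X. g x - c = k * (f x - b)) \<longleftrightarrow> (\<forall>x\<in>Rn d. \<forall>i\<le>n. ip d z x - h' i = k * (ip d a x - h i))" for k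
      proof
        assume l: "\<forall>x\<in>X. g x - c = k * (f x - b)"
        show "\<forall>x\<in>Rn d. \<forall>i\<le>n. ip d z x - h' i = k * (ip d a x - h i)"
        proof (intro ballI allI impI)
          fix x i assume xi: "x \<in> Rn d" "i \<le> n"
          then have "g (lift d x i) - c = k * (f (lift d x i) - b)" using l lift_in_Rn by blast
          then show "ip d z x - h' i = k * (ip d a x - h i)" unfolding gv[OF xi] v[OF xi] .
        qed
      next
        assume r: "\<forall>x\<in>Rn d. \<forall>i\<le>n. ip d z x - h' i = k * (ip d a x - h i)"
        show "\<forall>x\<in>X. g x - c = k * (f x - b)"
        proof
          fix y assume y: "y \<in> X"
          show "g y - c = k * (f y - b)"
          proof (rule proportional_on_lifts[OF f g _ y])
            fix x i assume xi: "x \<in> Rn d" "i \<le> n"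
            show "g (lift d x i) - c = k * (f (lift d x i) - b)"
              unfolding gv[OF xi] v[OF xi] using r xi by blast
          qed
        qed
      qed
      show ?thesis using 1 2 by simp
    qed
    show ?thesis
    proof
      assume L: ?L
      show ?R
      proof (intro ballI allI impI)
        fix z h' assume p: "\<forall>i\<le>n. \<forall>v\<in>pts i. ip d a v = h i \<longrightarrow> ip d z v = h' i"
        obtain g c where g: "linear g" "blocks g c z h'" using functional_with_blocks by blast
        have "\<exists>k. \<forall>x\<in>X. g x - c = k * (f x - b)"
          using L g(1) iffD2[OF conjunct1[OF key[OF g]] p] by blast
        then show "\<exists>k. \<forall>x\<in>Rn d. \<forall>i\<le>n. ip d z x - h' i = k * (ip d a x - h i)"
          by (rule iffD1[OF conjunct2[OF key[OF g]]])
      qed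
    next
      assume R: ?R
      show ?L
      proof (intro allI impI)
        fix g :: "point \<Rightarrow> real" and c assume g: "linear g" and p: "\<forall>w\<in>W. f w = b \<longrightarrow> g w = c"
        obtain z h' where z: "z \<in> Rn d" "blocks g c z h'" using blocks_exist[OF g] by blast
        have "\<exists>k. \<forall>x\<in>Rn d. \<forall>i\<le>n. ip d z x - h' i = k * (ip d a x - h i)"
          using R z(1) iffD1[OF conjunct1[OF key[OF g z(2)]] p] by blast
        then show "\<exists>k. \<forall>x\<in>X. g x - c = k * (f x - b)"
          by (rule iffD2[OF conjunct2[OF key[OF g z(2)]]])
      qed
    qed
  qed
  ultimately show ?thesis unfolding facet_functional_def block_facet_def using f by simp
qed

lemma block_facetD:
  assumes "block_facet a h"
  shows "\<And>i v. i \<le> n \<Longrightarrow> v \<in> pts i \<Longrightarrow> ip d a v \<le> h i"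
    and "\<exists>i\<le>n. \<exists>v\<in>pts i. ip d a v < h i"
    and "\<And>z h'. z \<in> Rn d \<Longrightarrow> (\<And>i v. i \<le> n \<Longrightarrow> v \<in> pts i \<Longrightarrow> ip d a v = h i \<Longrightarrow> ip d z v = h' i) \<Longrightarrow>
      \<exists>k. \<forall>x\<in>Rn d. \<forall>i\<le>n. ip d z x - h' i = k * (ip d a x - h i)"
  using assms unfolding block_facet_def by blast+

lemma block_facetI:
  assumes "\<And>i v. i \<le> n \<Longrightarrow> v \<in> pts i \<Longrightarrow> ip d a v \<le> h i"
    and "\<exists>i\<le>n. \<exists>v\<in>pts i. ip d a v < h i"
    and "\<And>z h'. z \<in> Rn d \<Longrightarrow> (\<And>i v. i \<le> n \<Longrightarrow> v \<in> pts i \<Longrightarrow> ip d a v = h i \<Longrightarrow> ip d z v = h' i) \<Longrightarrow>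
      \<exists>k. \<forall>x\<in>Rn d. \<forall>i\<le>n. ip d z x - h' i = k * (ip d a x - h i)"
  shows "block_facet a h"
  unfolding block_facet_def using assms by blast

text \<open>
  All blocks but the \<open>k\<close>-th are tight, and there is such a block as \<open>n \<ge> 1\<close>. Since each block is
  full-dimensional, a functional that vanishes on the tight ones has normal \<open>0\<close> and heights \<open>0\<close>
  there, and only its \<open>k\<close>-th height is free.
\<close>

lemma block_facet_simplex:
  assumes k: "k \<le> n"
  shows "block_facet 0 (\<lambda>i. of_bool (i = k))"
proof (rule block_facetI)
  show "ip d 0 v \<le> of_bool (i = k)" for i v by (simp add: ip_0_left)
  show "\<exists>i\<le>n. \<exists>v\<in>pts i. ip d 0 v < of_bool (i = k)" using k pts(3)[OF k] by (auto simp: ip_0_left)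
  fix z h' assume z: "z \<in> Rn d" and t: "\<And>i v. i \<le> n \<Longrightarrow> v \<in> pts i \<Longrightarrow> ip d 0 v = of_bool (i = k) \<Longrightarrow> ip d z v = h' i"
  have c: "ip d z x = h' i" if i: "i \<le> n" "i \<noteq> k" and x: "x \<in> Rn d" for i x
    by (rule linear_const_affine_hull[OF linear_ip,
      of "pts i"]) (use t i x pts(2)[OF i(1)] in \<open>auto simp: ip_0_left\<close>)
  obtain j where j: "j \<le> n" "j \<noteq> k" using n by (metis One_nat_def le0 not_one_le_zero)
  have z0: "0 \<in> Rn d" using subspace_0[OF subspace_Rn] .
  have h0: "h' i = 0" if "i \<le> n" "i \<noteq> k" for i using c[OF that z0] by (simp add: ip_0)
  have zx: "ip d z x = 0" if "x \<in> Rn d" for x using c[OF j that] h0[OF j] by simp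
  have "ip d z x - h' i = h' k * (ip d 0 x - of_bool (i = k))" if "x \<in> Rn d" "i \<le> n" for x i
    using zx[OF that(1)] h0[OF that(2)] by (cases "i = k") (auto simp: ip_0_left)
  then show "\<exists>c. \<forall>x\<in>Rn d. \<forall>i\<le>n. ip d z x - h' i = c * (ip d 0 x - of_bool (i = k))" by blast
qed

lemma block_facet_scale:
  assumes "block_facet a h" "0 < r"
  shows "block_facet (r *\<^sub>R a) (\<lambda>i. r * h i)"
proof (rule block_facetI)
  have s: "ip d (r *\<^sub>R a) x - r * h i = r * (ip d a x - h i)" for x i
    by (simp add: ip_scale_left algebra_simps)
  show "ip d (r *\<^sub>R a) v \<le> r * h i" if "i \<le> n" "v \<in> pts i" for i v
    using block_facetD(1)[OF assms(1) that] assms(2) by (simp add: ip_scale_left)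
  show "\<exists>i\<le>n. \<exists>v\<in>pts i. ip d (r *\<^sub>R a) v < r * h i"
    using block_facetD(2)[OF assms(1)] assms(2) by (simp add: ip_scale_left)
  fix z h' assume z: "z \<in> Rn d" and t: "\<And>i v. i \<le> n \<Longrightarrow> v \<in> pts i \<Longrightarrow> ip d (r *\<^sub>R a) v = r * h i \<Longrightarrow> ip d z v = h' i"
  have "\<exists>k. \<forall>x\<in>Rn d. \<forall>i\<le>n. ip d z x - h' i = k * (ip d a x - h i)"
    by (rule block_facetD(3)[OF assms(1) z]) (use t in \<open>simp add: ip_scale_left\<close>)
  then obtain k where "\<forall>x\<in>Rn d. \<forall>i\<le>n. ip d z x - h' i = k * (ip d a x - h i)" by blast
  then have "\<forall>x\<in>Rn d. \<forall>i\<le>n. ip d z x - h' i = (k / r) * (ip d (r *\<^sub>R a) x - r * h i)"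
    unfolding s using assms(2) by simp
  then show "\<exists>k. \<forall>x\<in>Rn d. \<forall>i\<le>n. ip d z x - h' i = k * (ip d (r *\<^sub>R a) x - r * h i)" by blast
qed

end

section \<open>Correctness of the output\<close>

lemma lists_of_image: "set t \<subseteq> f ` E \<Longrightarrow> \<exists>s. set s \<subseteq> E \<and> map f s = t"
proof (induction t)
  case (Cons x t)
  then obtain s e where "set s \<subseteq> E" "map f s = t" "e \<in> E" "f e = x" by auto
  then show ?case by (intro exI[of _ "e # s"]) auto
qed simp

context vertex_lists
begin

lemma ip_vertex:
  assumes "V \<in> set VV" "y \<in> set V" "length a = d"
  shows "ip d (ivec a) (vertex y) = real_of_int (dot d a (tl y)) / real_of_int (head 0 y)"
proof -
  have "length (tl y) = d" using vertex_shape[OF assms(1,2)] by simp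
  then show ?thesis unfolding vertex_def ip_scale using dot_ip[OF assms(3)] by simp
qed

lemma maximal_iff:
  assumes V: "V \<in> set VV" and y: "y \<in> set V" and a: "length a = d"
  shows "maximal d a V y \<longleftrightarrow> (\<forall>v\<in>vertex ` set V. ip d (ivec a) v \<le> ip d (ivec a) (vertex y))"
proof -
  have "dot d a (tl v) * head 0 y \<le> dot d a (tl y) * head 0 v
    \<longleftrightarrow> ip d (ivec a) (vertex v) \<le> ip d (ivec a) (vertex y)"
    if v: "v \<in> set V" for v
  proof -
    have p: "0 < real_of_int (head 0 y)" "0 < real_of_int (head 0 v)" using vertex_shape V y v by auto
    have "ip d (ivec a) (vertex v) \<le> ip d (ivec a) (vertex y) \<longleftrightarrow>
        real_of_int (dot d a (tl v)) * real_of_int (head 0 y)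
          \<le> real_of_int (dot d a (tl y)) * real_of_int (head 0 v)"
      unfolding ip_vertex[OF V v a] ip_vertex[OF V y a] using p by (simp add: field_simps)
    also have "\<dots> \<longleftrightarrow> dot d a (tl v) * head 0 y \<le> dot d a (tl y) * head 0 v"
      by (metis of_int_le_iff of_int_mult)
    finally show ?thesis by blast
  qed
  then show ?thesis unfolding maximal_def by auto
qed

text \<open>
  The value of the support function of the polytope in direction \<open>a\<close>.
\<close>

definition support :: "int list \<Rightarrow> int list list \<Rightarrow> real"
  where "support a V = real_of_int (fst (height d a V)) / real_of_int (snd (height d a V))"

lemma height_properties:
  assumes V: "V \<in> set VV" and a: "length a = d"
  shows "0 < snd (height d a V)"
    and "\<exists>v\<in>vertex ` set V. support a V = ip d (ivec a) v"
    and "\<And>v. v \<in> vertex ` set V \<Longrightarrow> ip d (ivec a) v \<le> support a V"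
proof -
  define y where "y = head [] (filter (maximal d a V) V)"
  have "vertex ` set V \<noteq> {}" using V VV_index pts(3) unfolding pts_def by metis
  then obtain v where v: "v \<in> vertex ` set V" "\<forall>w\<in>vertex ` set V. ip d (ivec a) w \<le> ip d (ivec a) v"
    using finite_argmax[of "vertex ` set V" "ip d (ivec a)"] by auto
  then obtain y0 where "y0 \<in> set V" "maximal d a V y0" using maximal_iff[OF V _ a] by auto
  then have "filter (maximal d a V) V \<noteq> []" by (auto simp: filter_empty_conv)
  then have "y \<in> set (filter (maximal d a V) V)"
    unfolding y_def by (cases "filter (maximal d a V) V") auto
  then have y: "y \<in> set V" "maximal d a V y" by auto
  have h: "height d a V = (dot d a (tl y), head 0 y)" by (simp add: height_def y_def Let_def)
  show "0 < snd (height d a V)" using h vertex_shape[OF V y(1)] by simp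
  have s: "support a V = ip d (ivec a) (vertex y)" unfolding support_def ip_vertex[OF V y(1) a] by (simp add: h)
  then show "\<exists>v\<in>vertex ` set V. support a V = ip d (ivec a) v" using y by blast
  show "ip d (ivec a) v \<le> support a V" if "v \<in> vertex ` set V" for v
    unfolding s using that y(2) maximal_iff[OF V y(1) a] by blast
qed

definition represents :: "ineq \<Rightarrow> point \<Rightarrow> (nat \<Rightarrow> real) \<Rightarrow> bool" where
  "represents c a h \<longleftrightarrow> length (fst c) = d + n \<and> blocks (lin (fst c)) (of_rat (snd c)) a h"

lemma normal_ineq_represents:
  assumes a: "length a = d"
  shows "\<exists>Q>0. represents (normal_ineq d VV a) (Q *\<^sub>R ivec a) (\<lambda>i. Q * support a (VV ! i))"
proof -
  define L where "L = map (height d a) VV"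
  define Q where "Q = real_of_int (prod_list (map snd L))"
  let ?a = "map (\<lambda>x. prod_list (map snd L) * x) a"
  have c: "normal_ineq d VV a = cayley_ineq ?a (cleared L)" by (simp add: normal_ineq_def L_def Let_def)
  have "0 < prod_list (map snd L)" by (rule prod_list_pos) (auto simp: L_def height_properties(1)[OF _ a])
  then have Q: "0 < Q" by (simp add: Q_def)
  have len: "length ?a = d" "length (cleared L) = Suc n" using a length_VV by (simp_all add: L_def)
  have va: "ivec ?a = Q *\<^sub>R ivec a" by (rule point_eqI) (simp add: coord_vec Q_def)
  have hs: "real_of_int (cleared L ! i) = Q * support a (VV ! i)" if i: "i \<le> n" for i
  proof -
    have il: "i < length L" "L ! i = height d a (VV ! i)" using i length_VV by (simp_all add: L_def)
    have "snd (L ! i) \<noteq> 0" using height_properties(1)[OF VV_nth[OF i] a] il by simp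
    from clear_nth_real[OF il(1) this] show ?thesis unfolding il(2) support_def Q_def .
  qed
  have "blocks (lin (fst (normal_ineq d VV a))) (of_rat (snd (normal_ineq d VV a))) (Q *\<^sub>R ivec a) (\<lambda>i. Q *
    support a (VV ! i))"
    unfolding blocks_def c
  proof (intro ballI allI impI)
    fix x i assume x: "x \<in> Rn d" "i \<le> n"
    show "lin (fst (cayley_ineq ?a (cleared L))) (lift d x i) - of_rat (snd (cayley_ineq ?a (cleared L)))
        = ip d (Q *\<^sub>R ivec a) x - Q * support a (VV ! i)"
      unfolding lin_cayley_ineq[OF len x] va hs[OF x(2)] ..
  qed
  moreover have "length (fst (normal_ineq d VV a)) = d + n" unfolding c by (rule length_cayley_ineq[OF len])
  ultimately show ?thesis using Q unfolding represents_def by blast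
qed

lemma simplex_ineqs_represent:
  "c \<in> set (simplex_ineqs d VV) \<Longrightarrow> \<exists>k\<le>n. represents c 0 (\<lambda>i. of_bool (i = k))"
  "k \<le> n \<Longrightarrow> \<exists>c\<in>set (simplex_ineqs d VV). represents c 0 (\<lambda>i. of_bool (i = k))"
proof -
  define hs where "hs k = map (\<lambda>r. if fst r = fst (number VV ! k) then 1 else 0 :: int) (number VV)" for k
  define c where "c k = cayley_ineq (replicate d 0) (hs k)" for k
  have len: "length (replicate d (0::int)) = d" "length (hs k) = Suc n"
    for k by (simp_all add: hs_def length_VV)
  have hs: "real_of_int (hs k ! i) = of_bool (i = k)" if "k \<le> n" "i \<le> n" for k i
  proof -
    have "fst (number VV ! i) = fst (number VV ! k) \<longleftrightarrow> i = k"
      using nth_eq_iff_index_eq[OF distinct_number[of VV], of i k] that length_VV by simp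
    then show ?thesis using that length_VV by (simp add: hs_def)
  qed
  have v0: "ivec (replicate d 0) = 0" by (rule point_eqI) (simp add: coord_vec)
  have rep: "represents (c k) 0 (\<lambda>i. of_bool (i = k))" if k: "k \<le> n" for k
    unfolding represents_def blocks_def
  proof (intro conjI ballI allI impI)
    show "length (fst (c k)) = d + n" unfolding c_def by (rule length_cayley_ineq[OF len])
    fix x i assume x: "x \<in> Rn d" "i \<le> n"
    show "lin (fst (c k)) (lift d x i) - of_rat (snd (c k)) = ip d 0 x - of_bool (i = k)"
      unfolding c_def lin_cayley_ineq[OF len x] v0 hs[OF k x(2)] ..
  qed
  have set: "set (simplex_ineqs d VV) = c ` {..n}"
  proof -
    have "set (simplex_ineqs d VV) = (\<lambda>p. cayley_ineq (replicate d 0) (map (\<lambda>r. if fst r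
      = fst p then 1 else 0) (number VV))) ` set (number VV)"
      by (simp add: simplex_ineqs_def)
    also have "set (number VV) = (\<lambda>k. number VV ! k) ` {..n}"
      unfolding set_conv_nth using length_VV by (auto simp: less_Suc_eq_le)
    finally show ?thesis by (simp add: image_image c_def hs_def)
  qed
  show "c' \<in> set (simplex_ineqs d VV) \<Longrightarrow> \<exists>k\<le>n. represents c' 0 (\<lambda>i. of_bool (i = k))" for c'
    unfolding set using rep by auto
  show "k \<le> n \<Longrightarrow> \<exists>c\<in>set (simplex_ineqs d VV). represents c 0 (\<lambda>i. of_bool (i = k))" for k
    unfolding set using rep by auto
qed

abbreviation edge :: "int list \<Rightarrow> int list \<Rightarrow> int list"
  where "edge y y' \<equiv> lincomb d (head 0 y) (tl y') (- head 0 y') (tl y)"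

lemma in_differences:
  "e \<in> set (concat (map (differences d) VV)) \<longleftrightarrow> (\<exists>V\<in>set VV. \<exists>y\<in>set V. \<exists>y'\<in>set V. e = (edge y y', y, V))"
  unfolding differences_def by auto

lemma edge_orthogonal_iff:
  assumes V: "V \<in> set VV" and y: "y \<in> set V" "y' \<in> set V"
  shows "ip d (ivec (edge y y')) z = 0 \<longleftrightarrow> ip d z (vertex y') = ip d z (vertex y)"
proof -
  have p: "0 < real_of_int (head 0 y)" "0 < real_of_int (head 0 y')"
    and l: "length (tl y) = d" "length (tl y') = d" using vertex_shape[OF V] y by auto
  have "ivec (edge y y') = real_of_int (head 0 y) *\<^sub>R ivec (tl y') - real_of_int (head 0 y') *\<^sub>R ivec (tl y)"
    unfolding vec_comb[OF l(2,1)] by simp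
  also have "\<dots> = (real_of_int (head 0 y) * real_of_int (head 0 y')) *\<^sub>R (vertex y' - vertex y)"
    using p by (simp add: vertex_def scaleR_diff_right)
  finally have "ip d (ivec (edge y y')) z
    = (real_of_int (head 0 y) * real_of_int (head 0 y')) * ip d z (vertex y' - vertex y)"
    using ip_commute[of d "ivec (edge y y')" z] by (simp only: ip_scale)
  then show ?thesis using p by (auto simp: ip_diff)
qed

lemma in_normals:
  "a \<in> set (normals d VV) \<longleftrightarrow> (\<exists>t a0. length t = d - 1 \<and> set t \<subseteq> set (concat (map (differences d) VV)) \<and>
     orth_basis d (d - 1) (map fst t) = [a0] \<and> (a = a0 \<or> a = map uminus a0) \<and>
     (\<forall>e\<in>set t. maximal d a (snd (snd e)) (fst (snd e))))" (is "?l \<longleftrightarrow> ?r")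
proof
  assume ?l
  then obtain t where t: "length t = d - 1" "set t \<subseteq> set (concat (map (differences d) VV))"
    "tl (orth_basis d (d - 1) (map fst t)) = []" "a \<in> set (plus_minus (orth_basis d (d - 1) (map fst t)))"
    "\<forall>e\<in>set t. maximal d a (snd (snd e)) (fst (snd e))"
    unfolding normals_def Let_def set_concat set_map
      by (auto simp only: in_tuples split: if_splits) (auto simp: in_tuples split: if_splits)
  then show ?r by (cases "orth_basis d (d - 1) (map fst t)") (auto simp: plus_minus_def)
next
  assume ?r
  then obtain t a0 where t: "t \<in> set (tuples (d - 1) (concat (map (differences d) VV)))"
    "orth_basis d (d - 1) (map fst t) = [a0]" "a = a0 \<or> a = map uminus a0"
    "\<forall>e\<in>set t. maximal d a (snd (snd e)) (fst (snd e))" using in_tuples by blast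
  then show ?l unfolding normals_def Let_def set_concat set_map
    by (intro UN_I[OF imageI[OF t(1)]]) (auto simp: plus_minus_def)
qed

text \<open>
  The chosen differences lie in the faces on which \<open>a\<close> is maximal, so the normal of a functional
  that vanishes on the tight points is orthogonal to all of them and hence a multiple of \<open>a\<close>. The
  heights are then determined because every block contains a tight vertex.
\<close>

lemma normals_facet:
  assumes "a \<in> set (normals d VV)"
  shows "length a = d" "block_facet (ivec a) (\<lambda>i. support a (VV ! i))"
proof -
  obtain t a0 where t: "length t = d - 1" "set t \<subseteq> set (concat (map (differences d) VV))"
    and o: "orth_basis d (d - 1) (map fst t) = [a0]" and a: "a = a0 \<or> a = map uminus a0"
    and m: "\<forall>e\<in>set t. maximal d a (snd (snd e)) (fst (snd e))"
    using assms in_normals by blast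
  have "length (fst e) = d" if "e \<in> set t" for e
    using t(2) that in_differences[of e] by force
  then have "\<forall>u\<in>set (map fst t). length u = d" by simp
  then have B: "int_basis d [a0] (complement d (fst ` set t))"
    using int_basis_orth[of "map fst t" "d - 1" d] t(1) o by simp
  then have a0: "length a0 = d" "ivec a0 \<noteq> 0" "complement d (fst ` set t) = span {ivec a0}"
    using dependent_zero by (auto simp: int_basis_def)
  show la: "length a = d" using a a0 by auto
  have "ivec a = ivec a0 \<or> ivec a = - ivec a0" using a vec_uminus by auto
  then have va: "ivec a \<noteq> 0" "complement d (fst ` set t) = span {ivec a}" "ivec a \<in> Rn d"
    using a0 la vec_in_Rn by (auto simp: span_singleton image_iff) (metis scaleR_minus_left scaleR_minus_right
      minus_minus)+
  show "block_facet (ivec a) (\<lambda>i. support a (VV ! i))"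
  proof (rule block_facetI)
    show "ip d (ivec a) v \<le> support a (VV ! i)" if "i \<le> n" "v \<in> pts i" for i v
      using height_properties(3)[OF VV_nth[OF that(1)] la] that(2) by (simp add: pts_def)
    then have le: "\<And>i v. i \<le> n \<Longrightarrow> v \<in> pts i \<Longrightarrow> ip d (ivec a) v \<le> support a (VV ! i)" .
    show "\<exists>i\<le>n. \<exists>v\<in>pts i. ip d (ivec a) v < support a (VV ! i)"
    proof (rule ccontr)
      assume no: "\<not> ?thesis"
      have eq: "ip d (ivec a) v = support a (VV ! 0)" if "v \<in> pts 0" for v
        using le[of 0 v] no that by force
      have "ip d (ivec a) x = support a (VV ! 0)" if "x \<in> Rn d" for x
        by (rule linear_const_affine_hull[OF linear_ip eq]) (use that pts(2)[of 0] in auto)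
      from this[OF va(3)] this[OF subspace_0[OF subspace_Rn]] have "ip d (ivec a) (ivec a) = 0"
        by (simp add: ip_0)
      then show False using ip_self_eq_0[OF va(3)] va(1) by blast
    qed
    fix z h' assume z: "z \<in> Rn d"
      and tight: "\<And>i v. i \<le> n \<Longrightarrow> v \<in> pts i \<Longrightarrow> ip d (ivec a) v = support a (VV ! i) \<Longrightarrow> ip d z v = h' i"
    have "ip d (ivec (fst e)) z = 0" if e: "e \<in> set t" for e
    proof -
      obtain V y y' where V: "V \<in> set VV" and y: "y \<in> set V" "y' \<in> set V" and e': "e = (edge y y', y, V)"
        using t(2) e in_differences by blast
      obtain i where i: "i \<le> n" "V = VV ! i" using VV_index[OF V] by blast
      have p: "vertex y \<in> pts i" "vertex y' \<in> pts i" using y i by (auto simp: pts_def)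
      have "maximal d a V y" using m e e' by auto
      then have "ip d (ivec a) v \<le> ip d (ivec a) (vertex y)" if "v \<in> vertex ` set V" for v
        using maximal_iff[OF V y(1) la] that by blast
      then have "support a V \<le> ip d (ivec a) (vertex y)" using height_properties(2)[OF V la] by force
      then have ty: "ip d (ivec a) (vertex y) = support a V" using le[OF i(1) p(1)] i by simp
      have "ivec a \<in> complement d (fst ` set t)" using va(2) by (simp add: span_base)
      then have "ip d (ivec (edge y y')) (ivec a) = 0" using e e' by (force simp: complement_def)
      then have "ip d (ivec a) (vertex y') = support a V" using edge_orthogonal_iff[OF V y] ty by simp
      then have "ip d z (vertex y') = ip d z (vertex y)" using tight[OF i(1)] p ty i by simp
      then show ?thesis using edge_orthogonal_iff[OF V y] e' by simp
    qed
    then have "z \<in> complement d (fst ` set t)" using z by (auto simp: complement_def)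
    then obtain k where k: "z = k *\<^sub>R ivec a" unfolding va(2) span_singleton by auto
    have "h' i = k * support a (VV ! i)" if i: "i \<le> n" for i
    proof -
      obtain v where v: "v \<in> pts i" "support a (VV ! i) = ip d (ivec a) v"
        using height_properties(2)[OF VV_nth[OF i] la] by (auto simp: pts_def)
      then have "h' i = ip d z v" using tight[OF i] by simp
      then show ?thesis using v k by (simp add: ip_scale_left)
    qed
    then have "\<forall>x\<in>Rn d. \<forall>i\<le>n. ip d z x - h' i = k * (ip d (ivec a) x - support a (VV ! i))"
      by (simp add: k ip_scale_left right_diff_distrib)
    then show "\<exists>k. \<forall>x\<in>Rn d. \<forall>i\<le>n. ip d z x - h' i = k * (ip d (ivec a) x - support a (VV ! i))" by blast
  qed
qed

text \<open>
  If block \<open>k\<close> had no tight vertex, \<open>\<lambda>\<^sub>k\<close> would vanish on all tight points and thus be a multiple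
  of the given functional, which has a nonzero normal.
\<close>

lemma block_facet_tight_vertex:
  assumes bf: "block_facet a h" and a: "a \<in> Rn d" "a \<noteq> 0" and k: "k \<le> n"
  shows "\<exists>v\<in>pts k. ip d a v = h k"
proof (rule ccontr)
  assume no: "\<not> ?thesis"
  have z0: "0 \<in> Rn d" using subspace_0[OF subspace_Rn] .
  have "\<exists>c. \<forall>x\<in>Rn d. \<forall>i\<le>n. ip d 0 x - of_bool (i = k) = c * (ip d a x - h i)"
    by (rule block_facetD(3)[OF bf z0]) (use no in \<open>auto simp: ip_0_left\<close>)
  then obtain c where c: "\<And>x. x \<in> Rn d \<Longrightarrow> - 1 = c * (ip d a x - h k)" using k by (force simp: ip_0_left)
  have "c * ip d a a = 0" using c[OF z0] c[OF a(1)] by (simp add: ip_0 algebra_simps)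
  moreover have "c \<noteq> 0" using c[OF z0] by auto
  ultimately show False using ip_self_eq_0[OF a(1)] a(2) by simp
qed

text \<open>
  For \<open>a = 0\<close> the functional is compared with \<open>\<lambda>\<^sub>k\<close> for a block \<open>k\<close> with positive height, in which
  no vertex is tight. For \<open>a \<noteq> 0\<close>, a vector \<open>z\<close> orthogonal to the differences of tight vertices
  within each block has constant values on the tight vertices of a block; with these values as
  heights it vanishes on all tight points, so it is a multiple of \<open>a\<close>. Hence the complement of the
  differences is the line through \<open>a\<close>, and the greedy choice finds \<open>d - 1\<close> of them that produce
  \<open>a\<close> up to a scalar.
\<close>

lemma block_facet_listed:
  assumes bf: "block_facet a h" and a: "a \<in> Rn d"
  shows "\<exists>c\<in>set (cayley_facets d VV). \<exists>a' h' r. represents c a' h' \<and> 0 < r \<and>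
    (\<forall>x\<in>Rn d. \<forall>i\<le>n. ip d a' x - h' i = r * (ip d a x - h i))"
proof (cases "a = 0")
  case True
  have z0: "0 \<in> Rn d" using subspace_0[OF subspace_Rn] .
  obtain k where k: "k \<le> n" "0 < h k" using block_facetD(2)[OF bf] True by (auto simp: ip_0_left)
  have "\<exists>c. \<forall>x\<in>Rn d. \<forall>i\<le>n. ip d 0 x - of_bool (i = k) = c * (ip d a x - h i)"
    by (rule block_facetD(3)[OF bf z0]) (use True k in \<open>auto simp: ip_0_left\<close>)
  then obtain c where c: "\<forall>x\<in>Rn d. \<forall>i\<le>n. ip d 0 x - of_bool (i = k) = c * (ip d a x - h i)" by blast
  then have "ip d 0 0 - of_bool (k = k) = c * (ip d a 0 - h k)" using z0 k by blast
  then have "c * h k = 1" by (simp add: ip_0)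
  then have cp: "0 < c" using k(2) by (metis zero_less_mult_pos2 zero_less_one)
  obtain c' where "c' \<in> set (simplex_ineqs d VV)" "represents c' 0 (\<lambda>i. of_bool (i = k))"
    using simplex_ineqs_represent(2)[OF k(1)] by blast
  then show ?thesis using c cp unfolding cayley_facets_def by (intro bexI[of _ c']) auto
next
  case False
  define tight where "tight i y \<longleftrightarrow> y \<in> set (VV ! i) \<and> ip d a (vertex y) = h i" for i y
  define E where "E = {(edge y y', y, VV ! i) | i y y'. i \<le> n \<and> tight i y \<and> tight i y'}"
  have tight_ex: "\<exists>y. tight i y" if "i \<le> n" for i
    using block_facet_tight_vertex[OF bf a False that] by (auto simp: pts_def tight_def)
  have edge_orth: "ip d (ivec (edge y y')) z = 0 \<longleftrightarrow> ip d z (vertex y') = ip d z (vertex y)"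
    if "i \<le> n" "tight i y" "tight i y'" for i y y' z
    using edge_orthogonal_iff[OF VV_nth[OF that(1)]] that by (simp add: tight_def)
  have line: "complement d (fst ` E) = span {a}"
  proof
    have "a \<in> complement d (fst ` E)"
      using a edge_orth by (auto simp: complement_def E_def tight_def)
    moreover have "subspace (complement d (fst ` E))"
      using subspace_Rn unfolding complement_def subspace_def by (auto simp: ip_0 ip_add ip_scale)
    ultimately show "span {a} \<subseteq> complement d (fst ` E)" by (intro span_minimal) auto
    show "complement d (fst ` E) \<subseteq> span {a}"
    proof
      fix z assume z: "z \<in> complement d (fst ` E)"
      then have zR: "z \<in> Rn d" by (simp add: complement_def)
      obtain y0 where y0: "\<And>i. i \<le> n \<Longrightarrow> tight i (y0 i)" using tight_ex by metis
      define h' where "h' i = ip d z (vertex (y0 i))" for i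
      have "\<exists>k. \<forall>x\<in>Rn d. \<forall>i\<le>n. ip d z x - h' i = k * (ip d a x - h i)"
      proof (rule block_facetD(3)[OF bf zR])
        fix i v assume i: "i \<le> n" and v: "v \<in> pts i" "ip d a v = h i"
        then obtain y where y: "tight i y" "v = vertex y" by (auto simp: pts_def tight_def)
        have "edge (y0 i) y \<in> fst ` E" using i y(1) y0[OF i] by (force simp: E_def)
        then have "ip d (ivec (edge (y0 i) y)) z = 0" using z by (auto simp: complement_def)
        then show "ip d z v = h' i" using edge_orth[OF i y0[OF i] y(1)] y(2) by (simp add: h'_def)
      qed
      then obtain k where k: "\<And>x i. x \<in> Rn d \<Longrightarrow> i \<le> n \<Longrightarrow> ip d z x - h' i = k * (ip d a x - h i)" by blast
      have z0: "0 \<in> Rn d" using subspace_0[OF subspace_Rn] .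
      have "ip d z x = ip d (k *\<^sub>R a) x" if "x \<in> Rn d" for x
        using k[OF that, of 0] k[OF z0, of 0] by (simp add: ip_0 ip_scale_left algebra_simps)
      then have "z = k *\<^sub>R a"
        using zR a subspace_scale[OF subspace_Rn] by (intro ip_eq_imp_eq) auto
      then show "z \<in> span {a}" by (simp add: span_base span_scale)
    qed
  qed
  have "\<forall>u\<in>fst ` E. length u = d" by (auto simp: E_def)
  then obtain t a0 c where t: "set t \<subseteq> fst ` E" "length t = d - 1" "orth_basis d (d - 1) t = [a0]"
    "length a0 = d" "a = c *\<^sub>R ivec a0"
    using exists_tuple_spanning_line[OF d _ line False] by blast
  obtain s where s: "set s \<subseteq> E" "map fst s = t" using lists_of_image[OF t(1)] by blast
  have c0: "c \<noteq> 0" using t(5) False by auto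
  \<comment> \<open>\<open>orth_basis\<close> determines the normal only up to sign\<close>
  define a' where "a' = (if 0 < c then a0 else map uminus a0)"
  have la: "length a' = d" using t(4) by (simp add: a'_def)
  have aa': "a = \<bar>c\<bar> *\<^sub>R ivec a'" using t(5) by (simp add: a'_def vec_uminus)
  have ip': "ip d (ivec a') x = ip d a x / \<bar>c\<bar>" for x unfolding aa' ip_scale_left using c0 by simp
  have max: "maximal d a' (VV ! i) y" if i: "i \<le> n" and y: "tight i y" for i y
    using maximal_iff[OF VV_nth[OF i] _ la, of y] y block_facetD(1)[OF bf i] c0
    unfolding tight_def ip' pts_def by (simp add: divide_right_mono)
  have "a' \<in> set (normals d VV)"
    unfolding in_normals
  proof (intro exI conjI ballI)
    show "length s = d - 1" using s t by (metis length_map)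
    show "set s \<subseteq> set (concat (map (differences d) VV))"
      using s(1) VV_nth unfolding subset_iff in_differences E_def tight_def by fastforce
    show "orth_basis d (d - 1) (map fst s) = [a0]" using s t by simp
    show "a' = a0 \<or> a' = map uminus a0" by (simp add: a'_def)
    show "maximal d a' (snd (snd e)) (fst (snd e))" if "e \<in> set s" for e
      using that s(1) max by (auto simp: E_def)
  qed
  then have mem: "normal_ineq d VV a' \<in> set (cayley_facets d VV)" by (simp add: cayley_facets_def)
  obtain Q where Q: "0 < Q" "represents (normal_ineq d VV a') (Q *\<^sub>R ivec a') (\<lambda>i. Q * support a' (VV ! i))"
    using normal_ineq_represents[OF la] by blast
  have sup: "support a' (VV ! i) = h i / \<bar>c\<bar>" if i: "i \<le> n" for i
  proof (rule antisym)
    obtain v where v: "v \<in> pts i" "support a' (VV ! i) = ip d (ivec a') v"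
      using height_properties(2)[OF VV_nth[OF i] la] by (auto simp: pts_def)
    then show "support a' (VV ! i) \<le> h i / \<bar>c\<bar>"
      using block_facetD(1)[OF bf i v(1)] by (simp add: ip' divide_right_mono)
    obtain y where y: "tight i y" using tight_ex[OF i] by blast
    then have "ip d (ivec a') (vertex y) = h i / \<bar>c\<bar>" by (simp add: ip' tight_def)
    moreover have "ip d (ivec a') (vertex y) \<le> support a' (VV ! i)"
      using height_properties(3)[OF VV_nth[OF i] la] y by (simp add: tight_def)
    ultimately show "h i / \<bar>c\<bar> \<le> support a' (VV ! i)" by simp
  qed
  have "ip d (Q *\<^sub>R ivec a') x - Q * support a' (VV ! i) = (Q / \<bar>c\<bar>) * (ip d a x - h i)" if "i \<le> n" for x i
    by (simp add: ip_scale_left ip' sup[OF that] diff_divide_distrib right_diff_distrib)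
  then show ?thesis using mem Q c0
    by (intro bexI[OF _ mem] exI[of _ "Q *\<^sub>R ivec a'"] exI[of _ "\<lambda>i. Q * support a' (VV ! i)"] exI[of _ "Q /
      \<bar>c\<bar>"]) auto
qed

lemma listed_facet_functional:
  assumes "c \<in> set (cayley_facets d VV)"
  shows "length (fst c) = d + n" "facet_functional X W (lin (fst c)) (of_rat (snd c))"
proof -
  have "\<exists>a h. represents c a h \<and> block_facet a h"
  proof (cases "c \<in> set (simplex_ineqs d VV)")
    case True
    then show ?thesis using simplex_ineqs_represent(1) block_facet_simplex by blast
  next
    case False
    then obtain a where a: "a \<in> set (normals d VV)" "c = normal_ineq d VV a"
      using assms by (auto simp: cayley_facets_def)
    then show ?thesis using normal_ineq_represents[OF normals_facet(1)[OF a(1)]]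
        block_facet_scale[OF normals_facet(2)[OF a(1)]] by blast
  qed
  then show "length (fst c) = d + n" "facet_functional X W (lin (fst c)) (of_rat (snd c))"
    using facet_functional_iff_block_facet[OF linear_lin] unfolding represents_def by blast+
qed

lemma facet_functional_listed:
  assumes ff: "facet_functional X W f b"
  shows "\<exists>c\<in>set (cayley_facets d VV). \<exists>r>0. \<forall>y\<in>X. lin (fst c) y - of_rat (snd c) = r * (f y - b)"
proof -
  have f: "linear f" using ff by (simp add: facet_functional_def)
  obtain a h where a: "a \<in> Rn d" and ab: "blocks f b a h" using blocks_exist[OF f] by blast
  have "block_facet a h" using facet_functional_iff_block_facet[OF f ab] ff by simp
  then obtain c a' h' r where c: "c \<in> set (cayley_facets d VV)" "represents c a' h'" "0 < r"
    and r: "\<forall>x\<in>Rn d. \<forall>i\<le>n. ip d a' x - h' i = r * (ip d a x - h i)"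
    using block_facet_listed[OF _ a] by blast
  have "lin (fst c) y - of_rat (snd c) = r * (f y - b)" if y: "y \<in> X" for y
  proof (rule proportional_on_lifts[OF f linear_lin _ y])
    fix x i assume x: "x \<in> Rn d" "i \<le> n"
    have "lin (fst c) (lift d x i) - of_rat (snd c) = ip d a' x - h' i"
      using c(2) x by (simp add: represents_def blocks_def)
    moreover have "f (lift d x i) - b = ip d a x - h i" using ab x by (simp add: blocks_def)
    ultimately show "lin (fst c) (lift d x i) - of_rat (snd c) = r * (f (lift d x i) - b)" using r x by simp
  qed
  then show ?thesis using c by blast
qed

theorem cayley_facets_correct: "facet_describing (d + n) (cayley_facets d VV) (convex hull W)"
proof -
  let ?S = "cayley_facets d VV" and ?D = "convex hull W"
  have DX: "?D \<subseteq> X" using W_subset subspace_Rn by (simp add: hull_minimal subspace_imp_convex)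
  have Xspan: "X = span (std_basis (d + n))" using span_std_basis by simp
  have X0: "X \<noteq> {0}"
  proof
    assume "X = {0}"
    moreover have "Poly_Mapping.single 0 1 \<in> X" using d by (simp add: Rn_def coord_simps lookup_one)
    ultimately have "coord (Poly_Mapping.single 0 1) 0 = coord 0 0" by simp
    then show False by simp
  qed
  have valid: "lin (fst c) x \<le> of_rat (snd c)" if c: "c \<in> set ?S" and x: "x \<in> ?D" for c x
    using listed_facet_functional(2)[OF c] linear_le_convex_hull[OF linear_lin _ x, of "fst c"]
    by (simp add: facet_functional_def)
  have sol: "solutions (d + n) ?S = ?D"
  proof (intro set_eqI iffI)
    fix x assume "x \<in> ?D"
    then show "x \<in> solutions (d + n) ?S" using valid DX by (auto simp: solutions_def)
  next
    fix x assume x: "x \<in> solutions (d + n) ?S"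
    then have xX: "x \<in> X" by (simp add: solutions_def)
    show "x \<in> ?D"
    proof (rule facet_functionals_describe_hull[OF finite_W affine_hull_W xX])
      fix f b assume "facet_functional X W f b"
      then obtain c r where c: "c \<in> set ?S" "0 < r" "\<forall>y\<in>X. lin (fst c) y - of_rat (snd c) = r * (f y - b)"
        using facet_functional_listed by blast
      have "lin (fst c) x \<le> of_rat (snd c)" using x c(1) by (auto simp: solutions_def)
      then have "r * (f x - b) \<le> 0" using c(3) xX by force
      then show "f x \<le> b" using c(2) by (simp add: mult_le_0_iff)
    qed
  qed
  have desc: "describes_facet c {x \<in> ?D. lin (fst c) x = of_rat (snd c)} ?D" if c: "c \<in> set ?S" for c
    unfolding describes_facet_def
    using valid[OF c] facet_functional_facet[OF listed_facet_functional(2)[OF c] finite_std_basis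
        independent_std_basis Xspan affine_hull_W X0] by blast
  have "\<exists>c\<in>set ?S. describes_facet c F ?D" if F: "facet F ?D" for F
  proof -
    obtain f b where f: "facet_functional X W f b" "F = {x \<in> ?D. f x = b}"
      using facet_has_functional[OF F finite_W affine_hull_W finite_std_basis independent_std_basis Xspan]
        by blast
    obtain c r where c: "c \<in> set ?S" "0 < r" "\<forall>y\<in>X. lin (fst c) y - of_rat (snd c) = r * (f y - b)"
      using facet_functional_listed[OF f(1)] by blast
    have "lin (fst c) x = of_rat (snd c) \<longleftrightarrow> f x = b" if "x \<in> ?D" for x
      using c(2,3) that DX by (metis eq_iff_diff_eq_0 mult_eq_0_iff order_less_irrefl subset_iff)
    then have "{x \<in> ?D. lin (fst c) x = of_rat (snd c)} = F" unfolding f(2) by blast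
    then show ?thesis using desc[OF c(1)] c(1) by metis
  qed
  then show ?thesis
    unfolding facet_describing_def has_columns_def using sol desc listed_facet_functional(1) by fastforce
qed

end

theorem theorem11:
  fixes d :: nat
  assumes "d \<ge> 1"
  shows "poly_time_solvable enc_instance enc_system (valid_instance d)
    (\<lambda>(n, Ss) S. facet_describing (d + n) S (cayley d n (\<lambda>i. solutions d (Ss ! i))))"
proof (rule ptime_solvable[OF ptime_algorithm[of d]])
  fix inst :: "nat \<times> ineq list list"
  assume v: "valid_instance d inst"
  obtain n Ss where inst: "inst = (n, Ss)" by (cases inst)
  have nSs: "1 \<le> n" "length Ss = Suc n" using v by (simp_all add: valid_instance_def inst)
  have S: "has_columns d (Ss ! i)" "polytope (solutions d (Ss ! i))" "affdim (solutions d (Ss ! i)) = int d"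
    if "i \<le> n" for i using v that by (auto simp: valid_instance_def inst)
  define VV where "VV = map (vertices d) Ss"
  have idx: "\<exists>i\<le>n. V = vertices d (Ss ! i)" if "V \<in> set VV" for V
  proof -
    from that obtain i where "i < length VV" "V = VV ! i" by (auto simp: in_set_conv_nth)
    then show ?thesis using nSs(2) by (auto simp: VV_def less_Suc_eq_le)
  qed
  have hull: "solutions d (Ss ! i) = convex hull (vertex ` set (vertices d (Ss ! i)))" if "i \<le> n" for i
    by (rule polytope_hull_of_vertices[OF S(1,2)[OF that]])
  interpret vertex_lists d n VV
  proof
    show "1 \<le> d" "1 \<le> n" "length VV = Suc n" using assms nSs by (simp_all add: VV_def)
    fix V assume "V \<in> set VV"
    then obtain i where i: "i \<le> n" "V = vertices d (Ss ! i)" using idx by blast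
    show "length y = Suc d \<and> 0 < head 0 y" if "y \<in> set V" for y
      using that in_vertices[OF S(1)[OF i(1)]] i(2) by blast
    have "affine hull (solutions d (Ss ! i)) = Rn d"
      by (rule affine_hull_full_dim) (use S(3)[OF i(1)] in \<open>auto simp: solutions_def\<close>)
    then show "affine hull (vertex ` set V) = Rn d" unfolding hull[OF i(1)] i(2) by simp
  qed
  have nth: "VV ! i = vertices d (Ss ! i)" if "i \<le> n" for i using that nSs by (simp add: VV_def)
  have lift_hull: "{lift d x i |x. x \<in> convex hull A} = convex hull ((\<lambda>v. lift d v i) ` A)" for i A
  proof -
    have "(\<lambda>v. lift d v i) ` B = (\<lambda>x. lift d 0 i + x) ` B" for B
      by (rule image_cong[OF refl]) (metis add.commute lift_add)
    moreover have "{lift d x i |x. x \<in> convex hull A} = (\<lambda>v. lift d v i) ` (convex hull A)" by auto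
    ultimately show ?thesis by (simp only: convex_hull_translation)
  qed
  have "cayley d n (\<lambda>i. solutions d (Ss ! i)) = convex hull W"
  proof
    have "(\<Union>i\<in>{0..n}. {lift d x i |x. x \<in> solutions d (Ss ! i)}) \<subseteq> convex hull W"
    proof (rule UN_least)
      fix i assume "i \<in> {0..n}"
      then have i: "i \<le> n" by simp
      have "(\<lambda>v. lift d v i) ` pts i \<subseteq> W" using i by (auto simp: W_def)
      then show "{lift d x i |x. x \<in> solutions d (Ss ! i)} \<subseteq> convex hull W"
        unfolding hull[OF i] lift_hull pts_def nth[OF i] by (rule hull_mono)
    qed
    then show "cayley d n (\<lambda>i. solutions d (Ss ! i)) \<subseteq> convex hull W"
      unfolding cayley_def by (rule hull_minimal) simp
    have "W \<subseteq> (\<Union>i\<in>{0..n}. {lift d x i |x. x \<in> solutions d (Ss ! i)})"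
    proof
      fix w assume "w \<in> W"
      then obtain i v where i: "i \<le> n" and v: "v \<in> pts i" "w = lift d v i" using in_W by blast
      have "v \<in> solutions d (Ss ! i)" unfolding hull[OF i] using v(1) nth[OF i] by (simp add: pts_def hull_inc)
      then show "w \<in> (\<Union>i\<in>{0..n}. {lift d x i |x. x \<in> solutions d (Ss ! i)})" using i v(2) by auto
    qed
    then show "convex hull W \<subseteq> cayley d n (\<lambda>i. solutions d (Ss ! i))"
      unfolding cayley_def by (rule hull_mono)
  qed
  then show "(\<lambda>(n, Ss) S. facet_describing (d + n) S (cayley d n (\<lambda>i. solutions d (Ss ! i)))) inst
      (cayley_facets d (map (vertices d) (snd inst)))"
    using cayley_facets_correct by (simp add: inst VV_def)
qed

end
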